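(* Let $\xi\in\mathbb{Z}^+$, $\Xi=\{1,\ldots,\xi\}$, and let $(Y,S)$ and $(Y_i,S_i)$, $i\in\mathbb{Z}^+$, be $M\times\Xi$-valued random elements on a probability space $(\Omega,\mathcal{F},P)$. For $n\in\mathbb{Z}^+$ and $s\in\Xi$ put $N_n^s=\sum_{i=1}^n I\{S_i=s\}$. Assume: (i) the pairs $(Y_i,S_i)$, $i\in\mathbb{Z}^+$, are independent; (ii) for every $i\in\mathbb{Z}^+$ and every $s\in\Xi$ with $P(S_i=s)P(S=s)>0$, the conditional distribution of $Y_i$ given $S_i=s$ equals the conditional distribution of $Y$ given $S=s$; (iii) $\lim_{n\to\infty}N_n^s=\infty$ almost surely for every $s\in\Xi$; (iv) $P(S=s)>0$ for every $s\in\Xi$. Suppose $d\in\mathbb{Z}^+$, $M=\mathbb{R}^d$ and $E(\lVert Y\rVert^2\mid S=s)<\infty$ for all $s\in\Xi$. Denote the covariance matrices by $\Sigma^s:=\mathrm{Cov}(Y\mid S=s)$ for all $s\in\Xi$. For each $n\in\mathbb{Z}^+$ let $\hat\lambda_n^s\in[0,1]$ ($s\in\Xi$) be random variables satisfying $\sum_{s=1}^\xi\hat\lambda_n^s=1$. Assume that $\hat\lambda_n^s=P(S=s)+o_p(n^{-1/2})$ as $n\to\infty$, and that $\lim_{n\to\infty}N_n^s/n=f_s$ for some $f_s\in(0,1)$, for all $s\in\Xi$. Let $$\hat\mu_n:=\sum_{s=1}^\xi\hat\lambda_n^s\,\hat\mu^s_{N_n^s},\qquad \hat\mu_m^s:=\frac1m\sum_{j=1}^m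 Y_{(j)}^s\quad(m\in\mathbb{Z}^+),$$ where $Y_{(j)}^s$ is the variable of interest for the $j$th sampled unit from group $s$ (defined in the context). (a) As $n\to\infty$, $$n^{1/2}(\hat\mu_n-E(Y))\rightsquigarrow N\bigg(0,\ \sum_{s=1}^\xi\frac{P(S=s)^2}{f_s}\Sigma^s\bigg).$$ (b) As $n\to\infty$, $$P\bigg(n\big(\hat\mu_n-E(Y)\big)^T\Big(\sum_{s=1}^\xi\frac{n(\hat\lambda_n^s)^2}{N_n^s}\hat\Sigma_n^s\Big)^{-1}\big(\hat\mu_n-E(Y)\big)<\chi^2_{1-\alpha,d}\bigg)\to1-\alpha,$$ where $\chi^2_{1-\alpha,d}$ is the $(1-\alpha)$-quantile of the $\chi^2_d$-distribution, and $$\hat\Sigma_n^s:=\frac{1}{N_n^s-1}\sum_{j=1}^{N_n^s}\big(Y_{(j)}^s-\hat\mu^s_{N_n^s}\big)\big(Y_{(j)}^s-\hat\mu^s_{N_n^s}\big)^T.$$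
   Context: $I\{\cdot\}$ denotes an indicator function, $\lVert\cdot\rVert$ the standard Euclidean norm, $\rightsquigarrow$ convergence in distribution, $\alpha$ a number in $(0,1)$, and $\chi^2_d$ the chi-squared distribution with $d$ degrees of freedom. $\Xi$ carries its discrete $\sigma$-algebra. For $s\in\Xi$ let $\Omega^s=\{\lim_{n\to\infty}N_n^s=\infty\}$. For $s\in\Xi$ and $j\in\mathbb{Z}^+$ define $K_j^s$ as follows: on $\Omega^s$, $K_j^s$ is the smallest $k\in\mathbb{Z}^+$ with $\sum_{i=1}^k I\{S_i=s\}=j$ (that is, the $j$th positive integer $i$ for which $S_i=s$); on $(\Omega^s)^c$, $K_j^s=1$. Then $Y_{(j)}^s:=Y_{K_j^s}$. $\hat\lambda_n^s=P(S=s)+o_p(n^{-1/2})$ means $n^{1/2}(\hat\lambda_n^s-P(S=s))\to0$ in probability.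
   Formalization: Part (b) is proved under the added assumption that the limiting covariance matrix, the sum over s of P(S=s)^2/f_s times Sigma^s, is invertible; when it is singular, the random matrix inverted in (b) is almost surely singular, so its inverse does not exist. *)

theory Defs
  imports "HOL-Probability.Probability"
begin

text \<open>
  The law of \<open>m + A Z\<close>, where \<open>Z\<close> has independent standard normal coordinates and
  \<open>A\<close> is any square matrix with \<open>A A\<^sup>T = V\<close>.  For positive semidefinite \<open>V\<close>
  such an \<open>A\<close> exists and the law does not depend on which one is chosen; degenerate (singular) \<open>V\<close>
  is covered.  For other \<open>V\<close> the value is unspecified.
\<close>
definition multivariate_normal :: "real^'d \<Rightarrow> real^'d^'d \<Rightarrow> (real^'d) measure" where
  "multivariate_normal m V =
     distr (\<Pi>\<^sub>M i\<in>(UNIV :: 'd set). density lborel std_normal_density) borel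
       (\<lambda>z. m + (SOME A :: real^'d^'d. A ** transpose A = V) *v (\<chi> i. z i))"

definition chi_squared :: "nat \<Rightarrow> real measure" where
  "chi_squared d =
     distr (\<Pi>\<^sub>M i\<in>{..<d}. density lborel std_normal_density) borel (\<lambda>z. \<Sum>i<d. (z i)\<^sup>2)"

definition quantile :: "real measure \<Rightarrow> real \<Rightarrow> real" where
  "quantile \<mu> p = Inf {x. p \<le> cdf \<mu> x}"

definition converges_in_probability_to_0 :: "'a measure \<Rightarrow> (nat \<Rightarrow> 'a \<Rightarrow> real) \<Rightarrow> bool" where
  "converges_in_probability_to_0 P X \<longleftrightarrow>
     (\<forall>\<epsilon>>0. (\<lambda>n. \<P>(\<omega> in P. \<bar>X n \<omega>\<bar> > \<epsilon>)) \<longlonglongrightarrow> 0)"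

definition converges_in_distribution ::
    "'a measure \<Rightarrow> (nat \<Rightarrow> 'a \<Rightarrow> real^'d) \<Rightarrow> (real^'d) measure \<Rightarrow> bool" where
  "converges_in_distribution P X \<mu> \<longleftrightarrow>
     (\<forall>n. X n \<in> borel_measurable P) \<and>
     (\<forall>g :: real^'d \<Rightarrow> real. continuous_on UNIV g \<longrightarrow> bounded (range g) \<longrightarrow>
        (\<lambda>n. \<integral>\<omega>. g (X n \<omega>) \<partial>P) \<longlonglongrightarrow> (\<integral>x. g x \<partial>\<mu>))"

definition given_group :: "'a measure \<Rightarrow> ('a \<Rightarrow> nat) \<Rightarrow> nat \<Rightarrow> 'a measure" where
  "given_group P S s = uniform_measure P {\<omega> \<in> space P. S \<omega> = s}"

definition outer_product :: "real^'d \<Rightarrow> real^'d \<Rightarrow> real^'d^'d" where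
  "outer_product v w = (\<chi> i j. v $ i * w $ j)"

definition covariance_matrix :: "'a measure \<Rightarrow> ('a \<Rightarrow> real^'d) \<Rightarrow> real^'d^'d" where
  "covariance_matrix Q Y =
     (\<chi> i j. \<integral>\<omega>. (Y \<omega> $ i - (\<integral>\<omega>'. Y \<omega>' $ i \<partial>Q)) * (Y \<omega> $ j - (\<integral>\<omega>'. Y \<omega>' $ j \<partial>Q)) \<partial>Q)"

text \<open>
  Units and sample sizes are numbered from \<open>1\<close>; the values \<open>Y 0\<close> and \<open>S 0\<close> of the sequences
  \<open>Y\<close> and \<open>S\<close> are never used.
\<close>

definition group_count :: "(nat \<Rightarrow> 'a \<Rightarrow> nat) \<Rightarrow> nat \<Rightarrow> nat \<Rightarrow> 'a \<Rightarrow> nat" where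
  "group_count S s n \<omega> = (\<Sum>i=1..n. of_bool (S i \<omega> = s))"

definition sample_index :: "(nat \<Rightarrow> 'a \<Rightarrow> nat) \<Rightarrow> nat \<Rightarrow> nat \<Rightarrow> 'a \<Rightarrow> nat" where
  "sample_index S s j \<omega> =
     (if filterlim (\<lambda>n. group_count S s n \<omega>) at_top sequentially
      then (LEAST k. 1 \<le> k \<and> group_count S s k \<omega> = j) else 1)"

definition group_sample ::
    "(nat \<Rightarrow> 'a \<Rightarrow> 'm) \<Rightarrow> (nat \<Rightarrow> 'a \<Rightarrow> nat) \<Rightarrow> nat \<Rightarrow> nat \<Rightarrow> 'a \<Rightarrow> 'm" where
  "group_sample Y S s j \<omega> = Y (sample_index S s j \<omega>) \<omega>"

definition group_mean ::
    "(nat \<Rightarrow> 'a \<Rightarrow> real^'d) \<Rightarrow> (nat \<Rightarrow> 'a \<Rightarrow> nat) \<Rightarrow> nat \<Rightarrow> nat \<Rightarrow> 'a \<Rightarrow> real^'d" where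
  "group_mean Y S s m \<omega> = (1 / real m) *\<^sub>R (\<Sum>j=1..m. group_sample Y S s j \<omega>)"

definition group_covariance ::
    "(nat \<Rightarrow> 'a \<Rightarrow> real^'d) \<Rightarrow> (nat \<Rightarrow> 'a \<Rightarrow> nat) \<Rightarrow> nat \<Rightarrow> nat \<Rightarrow> 'a \<Rightarrow> real^'d^'d" where
  "group_covariance Y S s n \<omega> =
     (let N = group_count S s n \<omega>; c = group_mean Y S s N \<omega>
      in (1 / (real N - 1)) *\<^sub>R
           (\<Sum>j=1..N. outer_product (group_sample Y S s j \<omega> - c) (group_sample Y S s j \<omega> - c)))"

definition weighted_mean ::
    "nat \<Rightarrow> (nat \<Rightarrow> nat \<Rightarrow> 'a \<Rightarrow> real) \<Rightarrow> (nat \<Rightarrow> 'a \<Rightarrow> real^'d) \<Rightarrow> (nat \<Rightarrow> 'a \<Rightarrow> nat)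
      \<Rightarrow> nat \<Rightarrow> 'a \<Rightarrow> real^'d" where
  "weighted_mean \<xi> l Y S n \<omega> =
     (\<Sum>s=1..\<xi>. l n s \<omega> *\<^sub>R group_mean Y S s (group_count S s n \<omega>) \<omega>)"

definition weighted_covariance ::
    "nat \<Rightarrow> (nat \<Rightarrow> nat \<Rightarrow> 'a \<Rightarrow> real) \<Rightarrow> (nat \<Rightarrow> 'a \<Rightarrow> real^'d) \<Rightarrow> (nat \<Rightarrow> 'a \<Rightarrow> nat)
      \<Rightarrow> nat \<Rightarrow> 'a \<Rightarrow> real^'d^'d" where
  "weighted_covariance \<xi> l Y S n \<omega> =
     (\<Sum>s=1..\<xi>. (real n * (l n s \<omega>)\<^sup>2 / real (group_count S s n \<omega>)) *\<^sub>R group_covariance Y S s n \<omega>)"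

end

theory Submission
  imports Defs "HOL-Real_Asymp.Real_Asymp"
begin

text \<open>
  With \<open>T\<^sup>s\<^sub>n = (\<Sum>i\<le>n. I{S\<^sub>i = s} (Y\<^sub>i - \<mu>\<^sup>s))\<close> the normalised error of the estimator differs from
  \<open>Z\<^sub>n = n\<^sup>-\<^sup>1\<^sup>/\<^sup>2 (\<Sum>s. (P(S = s) / f\<^sub>s) T\<^sup>s\<^sub>n)\<close> by a term tending to \<open>0\<close> in probability, because
  \<open>n\<^sup>-\<^sup>1\<^sup>/\<^sup>2 T\<^sup>s\<^sub>n\<close> is tight.  The random group sizes thus disappear, and no random-index limit theorem
  is needed: \<open>Z\<^sub>n\<close> is a normalised sum of independent centred vectors, and each summand is a mixture
  of the same finitely many laws.  Its characteristic function is therefore a product of mixtures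
  that can be expanded to second order uniformly in the summands.  Weak convergence in
  \<open>\<real>\<^sup>d\<close> follows from convergence of characteristic functions and tightness by approximating
  test functions by trigonometric polynomials.  For the second part, the weak law of large numbers
  (again by characteristic functions) makes the estimated covariance consistent, and the quadratic
  form in the inverse of the covariance of a Gaussian vector is the sum of squares of the standard
  normal coordinates it is built from.
\<close>

section \<open>Linear algebra and trigonometric polynomials\<close>

text \<open>The obstacle is that \<open>group_mean\<close> adds a random number of draws, picked by
  indices that depend on the whole label sequence. Where the counts diverge, the first N members of
  a stratum are exactly the units i \<le> n carrying that label, so every sum over draws becomes a
  sum over i \<le> n with an indicator, and the law of a single \<open>group_sample\<close> is never
  computed. The labels may have different laws; in the limit only the averages of P(S_i = s) over i
  \<le> n enter, and taking expectations in N/n -> f_s shows that these tend to f_s. The factor P(S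
  = s)/f_s reflects N ~ n f_s in the denominator of the mean; since a fraction f_s of the summands
  contributes, the variance carries f_s (P(S = s)/f_s)^2 = P(S = s)^2/f_s. As \<open>V\<close> may
  be singular, the Gaussian limit is handled through a factor A with A A^T = V and not through a
  density. In the second part \<open>V\<close> is invertible, so the estimated covariance is
  eventually invertible along almost surely convergent subsequences.\<close>

lemma psd_zero_diagonal:
  fixes V :: "real^'d^'d"
  assumes sym: "\<And>i j. V$i$j = V$j$i" and psd: "\<And>x. 0 \<le> x \<bullet> (V *v x)" and "V$k$k = 0"
  shows "V$k$j = 0"
proof -
  have ax: "V *v axis i 1 = (\<chi> l. V$l$i)" for i
    by (simp add: matrix_vector_mult_basis column_def)
  \<comment> \<open>The form at s e_k + e_j is affine in \<open>s\<close>, because the coefficient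
    of s^2 is \<open>V$k$k = 0\<close>; an affine function that is bounded below on the whole line
    is constant.\<close>
  have q: "0 \<le> V$j$j + 2 * s * V$k$j" for s
  proof -
    have "V *v (s *\<^sub>R axis k 1 + axis j 1) = s *\<^sub>R (\<chi> l. V$l$k) + (\<chi> l. V$l$j)"
      by (simp add: matrix_vector_right_distrib ax matrix_vector_mult_scaleR)
    then have "(s *\<^sub>R axis k 1 + axis j 1) \<bullet> (V *v (s *\<^sub>R axis k 1 + axis j 1)) =
        s * (s * V$k$k) + s * V$k$j + (s * V$j$k + V$j$j)"
      by (simp add: inner_axis' algebra_simps)
    then show ?thesis
      using psd[of "s *\<^sub>R axis k 1 + axis j 1"] assms(3) sym[of j k] by simp
  qed
  show ?thesis
  proof (rule ccontr)
    assume ne: "V$k$j \<noteq> 0"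
    have "2 * (- (V$j$j + 1) / (2 * V$k$j)) * V$k$j = - (V$j$j + 1)"
      using ne by simp
    with q[of "- (V$j$j + 1) / (2 * V$k$j)"] show False by simp
  qed
qed

text \<open>The form of the Schur complement at \<open>x\<close> is the minimum of the form of
  \<open>V\<close> over the line x - a e_k. The minimiser is a = (V x)_k / V_kk, which is the vector
  \<open>y\<close> below.\<close>

lemma psd_schur_complement:
  fixes V :: "real^'d^'d"
  assumes sym: "\<And>i j. V$i$j = V$j$i" and psd: "\<And>x. 0 \<le> x \<bullet> (V *v x)" and k: "V$k$k > 0"
  shows "0 \<le> x \<bullet> ((\<chi> i j. V$i$j - V$i$k * V$j$k / V$k$k) *v x)"
proof -
  define c where "c = V$k$k"
  define v where "v = (\<chi> l. V$l$k)"
  define w where "w = v \<bullet> x"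
  have c0: "c > 0" using k by (simp add: c_def)
  have ax: "V *v axis k 1 = v"
    by (simp add: v_def matrix_vector_mult_basis column_def)
  have vk: "v $ k = c" by (simp add: v_def c_def)
  have w: "(V *v x) $ k = w"
    by (simp add: w_def v_def matrix_vector_mult_def inner_vec_def sym[of k])
  have m: "(\<chi> i j. V$i$j - V$i$k * V$j$k / V$k$k) *v x = V *v x - (w / c) *\<^sub>R v"
    by (simp add: w_def v_def c_def vec_eq_iff matrix_vector_mult_def inner_vec_def left_diff_distrib
        right_diff_distrib sum_subtractf sum_distrib_left sum_distrib_right sum_divide_distrib mult_ac)
  have xv: "x \<bullet> v = w" by (simp add: inner_commute w_def)
  define y where "y = x - (w / c) *\<^sub>R axis k 1"
  have Vy: "V *v y = V *v x - (w / c) *\<^sub>R v"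
    by (simp add: y_def matrix_vector_mult_diff_distrib matrix_vector_mult_scaleR ax)
  have "y \<bullet> (V *v y) = x \<bullet> (V *v x) - (w / c) * w - (w / c) * (w - (w / c) * c)"
    unfolding Vy by (simp add: y_def inner_diff_left inner_diff_right inner_axis' w xv vk)
  also have "\<dots> = x \<bullet> (V *v x - (w / c) *\<^sub>R v)" using c0 by (simp add: inner_diff_right xv)
  finally show ?thesis using psd[of y] unfolding m by simp
qed

text \<open>Cholesky elimination, one pivot per step. A positive pivot \<open>k\<close> puts the
  column V_ik / sqrt V_kk into \<open>A\<close> and leaves the Schur complement, which vanishes in
  row and column \<open>k\<close>; a zero pivot is skipped, its row being zero already, so singular
  \<open>V\<close> is covered. The support conditions keep column \<open>k\<close> of the
  recursively built \<open>A\<close> free for the new entries.\<close>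

lemma psd_factorization_on:
  fixes V :: "real^'d^'d"
  assumes "finite I"
    and "\<And>i j. V$i$j = V$j$i" and "\<And>x. 0 \<le> x \<bullet> (V *v x)" and "\<And>i j. i \<notin> I \<Longrightarrow> V$i$j = 0"
  shows "\<exists>A :: real^'d^'d. (\<forall>i j. j \<notin> I \<longrightarrow> A$i$j = 0) \<and> A ** transpose A = V"
  using assms
proof (induction I arbitrary: V rule: finite_induct)
  case empty
  then have "V = 0" by (simp add: vec_eq_iff)
  then show ?case by (intro exI[of _ 0]) (simp add: matrix_matrix_mult_def vec_eq_iff)
next
  case (insert k I)
  note sym = insert.prems(1) and psd = insert.prems(2) and supp = insert.prems(3)
  have kk: "V$k$k \<ge> 0"
    using psd[of "axis k 1"] by (simp add: inner_axis' matrix_vector_mult_basis column_def)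
  show ?case
  proof (cases "V$k$k = 0")
    case True
    have "V$i$j = 0" if "i \<notin> I" for i j
      using psd_zero_diagonal[OF sym psd True] supp that by (cases "i = k") auto
    from insert.IH[OF sym psd this] show ?thesis by blast
  next
    case False
    with kk have c: "V$k$k > 0" by simp
    define W where "W = (\<chi> i j. V$i$j - V$i$k * V$j$k / V$k$k)"
    have "W$i$j = 0" if "i \<notin> I" for i j
      using supp[of i] that c sym[of j k] by (cases "i = k") (auto simp: W_def)
    moreover have "W$i$j = W$j$i" for i j
      by (simp add: W_def sym[of i j] mult.commute)
    moreover have "0 \<le> x \<bullet> (W *v x)" for x
      unfolding W_def by (rule psd_schur_complement[OF sym psd c])
    ultimately obtain A :: "real^'d^'d" where
      A: "\<And>i j. j \<notin> I \<Longrightarrow> A$i$j = 0" "A ** transpose A = W"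
      using insert.IH[of W] by blast
    define A' where "A' = (\<chi> i j. if j = k then V$i$k / sqrt (V$k$k) else A$i$j)"
    have AA: "(\<Sum>l\<in>UNIV. A$i$l * A$j$l) = W$i$j" for i j
      using A(2) by (auto simp: vec_eq_iff matrix_matrix_mult_def transpose_def)
    have "(\<Sum>l\<in>UNIV. A'$i$l * A'$j$l) = V$i$j" for i j
    proof -
      have "(\<Sum>l\<in>UNIV. A'$i$l * A'$j$l) =
          A'$i$k * A'$j$k + (\<Sum>l\<in>UNIV - {k}. A'$i$l * A'$j$l)"
        by (simp add: sum.remove)
      also have "A'$i$k * A'$j$k = V$i$k * V$j$k / V$k$k"
        using c by (simp add: A'_def)
      also have "(\<Sum>l\<in>UNIV - {k}. A'$i$l * A'$j$l) = (\<Sum>l\<in>UNIV - {k}. A$i$l * A$j$l)"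
        by (intro sum.cong) (auto simp: A'_def)
      also have "\<dots> = (\<Sum>l\<in>UNIV. A$i$l * A$j$l)"
        using A(1)[of k] insert.hyps by (intro sum.mono_neutral_left) auto
      finally show ?thesis by (simp add: AA W_def)
    qed
    then have "A' ** transpose A' = V"
      by (simp add: vec_eq_iff matrix_matrix_mult_def transpose_def)
    moreover have "A'$i$j = 0" if "j \<notin> insert k I" for i j
      using that A(1) by (simp add: A'_def)
    ultimately show ?thesis by blast
  qed
qed

lemma psd_factorization:
  fixes V :: "real^'d^'d"
  assumes "\<And>i j. V$i$j = V$j$i" and "\<And>x. 0 \<le> x \<bullet> (V *v x)"
  shows "\<exists>A :: real^'d^'d. A ** transpose A = V"
  using psd_factorization_on[of UNIV V] assms by auto

section \<open>Continuity and measurability of the matrix inverse\<close>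

text \<open>Through this formula the entries of the inverse are rational in the entries of
  \<open>M\<close>, so that continuity and measurability of inversion reduce to those of
  determinants.\<close>

lemma matrix_inv_cramer:
  fixes M :: "real^'d^'d"
  assumes "det M \<noteq> 0"
  shows "matrix_inv M $ i $ j = det (\<chi> k l. if l = i then axis j 1 $ k else M $ k $ l) / det M"
proof -
  have inv: "invertible M" using assms by (simp add: invertible_det_nz)
  have "M ** matrix_inv M = mat 1"
    using someI_ex[OF inv[unfolded invertible_def]] by (simp add: matrix_inv_def)
  then have "M *v (matrix_inv M *v axis j 1) = axis j 1"
    by (simp add: matrix_vector_mul_assoc)
  then have "matrix_inv M *v axis j 1 =
      (\<chi> k. det (\<chi> i l. if l = k then axis j 1 $ i else M $ i $ l) / det M)"
    using cramer[OF assms] by blast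
  moreover have "(matrix_inv M *v axis j 1) $ i = matrix_inv M $ i $ j"
    by (simp add: matrix_vector_mult_basis column_def)
  ultimately show ?thesis by simp
qed

text \<open>
  On singular matrices the choice in \<^const>\<open>matrix_inv\<close> is from the empty predicate, hence constant;
  this is why the inverse of the estimated covariance is measurable although it need not exist.
\<close>
lemma matrix_inv_singular:
  fixes M :: "real^'d^'d"
  assumes "det M = 0"
  shows "matrix_inv M = (SOME A. False)"
proof -
  have "\<not> invertible M" using assms by (simp add: invertible_det_nz)
  then have "(\<lambda>A. M ** A = mat 1 \<and> A ** M = mat 1) = (\<lambda>A. False)"
    by (auto simp: invertible_def)
  then show ?thesis unfolding matrix_inv_def by simp
qed

lemma tendsto_det:
  fixes M :: "'x \<Rightarrow> real^'d^'d"
  assumes "\<And>i j. ((\<lambda>x. M x $ i $ j) \<longlongrightarrow> L $ i $ j) F"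
  shows "((\<lambda>x. det (M x)) \<longlongrightarrow> det L) F"
  unfolding det_def by (intro tendsto_intros assms)

lemma borel_measurable_det [measurable]:
  fixes M :: "'a \<Rightarrow> real^'d^'d"
  assumes [measurable]: "\<And>i j. (\<lambda>x. M x $ i $ j) \<in> borel_measurable Q"
  shows "(\<lambda>x. det (M x)) \<in> borel_measurable Q"
  unfolding det_def by measurable

lemma tendsto_matrix_inv:
  fixes M :: "'x \<Rightarrow> real^'d^'d"
  assumes lim: "\<And>i j. ((\<lambda>x. M x $ i $ j) \<longlongrightarrow> L $ i $ j) F" and inv: "invertible L"
  shows "((\<lambda>x. matrix_inv (M x) $ i $ j) \<longlongrightarrow> matrix_inv L $ i $ j) F"
proof -
  have dL: "det L \<noteq> 0" using inv by (simp add: invertible_det_nz)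
  have dlim: "((\<lambda>x. det (M x)) \<longlongrightarrow> det L) F" by (rule tendsto_det[OF lim])
  have "((\<lambda>x. (if l = i then axis j 1 $ k else M x $ k $ l)) \<longlongrightarrow>
      (if l = i then axis j 1 $ k else L $ k $ l)) F" for k l
    using lim by (cases "l = i") auto
  then have "((\<lambda>x. det (\<chi> k l. if l = i then axis j 1 $ k else M x $ k $ l) / det (M x)) \<longlongrightarrow>
      det (\<chi> k l. if l = i then axis j 1 $ k else L $ k $ l) / det L) F"
    by (intro tendsto_divide dlim dL tendsto_det) auto
  moreover have "\<forall>\<^sub>F x in F. det (\<chi> k l. if l = i then axis j 1 $ k else M x $ k $ l) / det (M x)
      = matrix_inv (M x) $ i $ j"
    using tendsto_imp_eventually_ne[OF dlim dL] by eventually_elim (simp add: matrix_inv_cramer)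
  ultimately show ?thesis
    unfolding matrix_inv_cramer[OF dL] by (rule Lim_transform_eventually)
qed

lemma borel_measurable_matrix_inv:
  fixes M :: "'a \<Rightarrow> real^'d^'d"
  assumes M [measurable]: "\<And>i j. (\<lambda>x. M x $ i $ j) \<in> borel_measurable Q"
  shows "(\<lambda>x. matrix_inv (M x) $ i $ j) \<in> borel_measurable Q"
proof -
  have [measurable]: "(\<lambda>x. det (\<chi> k l. if l = i then axis j 1 $ k else M x $ k $ l)) \<in> borel_measurable Q"
    by (rule borel_measurable_det) (auto simp del: M intro!: M)
  have eq: "matrix_inv (M x) $ i $ j = (if det (M x) = 0 then (SOME A :: real^'d^'d. False) $ i $ j
      else det (\<chi> k l. if l = i then axis j 1 $ k else M x $ k $ l) / det (M x))" for x
    by (simp add: matrix_inv_cramer matrix_inv_singular)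
  show ?thesis unfolding eq by measurable
qed

section \<open>Trigonometric polynomials and approximation on the torus\<close>

text \<open>Monomials and sums suffice as generators: constants are the case \<open>t = 0\<close>,
  and products stay inside because frequencies add. Induction over this definition reduces every
  statement about expectations to a single characteristic function value.\<close>

inductive trig_poly :: "('a::real_inner \<Rightarrow> complex) \<Rightarrow> bool" where
  monomial: "trig_poly (\<lambda>x. c * cis (t \<bullet> x))"
| add: "trig_poly g \<Longrightarrow> trig_poly h \<Longrightarrow> trig_poly (\<lambda>x. g x + h x)"

lemma trig_poly_const: "trig_poly (\<lambda>x. c)"
  using trig_poly.monomial[of c 0] by simp

lemma trig_poly_cmult: "trig_poly g \<Longrightarrow> trig_poly (\<lambda>x. c * g x)"
proof (induction rule: trig_poly.induct)
  case (monomial d t)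
  then show ?case using trig_poly.monomial[of "c * d" t] by (simp add: mult.assoc)
next
  case (add g h)
  then show ?case using trig_poly.add by (fastforce simp: distrib_left)
qed

lemma trig_poly_mult:
  assumes "trig_poly g" "trig_poly h"
  shows "trig_poly (\<lambda>x. g x * h x)"
  using assms(1)
proof (induction rule: trig_poly.induct)
  case (monomial c t)
  from assms(2) show ?case
  proof (induction rule: trig_poly.induct)
    case (monomial d u)
    have "(\<lambda>x. c * cis (t \<bullet> x) * (d * cis (u \<bullet> x))) = (\<lambda>x. (c * d) * cis ((t + u) \<bullet> x))"
      by (simp add: inner_add_left cis_mult[symmetric] mult_ac)
    then show ?case using trig_poly.monomial by metis
  next
    case (add g h)
    then show ?case using trig_poly.add by (fastforce simp: distrib_left)
  qed
next
  case (add g1 g2)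
  then show ?case using trig_poly.add by (fastforce simp: distrib_right)
qed

lemma trig_poly_sum:
  "(\<And>i. i \<in> I \<Longrightarrow> trig_poly (g i)) \<Longrightarrow> trig_poly (\<lambda>x. \<Sum>i\<in>I. g i x)"
  by (induction I rule: infinite_finite_induct) (auto intro: trig_poly_const trig_poly.add)

lemma trig_poly_scale: "trig_poly g \<Longrightarrow> trig_poly (\<lambda>x. g (c *\<^sub>R x))"
proof (induction rule: trig_poly.induct)
  case (monomial d t)
  then show ?case using trig_poly.monomial[of d "c *\<^sub>R t"] by simp
qed (auto intro: trig_poly.add)

lemma trig_poly_cos: "trig_poly (\<lambda>x. of_real (cos (t \<bullet> x)))"
proof -
  have "trig_poly (\<lambda>x. (1/2) * cis (t \<bullet> x) + (1/2) * cis ((- t) \<bullet> x))"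
    by (intro trig_poly.intros)
  moreover have "(\<lambda>x. (1/2) * cis (t \<bullet> x) + (1/2) * cis ((- t) \<bullet> x)) = (\<lambda>x. complex_of_real (cos (t \<bullet> x)))"
    by (auto simp: fun_eq_iff complex_eq_iff)
  ultimately show ?thesis by simp
qed

lemma trig_poly_sin: "trig_poly (\<lambda>x. of_real (sin (t \<bullet> x)))"
proof -
  have "trig_poly (\<lambda>x. (-\<i>/2) * cis (t \<bullet> x) + (\<i>/2) * cis ((- t) \<bullet> x))"
    by (intro trig_poly.intros)
  moreover have "(\<lambda>x. (-\<i>/2) * cis (t \<bullet> x) + (\<i>/2) * cis ((- t) \<bullet> x)) = (\<lambda>x. complex_of_real (sin (t \<bullet> x)))"
    by (auto simp: fun_eq_iff complex_eq_iff)
  ultimately show ?thesis by simp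
qed

text \<open>The torus is placed in a Euclidean space, so that the Stone-Weierstrass theorem for
  polynomials applies to its compact subsets.\<close>

definition torus_map :: "real^'d \<Rightarrow> complex^'d" where
  "torus_map x = (\<chi> i. cis (x $ i))"

text \<open>A real-linear functional of the point with coordinates e^(i x_j) is a real combination
  of cos x_j and sin x_j, and trigonometric polynomials form an algebra.\<close>

lemma trig_poly_torus_polynomial:
  fixes p :: "complex^'d \<Rightarrow> real"
  assumes "real_polynomial_function p"
  shows "trig_poly (\<lambda>x. of_real (p (torus_map x)))"
  using assms
proof (induction rule: real_polynomial_function.induct)
  case (linear f)
  then have f: "linear f" by (rule bounded_linear.linear)
  have eq: "of_real (f (torus_map x)) =
      (\<Sum>i\<in>UNIV. of_real (f (axis i 1)) * of_real (cos (axis i 1 \<bullet> x))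
        + of_real (f (axis i \<i>)) * complex_of_real (sin (axis i 1 \<bullet> x)))" for x
  proof -
    have "torus_map x = (\<Sum>i\<in>UNIV. cos (x $ i) *\<^sub>R axis i 1 + sin (x $ i) *\<^sub>R axis i \<i>)"
    proof (intro vec_eq_iff[THEN iffD2] allI)
      fix j
      have "(\<Sum>i\<in>UNIV. cos (x $ i) *\<^sub>R axis i 1 + sin (x $ i) *\<^sub>R axis i \<i>) $ j
          = (\<Sum>i\<in>UNIV. if i = j then cis (x $ j) else 0)"
        unfolding sum_component
        by (intro sum.cong) (auto simp: axis_def complex_eq_iff)
      then show "torus_map x $ j = (\<Sum>i\<in>UNIV. cos (x $ i) *\<^sub>R axis i 1 + sin (x $ i) *\<^sub>R axis i \<i>) $ j"
        by (simp add: torus_map_def)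
    qed
    then have "f (torus_map x) = (\<Sum>i\<in>UNIV. cos (x $ i) * f (axis i 1) + sin (x $ i) * f (axis i \<i>))"
      by (simp add: linear_sum[OF f] linear_add[OF f] linear_scale[OF f])
    then show ?thesis by (simp add: inner_axis' mult.commute)
  qed
  show ?case unfolding eq
    by (intro trig_poly_sum trig_poly.add trig_poly_cmult trig_poly_cos trig_poly_sin)
qed (auto intro: trig_poly_const trig_poly.add trig_poly_mult)

text \<open>
  A continuous function that vanishes off the open cube descends to a function on the torus.  Its
  graph is a continuous image of the closed cube, hence compact, which gives continuity there.
\<close>
lemma trig_poly_approx_cube:
  fixes g :: "real^'d \<Rightarrow> real"
  assumes cont: "continuous_on UNIV g" and van: "\<And>x. (\<exists>i. \<bar>x $ i\<bar> \<ge> pi) \<Longrightarrow> g x = 0"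
    and e: "e > 0"
  obtains T :: "real^'d \<Rightarrow> real" where "trig_poly (\<lambda>x. of_real (T x))"
    and "\<And>x. (\<And>i. \<bar>x $ i\<bar> \<le> pi) \<Longrightarrow> \<bar>T x - g x\<bar> < e"
    and "\<And>x. \<exists>y. (\<forall>i. \<bar>y $ i\<bar> \<le> pi) \<and> T x = T y"
proof -
  define K :: "(real^'d) set" where "K = {x. \<forall>i. \<bar>x $ i\<bar> \<le> pi}"
  have "K = cbox (\<chi> i. - pi) (\<chi> i. pi)"
    by (auto simp: K_def mem_box_cart abs_le_iff minus_le_iff)
  then have cK: "compact K" by simp
  define G :: "complex^'d \<Rightarrow> real" where "G z = g (\<chi> i. Arg (z $ i))" for z
  have cT: "continuous_on UNIV (torus_map :: real^'d \<Rightarrow> complex^'d)"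
    unfolding torus_map_def cis_conv_exp by (intro continuous_intros)
  \<comment> \<open>\<open>Arg\<close> takes values in (-pi, pi], so it inverts \<open>cis\<close>
    except on the faces x_i = -pi, which it sends to x_i = pi. There both sides are 0, because
    \<open>g\<close> vanishes on all faces.\<close>
  have GT: "G (torus_map x) = g x" if "x \<in> K" for x
  proof (cases "\<exists>i. x $ i = - pi")
    case True
    then obtain i where i: "x $ i = - pi" by blast
    have "Arg (cis (x $ i)) = pi" 
      unfolding i by (rule cis_Arg_unique) (auto simp: complex_eq_iff sgn_cis)
    then have "\<bar>(\<chi> j. Arg (torus_map x $ j)) $ i\<bar> \<ge> pi" by (simp add: torus_map_def)
    then have "G (torus_map x) = 0" unfolding G_def by (intro van exI)
    moreover have "g x = 0" by (intro van exI[of _ i]) (simp add: i)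
    ultimately show ?thesis by simp
  next
    case False
    have "Arg (cis (x $ i)) = x $ i" for i
    proof (rule cis_Arg_unique)
      show "- pi < x $ i" using that False by (auto simp: K_def abs_le_iff less_le minus_le_iff)
      show "x $ i \<le> pi" using that by (auto simp: K_def abs_le_iff)
    qed (simp add: sgn_cis)
    then show ?thesis by (simp add: G_def torus_map_def)
  qed
  have "compact (torus_map ` K)"
    by (rule compact_continuous_image[OF continuous_on_subset[OF cT] cK]) simp
  have "compact ((\<lambda>x. (torus_map x, g x)) ` K)"
    by (intro compact_continuous_image cK continuous_on_Pair continuous_on_subset[OF cT]
        continuous_on_subset[OF cont]) auto
  also have "(\<lambda>x. (torus_map x, g x)) ` K = (\<lambda>z. (z, G z)) ` torus_map ` K"
    using GT by (auto simp: image_iff)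
  finally have clo: "closed ((\<lambda>z. (z, G z)) ` torus_map ` K)"
    by (rule compact_imp_closed)
  have "compact (g ` K)"
    by (rule compact_continuous_image[OF continuous_on_subset[OF cont] cK]) simp
  then have "continuous_on (torus_map ` K) G"
    by (rule continuous_from_closed_graph[OF _ _ clo]) (use GT in auto)
  then obtain p where p: "real_polynomial_function p"
    "\<And>z. z \<in> torus_map ` K \<Longrightarrow> \<bar>G z - p z\<bar> < e"
    using Stone_Weierstrass_real_polynomial_function[OF \<open>compact (torus_map ` K)\<close> _ e] by metis
  show ?thesis
  proof
    show "trig_poly (\<lambda>x. of_real (p (torus_map x)))"
      by (rule trig_poly_torus_polynomial[OF p(1)])
    show "\<bar>p (torus_map x) - g x\<bar> < e" if "\<And>i. \<bar>x $ i\<bar> \<le> pi" for x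
      using p(2)[of "torus_map x"] GT[of x] that by (auto simp: K_def abs_minus_commute)
    fix x :: "real^'d"
    \<comment> \<open>Periodicity: each coordinate is moved into (-pi, pi] without changing the
      torus point. This is what later bounds the approximant far away from the cube.\<close>
    let ?y = "\<chi> i. Arg (cis (x $ i))"
    have "cis (Arg (cis a)) = cis a" for a
      using cis_Arg[of "cis a"] by (simp add: sgn_cis)
    then have "torus_map ?y = torus_map x" by (simp add: torus_map_def)
    moreover have "\<bar>?y $ i\<bar> \<le> pi" for i
      using Arg_bounded[of "cis (x $ i)"] by (auto simp: abs_le_iff)
    ultimately show "\<exists>y. (\<forall>i. \<bar>y $ i\<bar> \<le> pi) \<and> p (torus_map x) = p (torus_map y)"
      by (intro exI[of _ ?y]) auto
  qed
qed

text \<open>\<open>g\<close> is cut off continuously between the radii \<open>R\<close> and R' = |R|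
  + 1 and rescaled by \<open>c = R' / pi\<close>, so that the ball of radius R' fits into the cube
  of half-width pi and the cut-off function vanishes off its interior. The cut-off does not increase
  the bound \<open>B\<close>; periodicity of the approximant then extends the bound
  \<open>B + e\<close> from the cube to the whole space.\<close>

lemma trig_poly_approx:
  fixes g :: "real^'d \<Rightarrow> real"
  assumes cont: "continuous_on UNIV g" and bnd: "\<And>x. \<bar>g x\<bar> \<le> B" and e: "e > 0"
  obtains T :: "real^'d \<Rightarrow> real" where "trig_poly (\<lambda>x. of_real (T x))"
    and "\<And>x. norm x \<le> R \<Longrightarrow> \<bar>T x - g x\<bar> \<le> e" and "\<And>x. \<bar>T x\<bar> \<le> B + e"
proof -
  define R' where "R' = \<bar>R\<bar> + 1"
  have R': "R' > 0" "R < R'" by (auto simp: R'_def)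
  define h where "h x = g x * max 0 (min 1 (R' - norm x))" for x
  have hb: "\<bar>h x\<bar> \<le> B" for x
  proof -
    have "\<bar>h x\<bar> \<le> \<bar>g x\<bar> * 1" unfolding h_def abs_mult by (intro mult_left_mono) auto
    then show ?thesis using bnd[of x] by simp
  qed
  define c where "c = R' / pi"
  have c: "c > 0" by (simp add: c_def R')
  have van: "h (c *\<^sub>R x) = 0" if "\<exists>i. \<bar>x $ i\<bar> \<ge> pi" for x
  proof -
    from that obtain i where i: "\<bar>x $ i\<bar> \<ge> pi" ..
    have "\<bar>x $ i\<bar> \<le> norm x" by (rule component_le_norm_cart)
    then have "c * pi \<le> c * norm x" using i c by (intro mult_left_mono) auto
    then have "R' \<le> norm (c *\<^sub>R x)" using c by (simp add: c_def R'_def)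
    then show ?thesis by (simp add: h_def)
  qed
  have "continuous_on UNIV (\<lambda>x. h (c *\<^sub>R x))"
    unfolding h_def
    by (intro continuous_intros continuous_on_compose2[OF cont]) auto
  from trig_poly_approx_cube[OF this van e]
  obtain T where T: "trig_poly (\<lambda>x. of_real (T x))"
    "\<And>x. (\<And>i. \<bar>x $ i\<bar> \<le> pi) \<Longrightarrow> \<bar>T x - h (c *\<^sub>R x)\<bar> < e"
    "\<And>x. \<exists>y. (\<forall>i. \<bar>y $ i\<bar> \<le> pi) \<and> T x = T y"
    by blast
  show ?thesis
  proof
    show "trig_poly (\<lambda>x. of_real (T ((1/c) *\<^sub>R x)))"
      by (rule trig_poly_scale[OF T(1)])
    fix x :: "real^'d"
    show "\<bar>T ((1/c) *\<^sub>R x)\<bar> \<le> B + e"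
    proof -
      obtain y where y: "\<And>i. \<bar>y $ i\<bar> \<le> pi" "T ((1/c) *\<^sub>R x) = T y" using T(3) by blast
      show ?thesis using T(2)[OF y(1)] hb[of "c *\<^sub>R y"] unfolding y(2) by linarith
    qed
    assume x: "norm x \<le> R"
    have "\<bar>((1/c) *\<^sub>R x) $ i\<bar> \<le> pi" for i
    proof -
      have "\<bar>((1/c) *\<^sub>R x) $ i\<bar> \<le> norm ((1/c) *\<^sub>R x)" by (rule component_le_norm_cart)
      also have "\<dots> \<le> (1/c) * R'" using x R' c by (simp add: divide_right_mono)
      also have "\<dots> = pi" using R' by (simp add: c_def)
      finally show ?thesis .
    qed
    then have "\<bar>T ((1/c) *\<^sub>R x) - h (c *\<^sub>R (1/c) *\<^sub>R x)\<bar> < e" by (rule T(2))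
    moreover have "h (c *\<^sub>R (1/c) *\<^sub>R x) = g x"
      using c x by (simp add: h_def R'_def)
    ultimately show "\<bar>T ((1/c) *\<^sub>R x) - g x\<bar> \<le> e" by simp
  qed
qed

section \<open>Convergence in distribution and in probability\<close>

text \<open>The bound is asked only for large \<open>n\<close>. This suffices for limits, and it is
  stable under perturbations that tend to 0 in probability.\<close>

definition tight_sequence :: "'a measure \<Rightarrow> (nat \<Rightarrow> 'a \<Rightarrow> 'b::real_normed_vector) \<Rightarrow> bool" where
  "tight_sequence M X \<longleftrightarrow>
     (\<forall>e>0. \<exists>R. \<forall>\<^sub>F n in sequentially. \<P>(\<omega> in M. norm (X n \<omega>) > R) \<le> e)"

lemma borel_measurable_cis [measurable]: "cis \<in> borel_measurable borel"
  by (intro borel_measurable_continuous_onI) (simp add: cis_conv_exp continuous_intros)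

lemma borel_measurable_component [measurable (raw)]:
  fixes X :: "'a \<Rightarrow> real^'d"
  assumes [measurable]: "X \<in> borel_measurable M"
  shows "(\<lambda>\<omega>. X \<omega> $ i) \<in> borel_measurable M"
proof -
  have "(\<lambda>\<omega>. X \<omega> \<bullet> axis i 1) \<in> borel_measurable M" by measurable
  then show ?thesis by (simp add: inner_axis)
qed

lemma trig_poly_measurable:
  "trig_poly g \<Longrightarrow> g \<in> borel_measurable (borel :: ('a::euclidean_space) measure)"
proof (induction rule: trig_poly.induct)
  case (monomial c t)
  show ?case by measurable
qed (rule borel_measurable_add)

lemma trig_poly_bounded: "trig_poly g \<Longrightarrow> \<exists>B. \<forall>x. norm (g x) \<le> B"
proof (induction rule: trig_poly.induct)
  case (monomial c t)
  show ?case by (intro exI[of _ "norm c"]) (simp add: norm_mult)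
next
  case (add g h)
  then obtain B C where "\<forall>x. norm (g x) \<le> B" "\<forall>x. norm (h x) \<le> C" by blast
  then show ?case by (intro exI[of _ "B + C"]) (blast intro: norm_triangle_mono)
qed

lemma (in prob_space) integrable_bounded:
  fixes g :: "'b \<Rightarrow> 'c::{banach, second_countable_topology}"
  assumes "g \<in> borel_measurable N" "X \<in> measurable M N" "\<And>x. norm (g x) \<le> B"
  shows "integrable M (\<lambda>\<omega>. g (X \<omega>))"
  by (rule integrable_const_bound[of _ B]) (use assms in auto)

lemma (in prob_space) integrable_trig_poly:
  fixes X :: "'a \<Rightarrow> 'b::euclidean_space"
  assumes "trig_poly g" "X \<in> borel_measurable M"
  shows "integrable M (\<lambda>\<omega>. g (X \<omega>))"
  using trig_poly_bounded[OF assms(1)] integrable_bounded[OF trig_poly_measurable[OF assms(1)] assms(2)]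
  by blast

lemma trig_poly_tendsto:
  fixes X :: "nat \<Rightarrow> 'a \<Rightarrow> 'b::euclidean_space"
  assumes P: "prob_space P" and X: "\<And>n. X n \<in> borel_measurable P"
    and \<nu>: "prob_space \<nu>" "sets \<nu> = sets borel"
    and char: "\<And>t. (\<lambda>n. \<integral>\<omega>. cis (t \<bullet> X n \<omega>) \<partial>P) \<longlonglongrightarrow> (\<integral>x. cis (t \<bullet> x) \<partial>\<nu>)"
    and g: "trig_poly g"
  shows "(\<lambda>n. \<integral>\<omega>. g (X n \<omega>) \<partial>P) \<longlonglongrightarrow> (\<integral>x. g x \<partial>\<nu>)"
  using g
proof (induction rule: trig_poly.induct)
  case (monomial c t)
  show ?case using tendsto_mult_left[OF char] by simp
next
  case (add g h)
  interpret P: prob_space P by fact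
  interpret \<nu>: prob_space \<nu> by fact
  have id: "(\<lambda>x. x) \<in> borel_measurable \<nu>"
    using measurable_ident_sets[OF \<nu>(2)] by (simp add: id_def)
  show ?case
    using tendsto_add[OF add.IH]
    by (simp add: P.integrable_trig_poly[OF _ X] \<nu>.integrable_trig_poly[OF _ id] add.hyps)
qed

text \<open>On the ball the two functions differ by at most \<open>d\<close>; off it by at most 2 B
  + d, the sum of their bounds.\<close>

lemma (in prob_space) expectation_diff_le_tail:
  fixes X :: "'a \<Rightarrow> 'b::euclidean_space" and g T :: "'b \<Rightarrow> real"
  assumes [measurable]: "X \<in> borel_measurable M" "g \<in> borel_measurable borel" "T \<in> borel_measurable borel"
    and g: "\<And>x. \<bar>g x\<bar> \<le> B" and T: "\<And>x. \<bar>T x\<bar> \<le> B + d"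
    and close: "\<And>x. norm x \<le> R \<Longrightarrow> \<bar>T x - g x\<bar> \<le> d" and d: "d \<ge> 0"
  shows "\<bar>expectation (\<lambda>\<omega>. T (X \<omega>)) - expectation (\<lambda>\<omega>. g (X \<omega>))\<bar> \<le>
    d + (2 * B + d) * \<P>(\<omega> in M. norm (X \<omega>) > R)"
proof -
  have B: "B \<ge> 0" using g[of 0] by linarith
  let ?A = "{\<omega> \<in> space M. norm (X \<omega>) > R}"
  have [measurable]: "?A \<in> sets M" by measurable
  have iT: "integrable M (\<lambda>\<omega>. T (X \<omega>))" and ig: "integrable M (\<lambda>\<omega>. g (X \<omega>))"
    using integrable_bounded[of T borel X "B + d"] integrable_bounded[of g borel X B] g T by auto
  have "\<bar>T (X \<omega>) - g (X \<omega>)\<bar> \<le> d + (2 * B + d) * indicator ?A \<omega>" if "\<omega> \<in> space M" for \<omega>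
  proof (cases "norm (X \<omega>) \<le> R")
    case False
    then show ?thesis using that g[of "X \<omega>"] T[of "X \<omega>"] d by (auto simp: indicator_def)
  qed (use close that in \<open>auto simp: indicator_def\<close>)
  then have "expectation (\<lambda>\<omega>. \<bar>T (X \<omega>) - g (X \<omega>)\<bar>) \<le> expectation (\<lambda>\<omega>. d + (2 * B + d) * indicator ?A \<omega>)"
    by (intro integral_mono integrable_abs Bochner_Integration.integrable_diff iT ig
        Bochner_Integration.integrable_add integrable_mult_right) (auto simp: less_top[symmetric])
  also have "\<dots> = d + (2 * B + d) * prob ?A"
    by (subst Bochner_Integration.integral_add) (auto simp: less_top[symmetric] prob_space)
  also have "\<bar>expectation (\<lambda>\<omega>. T (X \<omega>)) - expectation (\<lambda>\<omega>. g (X \<omega>))\<bar> \<le> expectation (\<lambda>\<omega>. \<bar>T (X \<omega>) - g (X \<omega>)\<bar>)"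
    using integral_abs_bound[of M "\<lambda>\<omega>. T (X \<omega>) - g (X \<omega>)"] iT ig by simp
  finally show ?thesis by simp
qed

lemma (in finite_measure) measure_tail_le:
  fixes X :: "'a \<Rightarrow> 'b::euclidean_space"
  assumes [measurable]: "X \<in> borel_measurable M" and e: "e > 0"
  shows "\<exists>R. measure M {\<omega> \<in> space M. norm (X \<omega>) > R} \<le> e"
proof -
  let ?A = "\<lambda>n::nat. {\<omega> \<in> space M. norm (X \<omega>) > real n}"
  have "(\<lambda>n. measure M (?A n)) \<longlonglongrightarrow> measure M (\<Inter>n. ?A n)"
    by (rule finite_Lim_measure_decseq) (auto simp: decseq_def)
  also have "(\<Inter>n. ?A n) = {}"
    by (auto simp: not_less) (meson not_less real_arch_simple)
  finally have "\<forall>\<^sub>F n in sequentially. measure M (?A n) < e"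
    using e by (auto dest: order_tendstoD(2))
  then show ?thesis by (auto simp: eventually_sequentially intro: less_imp_le)
qed

text \<open>Expectations of trigonometric polynomials converge by linearity. A test function
  \<open>g\<close> is replaced by such a polynomial on a ball that carries nearly all mass both of
  \<open>X n\<close> for large \<open>n\<close> and of the limit; the global bound on the polynomial
  makes the mass outside harmless. The three errors are each at most e/3.\<close>

theorem converges_in_distribution_char:
  fixes X :: "nat \<Rightarrow> 'a \<Rightarrow> real^'d"
  assumes P: "prob_space P" and X: "\<And>n. X n \<in> borel_measurable P"
    and \<nu>: "prob_space \<nu>" "sets \<nu> = sets borel"
    and char: "\<And>t. (\<lambda>n. \<integral>\<omega>. cis (t \<bullet> X n \<omega>) \<partial>P) \<longlonglongrightarrow> (\<integral>x. cis (t \<bullet> x) \<partial>\<nu>)"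
    and tight: "tight_sequence P X"
  shows "converges_in_distribution P X \<nu>"
  unfolding converges_in_distribution_def
proof (intro conjI allI impI X)
  fix g :: "real^'d \<Rightarrow> real"
  assume cont: "continuous_on UNIV g" and "bounded (range g)"
  then obtain B where B: "\<And>x. \<bar>g x\<bar> \<le> B" by (auto simp: bounded_iff)
  interpret P: prob_space P by fact
  interpret \<nu>: prob_space \<nu> by fact
  have id: "(\<lambda>x. x) \<in> borel_measurable \<nu>"
    using measurable_ident_sets[OF \<nu>(2)] by (simp add: id_def)
  have B0: "B \<ge> 0" using B[of 0] by linarith
  have mg [measurable]: "g \<in> borel_measurable borel"
    by (rule borel_measurable_continuous_onI[OF cont])
  show "(\<lambda>n. \<integral>\<omega>. g (X n \<omega>) \<partial>P) \<longlonglongrightarrow> (\<integral>x. g x \<partial>\<nu>)"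
  proof (rule tendstoI)
    fix e :: real assume e: "e > 0"
    \<comment> \<open>As d \<le> 1, the error d + (2 B + d) d of the replacement is at most (2 B +
      2) d, which the second entry of the minimum makes at most e/3.\<close>
    define d where "d = min 1 (e / (3 * (2 * B + 2)))"
    have d: "d > 0" "d \<le> 1" using e B0 by (auto simp: d_def)
    have de: "d + (2 * B + d) * d \<le> e / 3"
    proof -
      have "d + (2 * B + d) * d \<le> d + (2 * B + 1) * d"
        using d B0 by (intro add_left_mono mult_right_mono) auto
      also have "\<dots> = (2 * B + 2) * d" by (simp add: algebra_simps)
      also have "\<dots> \<le> (2 * B + 2) * (e / (3 * (2 * B + 2)))"
        using B0 by (intro mult_left_mono) (auto simp: d_def)
      also have "\<dots> = e / 3" using B0 by (simp add: field_simps)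
      finally show ?thesis .
    qed
    obtain R1 where R1: "\<forall>\<^sub>F n in sequentially. \<P>(\<omega> in P. norm (X n \<omega>) > R1) \<le> d"
      using tight d(1) by (auto simp: tight_sequence_def)
    obtain R2 where R2: "\<P>(x in \<nu>. norm x > R2) \<le> d"
      using \<nu>.measure_tail_le[OF id d(1)] by blast
    define R where "R = max R1 R2"
    obtain T where T: "trig_poly (\<lambda>x. of_real (T x))" "\<And>x. norm x \<le> R \<Longrightarrow> \<bar>T x - g x\<bar> \<le> d"
      "\<And>x. \<bar>T x\<bar> \<le> B + d"
      using trig_poly_approx[OF cont B d(1)] by metis
    have "(\<lambda>x. Re (of_real (T x))) \<in> borel_measurable borel"
      using trig_poly_measurable[OF T(1)] by measurable
    then have mT [measurable]: "T \<in> borel_measurable borel" by simp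
    have le: "d + (2 * B + d) * p \<le> e / 3" if "p \<le> d" for p
    proof -
      have "d + (2 * B + d) * p \<le> d + (2 * B + d) * d"
        using that B0 d by (intro add_left_mono mult_left_mono) auto
      with de show ?thesis by linarith
    qed
    have "\<P>(x in \<nu>. norm x > R) \<le> \<P>(x in \<nu>. norm x > R2)"
      using id by (intro \<nu>.finite_measure_mono) (auto simp: R_def)
    with R2 have "d + (2 * B + d) * \<P>(x in \<nu>. norm x > R) \<le> e / 3"
      by (intro le) simp
    moreover have "\<bar>(\<integral>x. T x \<partial>\<nu>) - (\<integral>x. g x \<partial>\<nu>)\<bar> \<le> d + (2 * B + d) * \<P>(x in \<nu>. norm x > R)"
      by (rule \<nu>.expectation_diff_le_tail[OF id mg mT B T(3) T(2)]) (use d in auto)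
    ultimately have 1: "\<bar>(\<integral>x. T x \<partial>\<nu>) - (\<integral>x. g x \<partial>\<nu>)\<bar> \<le> e / 3" by linarith
    have "(\<lambda>n. complex_of_real (\<integral>\<omega>. T (X n \<omega>) \<partial>P)) \<longlonglongrightarrow> complex_of_real (\<integral>x. T x \<partial>\<nu>)"
      using trig_poly_tendsto[OF P X \<nu> char T(1)] by simp
    then have "(\<lambda>n. \<integral>\<omega>. T (X n \<omega>) \<partial>P) \<longlonglongrightarrow> (\<integral>x. T x \<partial>\<nu>)"
      by (simp only: tendsto_of_real_iff)
    then have "\<forall>\<^sub>F n in sequentially. \<bar>(\<integral>\<omega>. T (X n \<omega>) \<partial>P) - (\<integral>x. T x \<partial>\<nu>)\<bar> < e / 3"
      using e by (auto dest!: tendstoD[of _ _ _ "e/3"] simp: dist_real_def)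
    with R1 show "\<forall>\<^sub>F n in sequentially. dist (\<integral>\<omega>. g (X n \<omega>) \<partial>P) (\<integral>x. g x \<partial>\<nu>) < e"
    proof eventually_elim
      case (elim n)
      have "\<P>(\<omega> in P. norm (X n \<omega>) > R) \<le> \<P>(\<omega> in P. norm (X n \<omega>) > R1)"
        using X by (intro P.finite_measure_mono) (auto simp: R_def)
      with elim(1) have "d + (2 * B + d) * \<P>(\<omega> in P. norm (X n \<omega>) > R) \<le> e / 3"
        by (intro le) simp
      moreover have "\<bar>(\<integral>\<omega>. T (X n \<omega>) \<partial>P) - (\<integral>\<omega>. g (X n \<omega>) \<partial>P)\<bar> \<le>
          d + (2 * B + d) * \<P>(\<omega> in P. norm (X n \<omega>) > R)"
        by (rule P.expectation_diff_le_tail[OF X mg mT B T(3) T(2)]) (use d in auto)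
      ultimately have "\<bar>(\<integral>\<omega>. T (X n \<omega>) \<partial>P) - (\<integral>\<omega>. g (X n \<omega>) \<partial>P)\<bar> \<le> e / 3" by linarith
      with elim(2) 1 show ?case unfolding dist_real_def by linarith
    qed
  qed
qed

section \<open>Convergence in probability through almost sure subsequences\<close>

text \<open>Limits of numbers can be checked along further subsequences, and there convergence in
  probability becomes almost sure convergence, to which dominated convergence and pointwise calculus
  apply.\<close>

lemma tendsto_if_subseq:
  fixes a :: "nat \<Rightarrow> 'x::metric_space"
  assumes "\<And>r :: nat \<Rightarrow> nat. strict_mono r \<Longrightarrow>
    \<exists>s :: nat \<Rightarrow> nat. strict_mono s \<and> (\<lambda>n. a (r (s n))) \<longlonglongrightarrow> L"
  shows "a \<longlonglongrightarrow> L"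
proof (rule ccontr)
  assume "\<not> a \<longlonglongrightarrow> L"
  then obtain e where e: "e > 0" "\<exists>\<^sub>F n in sequentially. \<not> dist (a n) L < e"
    unfolding tendsto_iff not_eventually by (auto simp: frequently_def)
  then have "infinite {n. \<not> dist (a n) L < e}"
    by (simp add: frequently_cofinite[symmetric] cofinite_eq_sequentially)
  then obtain r :: "nat \<Rightarrow> nat" where r: "strict_mono r" "\<And>n. \<not> dist (a (r n)) L < e"
    using infinite_enumerate by blast
  from assms[OF r(1)] obtain s where "(\<lambda>n. a (r (s n))) \<longlonglongrightarrow> L" by blast
  from tendstoD[OF this e(1)] r(2) show False
    by (auto simp: eventually_sequentially)
qed

context prob_space
begin

text \<open>Truncation at 1 turns convergence in probability into convergence in mean, from which an
  almost surely convergent subsequence can be extracted.\<close>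

lemma converges_in_probability_truncated_mean:
  assumes [measurable]: "\<And>n. X n \<in> borel_measurable M"
    and cip: "converges_in_probability_to_0 M X"
  shows "(\<lambda>n. expectation (\<lambda>\<omega>. min 1 \<bar>X n \<omega>\<bar>)) \<longlonglongrightarrow> 0"
proof (rule tendstoI)
  fix e :: real assume e: "e > 0"
  have "(\<lambda>n. \<P>(\<omega> in M. \<bar>X n \<omega>\<bar> > e/2)) \<longlonglongrightarrow> 0"
    using cip[unfolded converges_in_probability_to_0_def, rule_format, of "e/2"] e by simp
  then have "\<forall>\<^sub>F n in sequentially. \<P>(\<omega> in M. \<bar>X n \<omega>\<bar> > e/2) < e/2"
    using e by (auto dest!: order_tendstoD(2)[of _ _ _ "e/2"])
  then show "\<forall>\<^sub>F n in sequentially. dist (expectation (\<lambda>\<omega>. min 1 \<bar>X n \<omega>\<bar>)) 0 < e"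
  proof eventually_elim
    case (elim n)
    let ?A = "{\<omega> \<in> space M. \<bar>X n \<omega>\<bar> > e/2}"
    have "expectation (\<lambda>\<omega>. min 1 \<bar>X n \<omega>\<bar>) \<le> expectation (\<lambda>\<omega>. e/2 + indicator ?A \<omega>)"
    proof (rule integral_mono)
      show "integrable M (\<lambda>\<omega>. min 1 \<bar>X n \<omega>\<bar>)"
        by (rule integrable_const_bound[of _ 1]) auto
      show "integrable M (\<lambda>\<omega>. e/2 + indicator ?A \<omega>)"
        by (intro Bochner_Integration.integrable_add) (auto simp: less_top[symmetric])
      show "min 1 \<bar>X n \<omega>\<bar> \<le> e/2 + indicator ?A \<omega>" if "\<omega> \<in> space M" for \<omega>
        using that e by (auto simp: indicator_def)
    qed
    also have "\<dots> = e/2 + prob ?A"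
      by (subst Bochner_Integration.integral_add) (auto simp: less_top[symmetric] prob_space)
    finally have "expectation (\<lambda>\<omega>. min 1 \<bar>X n \<omega>\<bar>) < e" using elim by simp
    moreover have "expectation (\<lambda>\<omega>. min 1 \<bar>X n \<omega>\<bar>) \<ge> 0" by (intro integral_nonneg_AE) auto
    ultimately show ?case by (simp add: dist_real_def)
  qed
qed

text \<open>The truncations are summed over the finite index set first; a subsequence along which
  the sum tends to 0 almost surely serves all members of the family at once.\<close>

lemma converges_in_probability_AE_subseq:
  fixes X :: "'k \<Rightarrow> nat \<Rightarrow> 'a \<Rightarrow> real"
  assumes K: "finite K" and X [measurable]: "\<And>k n. k \<in> K \<Longrightarrow> X k n \<in> borel_measurable M"
    and cip: "\<And>k. k \<in> K \<Longrightarrow> converges_in_probability_to_0 M (X k)" and r: "strict_mono (r :: nat \<Rightarrow> nat)"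
  shows "\<exists>s :: nat \<Rightarrow> nat. strict_mono s \<and> (AE \<omega> in M. \<forall>k\<in>K. (\<lambda>n. X k (r (s n)) \<omega>) \<longlonglongrightarrow> 0)"
proof -
  define u where "u n \<omega> = (\<Sum>k\<in>K. min 1 \<bar>X k (r n) \<omega>\<bar>)" for n \<omega>
  have i: "integrable M (\<lambda>\<omega>. min 1 \<bar>X k n \<omega>\<bar>)" if "k \<in> K" for k n
    by (rule integrable_const_bound[of _ 1]) (use that in auto)
  have "(\<lambda>n. \<Sum>k\<in>K. expectation (\<lambda>\<omega>. min 1 \<bar>X k (r n) \<omega>\<bar>)) \<longlonglongrightarrow> (\<Sum>k\<in>K. 0)"
    by (intro tendsto_sum LIMSEQ_subseq_LIMSEQ[OF _ r, unfolded o_def]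
        converges_in_probability_truncated_mean) (auto intro: cip)
  moreover have "expectation (\<lambda>\<omega>. norm (u n \<omega>)) = (\<Sum>k\<in>K. expectation (\<lambda>\<omega>. min 1 \<bar>X k (r n) \<omega>\<bar>))" for n
    unfolding u_def using i by (simp add: sum_nonneg)
  ultimately have "(\<lambda>n. expectation (\<lambda>\<omega>. norm (u n \<omega>))) \<longlonglongrightarrow> 0" by simp
  moreover have "integrable M (u n)" for n unfolding u_def using i by auto
  ultimately obtain s where s: "strict_mono s" "AE \<omega> in M. (\<lambda>n. u (s n) \<omega>) \<longlonglongrightarrow> 0"
    using tendsto_L1_AE_subseq[of M u] by blast
  have "(\<lambda>n. X k (r (s n)) \<omega>) \<longlonglongrightarrow> 0" if u: "(\<lambda>n. u (s n) \<omega>) \<longlonglongrightarrow> 0" and k: "k \<in> K" for k \<omega>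
  proof (rule Lim_null_comparison[OF _ u])
    have "\<forall>\<^sub>F n in sequentially. u (s n) \<omega> < 1"
      using order_tendstoD(2)[OF u] by simp
    then show "\<forall>\<^sub>F n in sequentially. norm (X k (r (s n)) \<omega>) \<le> u (s n) \<omega>"
    proof eventually_elim
      case (elim n)
      have "min 1 \<bar>X k (r (s n)) \<omega>\<bar> \<le> u (s n) \<omega>"
        unfolding u_def by (rule member_le_sum[OF k]) (auto simp: K)
      with elim show ?case by simp
    qed
  qed
  then have "AE \<omega> in M. \<forall>k\<in>K. (\<lambda>n. X k (r (s n)) \<omega>) \<longlonglongrightarrow> 0"
    using s(2) by (auto elim!: eventually_mono)
  with s(1) show ?thesis by blast
qed

lemma converges_in_probability_if_AE_subseq:
  assumes [measurable]: "\<And>n. X n \<in> borel_measurable M"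
    and sub: "\<And>r :: nat \<Rightarrow> nat. strict_mono r \<Longrightarrow>
      \<exists>s :: nat \<Rightarrow> nat. strict_mono s \<and> (AE \<omega> in M. (\<lambda>n. X (r (s n)) \<omega>) \<longlonglongrightarrow> 0)"
  shows "converges_in_probability_to_0 M X"
  unfolding converges_in_probability_to_0_def
proof (intro allI impI tendsto_if_subseq)
  fix e :: real and r :: "nat \<Rightarrow> nat"
  assume e: "e > 0" and r: "strict_mono r"
  from sub[OF r] obtain s where s: "strict_mono s" "AE \<omega> in M. (\<lambda>n. X (r (s n)) \<omega>) \<longlonglongrightarrow> 0"
    by blast
  let ?A = "\<lambda>n. {\<omega> \<in> space M. \<bar>X (r (s n)) \<omega>\<bar> > e}"
  have "(\<lambda>n. expectation (indicator (?A n))) \<longlonglongrightarrow> expectation (\<lambda>\<omega>. 0 :: real)"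
  proof (rule integral_dominated_convergence[where w="\<lambda>\<omega>. 1"])
    show "AE \<omega> in M. (\<lambda>n. indicator (?A n) \<omega> :: real) \<longlonglongrightarrow> 0"
      using s(2)
    proof eventually_elim
      case (elim \<omega>)
      have "\<forall>\<^sub>F n in sequentially. \<bar>X (r (s n)) \<omega>\<bar> < e"
        using tendstoD[OF elim e] by (simp add: dist_real_def)
      then have "\<forall>\<^sub>F n in sequentially. indicator (?A n) \<omega> = (0::real)"
        by eventually_elim (auto simp: indicator_def)
      then show ?case by (rule tendsto_eventually)
    qed
  qed (auto simp: indicator_def)
  then have "(\<lambda>n. \<P>(\<omega> in M. \<bar>X (r (s n)) \<omega>\<bar> > e)) \<longlonglongrightarrow> 0" by simp
  with s(1) show "\<exists>s. strict_mono s \<and> (\<lambda>n. \<P>(\<omega> in M. \<bar>X (r (s n)) \<omega>\<bar> > e)) \<longlonglongrightarrow> 0" by blast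
qed

text \<open>The continuous mapping principle in a pointwise form: the implication between the limits
  is an argument about one fixed outcome. The exceptional null set leaves room for events such as
  convergence of the group frequencies, and the quantifier over \<open>r\<close> stands inside it
  because the subsequence is chosen later.\<close>

lemma converges_in_probability_from:
  fixes X :: "'k \<Rightarrow> nat \<Rightarrow> 'a \<Rightarrow> real" and Y :: "nat \<Rightarrow> 'a \<Rightarrow> real"
  assumes K: "finite K" and X: "\<And>k n. k \<in> K \<Longrightarrow> X k n \<in> borel_measurable M"
    and Y: "\<And>n. Y n \<in> borel_measurable M"
    and cip: "\<And>k. k \<in> K \<Longrightarrow> converges_in_probability_to_0 M (X k)"
    and imp: "AE \<omega> in M. \<forall>r. strict_mono r \<longrightarrow>
      (\<forall>k\<in>K. (\<lambda>n. X k (r n) \<omega>) \<longlonglongrightarrow> 0) \<longrightarrow> (\<lambda>n. Y (r n) \<omega>) \<longlonglongrightarrow> 0"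
  shows "converges_in_probability_to_0 M Y"
proof (rule converges_in_probability_if_AE_subseq[OF Y])
  fix r :: "nat \<Rightarrow> nat" assume r: "strict_mono r"
  have "\<exists>s. strict_mono s \<and> (AE \<omega> in M. \<forall>k\<in>K. (\<lambda>n. X k (r (s n)) \<omega>) \<longlonglongrightarrow> 0)"
    by (rule converges_in_probability_AE_subseq[OF K X cip r])
  then obtain s where s: "strict_mono s" "AE \<omega> in M. \<forall>k\<in>K. (\<lambda>n. X k (r (s n)) \<omega>) \<longlonglongrightarrow> 0"
    by blast
  have rs: "strict_mono (\<lambda>n. r (s n))"
    using strict_mono_o[OF r s(1)] by (simp add: o_def)
  from s(2) imp have "AE \<omega> in M. (\<lambda>n. Y (r (s n)) \<omega>) \<longlonglongrightarrow> 0"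
    by eventually_elim (use rs in auto)
  with s(1) show "\<exists>s. strict_mono s \<and> (AE \<omega> in M. (\<lambda>n. Y (r (s n)) \<omega>) \<longlonglongrightarrow> 0)" by blast
qed

lemma converges_in_probability_sum:
  fixes X :: "'k \<Rightarrow> nat \<Rightarrow> 'a \<Rightarrow> real"
  assumes "finite K" and "\<And>k n. k \<in> K \<Longrightarrow> X k n \<in> borel_measurable M"
    and "\<And>k. k \<in> K \<Longrightarrow> converges_in_probability_to_0 M (X k)"
  shows "converges_in_probability_to_0 M (\<lambda>n \<omega>. \<Sum>k\<in>K. X k n \<omega>)"
  by (rule converges_in_probability_from[OF assms(1,2) _ assms(3)])
    (auto intro!: borel_measurable_sum assms(2) tendsto_null_sum)

text \<open>Off an event of small probability \<open>Z n\<close> is at most R', so a large product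
  forces \<open>X n\<close> above \<epsilon> / R'.\<close>

lemma converges_in_probability_times_tight:
  assumes [measurable]: "\<And>n. X n \<in> borel_measurable M" "\<And>n. Z n \<in> borel_measurable M"
    and X: "converges_in_probability_to_0 M X" and Z: "tight_sequence M Z"
  shows "converges_in_probability_to_0 M (\<lambda>n \<omega>. X n \<omega> * Z n \<omega>)"
  unfolding converges_in_probability_to_0_def
proof (intro allI impI tendstoI)
  fix \<epsilon> e :: real assume \<epsilon>: "\<epsilon> > 0" and e: "e > 0"
  then obtain R where R: "\<forall>\<^sub>F n in sequentially. \<P>(\<omega> in M. norm (Z n \<omega>) > R) \<le> e/2"
    using Z[unfolded tight_sequence_def, rule_format, of "e/2"] by auto
  define R' where "R' = \<bar>R\<bar> + 1"
  have R': "R' > 0" "R' \<ge> R" by (auto simp: R'_def)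
  have "(\<lambda>n. \<P>(\<omega> in M. \<bar>X n \<omega>\<bar> > \<epsilon> / R')) \<longlonglongrightarrow> 0"
    using X \<epsilon> R' by (auto simp: converges_in_probability_to_0_def)
  then have "\<forall>\<^sub>F n in sequentially. \<P>(\<omega> in M. \<bar>X n \<omega>\<bar> > \<epsilon> / R') < e/2"
    using e by (auto dest!: order_tendstoD(2)[of _ _ _ "e/2"])
  with R show "\<forall>\<^sub>F n in sequentially. dist (\<P>(\<omega> in M. \<bar>X n \<omega> * Z n \<omega>\<bar> > \<epsilon>)) 0 < e"
  proof eventually_elim
    case (elim n)
    have "\<bar>X n \<omega>\<bar> > \<epsilon> / R'" if "\<bar>X n \<omega> * Z n \<omega>\<bar> > \<epsilon>" "\<not> norm (Z n \<omega>) > R" for \<omega>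
    proof -
      have "\<epsilon> < \<bar>X n \<omega>\<bar> * \<bar>Z n \<omega>\<bar>" using that(1) by (simp add: abs_mult)
      also have "\<dots> \<le> \<bar>X n \<omega>\<bar> * R'" using that(2) R' by (intro mult_left_mono) auto
      finally show ?thesis using R' by (simp add: field_simps)
    qed
    then have "\<P>(\<omega> in M. \<bar>X n \<omega> * Z n \<omega>\<bar> > \<epsilon>)
        \<le> prob ({\<omega> \<in> space M. \<bar>X n \<omega>\<bar> > \<epsilon> / R'} \<union> {\<omega> \<in> space M. norm (Z n \<omega>) > R})"
      by (intro finite_measure_mono) auto
    also have "\<dots> \<le> \<P>(\<omega> in M. \<bar>X n \<omega>\<bar> > \<epsilon> / R') + \<P>(\<omega> in M. norm (Z n \<omega>) > R)"
      by (intro measure_Un_le) auto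
    finally show ?case using elim by (simp add: dist_real_def)
  qed
qed

lemma tight_sequence_perturb:
  fixes X Z :: "nat \<Rightarrow> 'a \<Rightarrow> 'b::euclidean_space"
  assumes [measurable]: "\<And>n. X n \<in> borel_measurable M" "\<And>n. Z n \<in> borel_measurable M"
    and Z: "tight_sequence M Z"
    and D: "converges_in_probability_to_0 M (\<lambda>n \<omega>. norm (X n \<omega> - Z n \<omega>))"
  shows "tight_sequence M X"
  unfolding tight_sequence_def
proof (intro allI impI)
  fix e :: real assume e: "e > 0"
  then obtain R where R: "\<forall>\<^sub>F n in sequentially. \<P>(\<omega> in M. norm (Z n \<omega>) > R) \<le> e/2"
    using Z[unfolded tight_sequence_def, rule_format, of "e/2"] by auto
  have "(\<lambda>n. \<P>(\<omega> in M. \<bar>norm (X n \<omega> - Z n \<omega>)\<bar> > 1)) \<longlonglongrightarrow> 0"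
    using D zero_less_one unfolding converges_in_probability_to_0_def by blast
  then have "\<forall>\<^sub>F n in sequentially. \<P>(\<omega> in M. \<bar>norm (X n \<omega> - Z n \<omega>)\<bar> > 1) < e/2"
    using e by (auto dest!: order_tendstoD(2)[of _ _ _ "e/2"])
  with R have "\<forall>\<^sub>F n in sequentially. \<P>(\<omega> in M. norm (X n \<omega>) > R + 1) \<le> e"
  proof eventually_elim
    case (elim n)
    have *: "norm (X n \<omega>) \<le> norm (Z n \<omega>) + norm (X n \<omega> - Z n \<omega>)" for \<omega>
      using norm_triangle_ineq[of "Z n \<omega>" "X n \<omega> - Z n \<omega>"] by simp
    have "norm (X n \<omega> - Z n \<omega>) > 1" if "norm (X n \<omega>) > R + 1" "\<not> norm (Z n \<omega>) > R" for \<omega>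
      using *[of \<omega>] that by linarith
    then have "\<P>(\<omega> in M. norm (X n \<omega>) > R + 1)
        \<le> prob ({\<omega> \<in> space M. \<bar>norm (X n \<omega> - Z n \<omega>)\<bar> > 1} \<union> {\<omega> \<in> space M. norm (Z n \<omega>) > R})"
      by (intro finite_measure_mono) auto
    also have "\<dots> \<le> \<P>(\<omega> in M. \<bar>norm (X n \<omega> - Z n \<omega>)\<bar> > 1) + \<P>(\<omega> in M. norm (Z n \<omega>) > R)"
      by (intro measure_Un_le) auto
    finally show ?case using elim by simp
  qed
  then show "\<exists>R. \<forall>\<^sub>F n in sequentially. \<P>(\<omega> in M. norm (X n \<omega>) > R) \<le> e" by blast
qed

lemma tight_sequence_second_moment:
  fixes X :: "nat \<Rightarrow> 'a \<Rightarrow> 'b::euclidean_space"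
  assumes [measurable]: "\<And>n. X n \<in> borel_measurable M"
    and i: "\<And>n. integrable M (\<lambda>\<omega>. (norm (X n \<omega>))\<^sup>2)"
    and C: "\<And>n. expectation (\<lambda>\<omega>. (norm (X n \<omega>))\<^sup>2) \<le> C"
  shows "tight_sequence M X"
  unfolding tight_sequence_def
proof (intro allI impI exI always_eventually)
  fix e :: real and n assume e: "e > 0"
  have C0: "C \<ge> 0" using C[of 0] by (rule order_trans[rotated]) simp
  \<comment> \<open>Markov's inequality for the square gives C / R^2, and this choice makes it at
    most \<open>e\<close>; the added 1 keeps \<open>R\<close> positive when
    \<open>C = 0\<close>.\<close>
  define R where "R = sqrt ((C + 1) / e)"
  have R: "R > 0" "R\<^sup>2 = (C + 1) / e" using C0 e by (auto simp: R_def)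
  have "\<P>(\<omega> in M. norm (X n \<omega>) > R) \<le> \<P>(\<omega> in M. (norm (X n \<omega>))\<^sup>2 \<ge> R\<^sup>2)"
    using R(1) by (intro finite_measure_mono) (auto intro!: power_mono simp del: R(2))
  also have "\<dots> \<le> expectation (\<lambda>\<omega>. (norm (X n \<omega>))\<^sup>2) / R\<^sup>2"
    using R(1) by (intro integral_Markov_inequality_measure[OF i, of "{}"]) auto
  also have "\<dots> \<le> C / R\<^sup>2" using C by (intro divide_right_mono) auto
  also have "\<dots> \<le> e" using C0 e by (simp add: R(2) field_simps)
  finally show "\<P>(\<omega> in M. norm (X n \<omega>) > sqrt ((C + 1) / e)) \<le> e" by (simp add: R_def)
qed

text \<open>The difference of the two integrands is at most |t| |X n - Z n| and also at most 2, so
  dominated convergence applies along almost surely convergent subsequences.\<close>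

lemma char_perturb:
  fixes X Z :: "nat \<Rightarrow> 'a \<Rightarrow> 'b::euclidean_space"
  assumes [measurable]: "\<And>n. X n \<in> borel_measurable M" "\<And>n. Z n \<in> borel_measurable M"
    and D: "converges_in_probability_to_0 M (\<lambda>n \<omega>. norm (X n \<omega> - Z n \<omega>))"
    and Z: "(\<lambda>n. expectation (\<lambda>\<omega>. cis (t \<bullet> Z n \<omega>))) \<longlonglongrightarrow> c"
  shows "(\<lambda>n. expectation (\<lambda>\<omega>. cis (t \<bullet> X n \<omega>))) \<longlonglongrightarrow> c"
proof -
  have ix: "integrable M (\<lambda>\<omega>. cis (t \<bullet> Y \<omega>))" if [measurable]: "Y \<in> borel_measurable M" for Y
    by (rule integrable_const_bound[of _ 1]) auto
  have "(\<lambda>n. expectation (\<lambda>\<omega>. cis (t \<bullet> X n \<omega>) - cis (t \<bullet> Z n \<omega>))) \<longlonglongrightarrow> 0"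
  proof (rule tendsto_if_subseq)
    fix r :: "nat \<Rightarrow> nat" assume r: "strict_mono r"
    obtain s where s: "strict_mono s"
      "AE \<omega> in M. (\<lambda>n. norm (X (r (s n)) \<omega> - Z (r (s n)) \<omega>)) \<longlonglongrightarrow> 0"
      using converges_in_probability_AE_subseq[of "{()}" "\<lambda>_ n \<omega>. norm (X n \<omega> - Z n \<omega>)" r] D r
      by (auto simp del: tendsto_norm_zero_iff)
    have "(\<lambda>n. expectation (\<lambda>\<omega>. cis (t \<bullet> X (r (s n)) \<omega>) - cis (t \<bullet> Z (r (s n)) \<omega>)))
        \<longlonglongrightarrow> expectation (\<lambda>\<omega>. 0 :: complex)"
    proof (rule integral_dominated_convergence[where w="\<lambda>\<omega>. 2"])
      show "AE \<omega> in M. (\<lambda>n. cis (t \<bullet> X (r (s n)) \<omega>) - cis (t \<bullet> Z (r (s n)) \<omega>)) \<longlonglongrightarrow> 0"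
        using s(2)
      proof eventually_elim
        case (elim \<omega>)
        have "norm (cis (t \<bullet> X n \<omega>) - cis (t \<bullet> Z n \<omega>)) \<le> norm (X n \<omega> - Z n \<omega>) * norm t" for n
        proof -
          have "cis (t \<bullet> X n \<omega>) - cis (t \<bullet> Z n \<omega>) = cis (t \<bullet> Z n \<omega>) * (cis (t \<bullet> (X n \<omega> - Z n \<omega>)) - 1)"
            by (simp add: right_diff_distrib cis_mult inner_diff_right)
          then have "norm (cis (t \<bullet> X n \<omega>) - cis (t \<bullet> Z n \<omega>)) = norm (iexp (t \<bullet> (X n \<omega> - Z n \<omega>)) - 1)"
            by (simp add: norm_mult cis_conv_exp)
          also have "\<dots> \<le> \<bar>t \<bullet> (X n \<omega> - Z n \<omega>)\<bar>"
            using iexp_approx1[of "t \<bullet> (X n \<omega> - Z n \<omega>)" 0] by simp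
          also have "\<dots> \<le> norm t * norm (X n \<omega> - Z n \<omega>)" by (rule Cauchy_Schwarz_ineq2)
          finally show ?thesis by (simp add: mult.commute)
        qed
        then show ?case
          by (intro Lim_null_comparison[OF _ tendsto_mult_left_zero[OF elim, of "norm t"]] always_eventually) auto
      qed
      show "AE \<omega> in M. norm (cis (t \<bullet> X (r (s n)) \<omega>) - cis (t \<bullet> Z (r (s n)) \<omega>)) \<le> 2" for n
        by (intro AE_I2 order_trans[OF norm_triangle_ineq4]) simp
    qed auto
    with s(1) show "\<exists>s. strict_mono s \<and>
        (\<lambda>n. expectation (\<lambda>\<omega>. cis (t \<bullet> X (r (s n)) \<omega>) - cis (t \<bullet> Z (r (s n)) \<omega>))) \<longlonglongrightarrow> 0"
      by auto
  qed
  from tendsto_add[OF this Z] show ?thesis by (simp add: ix)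
qed

end

section \<open>Gaussian and chi-squared limits\<close>

lemma tight_sequence_component_product:
  fixes X :: "nat \<Rightarrow> 'a \<Rightarrow> real^'d"
  assumes P: "prob_space P" and [measurable]: "\<And>n. X n \<in> borel_measurable P" and X: "tight_sequence P X"
  shows "tight_sequence P (\<lambda>n \<omega>. X n \<omega> $ i * X n \<omega> $ j)"
  unfolding tight_sequence_def
proof (intro allI impI)
  interpret prob_space P by fact
  fix e :: real assume "e > 0"
  then obtain R where R: "\<forall>\<^sub>F n in sequentially. \<P>(\<omega> in P. norm (X n \<omega>) > R) \<le> e"
    using X by (auto simp: tight_sequence_def)
  have le: "norm (x $ i * x $ j) \<le> R\<^sup>2" if "\<not> norm x > R" for x :: "real^'d"
  proof -
    have "norm (x $ i * x $ j) \<le> norm x * norm x"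
      unfolding real_norm_def abs_mult by (intro mult_mono component_le_norm_cart) auto
    also have "\<dots> \<le> R * R"
      using that norm_ge_zero[of x] by (intro mult_mono) (auto simp del: norm_ge_zero)
    finally show ?thesis by (simp add: power2_eq_square)
  qed
  from R have "\<forall>\<^sub>F n in sequentially. \<P>(\<omega> in P. norm (X n \<omega> $ i * X n \<omega> $ j) > R\<^sup>2) \<le> e"
  proof eventually_elim
    case (elim n)
    have "\<P>(\<omega> in P. norm (X n \<omega> $ i * X n \<omega> $ j) > R\<^sup>2) \<le> \<P>(\<omega> in P. norm (X n \<omega>) > R)"
      using le by (intro finite_measure_mono) (auto simp: not_less[symmetric])
    with elim show ?case by simp
  qed
  then show "\<exists>R. \<forall>\<^sub>F n in sequentially. \<P>(\<omega> in P. norm (X n \<omega> $ i * X n \<omega> $ j) > R) \<le> e" by blast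
qed

section \<open>The centred multivariate normal law\<close>

lemma cis_sum: "cis (\<Sum>i\<in>I. f i) = (\<Prod>i\<in>I. cis (f i))"
  by (induction I rule: infinite_finite_induct) (auto simp: cis_mult[symmetric])

lemma prob_space_std_normal: "prob_space std_normal_distribution"
  using real_dist_normal_dist by (simp add: real_distribution_def)

lemma product_prob_space_std_normal: "product_prob_space (\<lambda>_. std_normal_distribution)"
  by (simp add: product_prob_space_def product_prob_space_axioms_def product_sigma_finite_def
      prob_space_std_normal prob_space_imp_sigma_finite)

lemma matrix_vector_mult_eq_sum:
  fixes A :: "real^'d^'e"
  shows "A *v (\<chi> i. z i) = (\<Sum>i\<in>UNIV. z i *\<^sub>R column i A)"
  by (simp add: matrix_mult_sum scalar_mult_eq_scaleR)

lemma borel_measurable_linear_image_PiM [measurable]: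
  fixes A :: "real^'d^'d"
  shows "(\<lambda>z. A *v (\<chi> i. z i)) \<in> borel_measurable (\<Pi>\<^sub>M i\<in>UNIV. std_normal_distribution)"
  unfolding matrix_vector_mult_eq_sum by measurable

lemma multivariate_normal_eq_distr:
  fixes V :: "real^'d^'d"
  assumes "\<And>i j. V$i$j = V$j$i" and "\<And>x. 0 \<le> x \<bullet> (V *v x)"
  obtains A :: "real^'d^'d" where "A ** transpose A = V" and "multivariate_normal 0 V =
    distr (\<Pi>\<^sub>M i\<in>UNIV. std_normal_distribution) borel (\<lambda>z. A *v (\<chi> i. z i))"
proof
  show "(SOME A :: real^'d^'d. A ** transpose A = V) ** transpose (SOME A. A ** transpose A = V) = V"
    using someI_ex[OF psd_factorization[OF assms]] .
qed (simp add: multivariate_normal_def)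

lemma prob_space_multivariate_normal:
  fixes V :: "real^'d^'d"
  assumes "\<And>i j. V$i$j = V$j$i" and "\<And>x. 0 \<le> x \<bullet> (V *v x)"
  shows "prob_space (multivariate_normal 0 V)"
proof -
  interpret product_prob_space "\<lambda>_::'d. std_normal_distribution" UNIV
    by (rule product_prob_space_std_normal)
  obtain A :: "real^'d^'d" where A: "multivariate_normal 0 V =
    distr (\<Pi>\<^sub>M i\<in>UNIV. std_normal_distribution) borel (\<lambda>z. A *v (\<chi> i. z i))"
    using multivariate_normal_eq_distr[OF assms] by metis
  show ?thesis unfolding A by (rule P.prob_space_distr) measurable
qed

lemma sets_multivariate_normal [simp]: "sets (multivariate_normal m V) = sets borel"
  by (simp add: multivariate_normal_def)

text \<open>For a factor \<open>A\<close> of \<open>V\<close>, t . A z = b . z with b = A^T t, so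
  the integral splits into one-dimensional normal characteristic functions. Only |b|^2 = t . V t
  survives, so the value does not depend on which factor is chosen.\<close>

lemma char_multivariate_normal:
  fixes V :: "real^'d^'d"
  assumes "\<And>i j. V$i$j = V$j$i" and "\<And>x. 0 \<le> x \<bullet> (V *v x)"
  shows "(\<integral>x. cis (t \<bullet> x) \<partial>multivariate_normal 0 V) = of_real (exp (- (t \<bullet> (V *v t)) / 2))"
proof -
  interpret product_prob_space "\<lambda>_::'d. std_normal_distribution" UNIV
    by (rule product_prob_space_std_normal)
  obtain A :: "real^'d^'d" where A: "A ** transpose A = V" "multivariate_normal 0 V =
    distr (\<Pi>\<^sub>M i\<in>UNIV. std_normal_distribution) borel (\<lambda>z. A *v (\<chi> i. z i))"
    using multivariate_normal_eq_distr[OF assms] by metis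
  define b where "b = t v* A"
  have "(\<integral>x. cis (t \<bullet> x) \<partial>multivariate_normal 0 V) =
      (\<integral>z. cis (t \<bullet> (A *v (\<chi> i. z i))) \<partial>(\<Pi>\<^sub>M i\<in>UNIV. std_normal_distribution))"
    unfolding A(2) by (subst integral_distr) auto
  also have "\<dots> = (\<integral>z. (\<Prod>i\<in>UNIV. cis (b $ i * z i)) \<partial>(\<Pi>\<^sub>M i\<in>UNIV. std_normal_distribution))"
    unfolding dot_lmul_matrix[symmetric] b_def[symmetric] by (simp add: inner_vec_def cis_sum)
  also have "\<dots> = (\<Prod>i\<in>UNIV. (\<integral>y. cis (b $ i * y) \<partial>std_normal_distribution))"
  proof (rule product_integral_prod)
    show "integrable std_normal_distribution (\<lambda>y. cis (b $ i * y))" for i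
      by (rule finite_measure.integrable_const_bound[OF prob_space.finite_measure[OF prob_space_std_normal], of _ 1]) auto
  qed simp
  also have "\<dots> = (\<Prod>i\<in>UNIV. of_real (exp (- ((b $ i)\<^sup>2) / 2)))"
    using char_std_normal_distribution by (simp add: char_def cis_conv_exp fun_eq_iff)
  also have "\<dots> = of_real (exp (\<Sum>i\<in>UNIV. - ((b $ i)\<^sup>2) / 2))"
    by (simp add: exp_sum)
  also have "(\<Sum>i\<in>UNIV. - ((b $ i)\<^sup>2) / 2) = - (b \<bullet> b) / 2"
    by (simp add: inner_vec_def sum_negf sum_divide_distrib power2_eq_square)
  also have "b \<bullet> b = t \<bullet> (V *v t)"
  proof -
    have "A *v b = V *v t"
      unfolding b_def A(1)[symmetric] matrix_vector_mul_assoc[symmetric] by simp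
    then show ?thesis using dot_lmul_matrix[of t A b] by (simp add: b_def[symmetric])
  qed
  finally show ?thesis .
qed

text \<open>With w = (A A^T)^(-1) A z one has A (A^T w) = A z. Invertibility of the product makes
  the square matrix \<open>A\<close> injective, hence A^T w = z, and the form is (A z) . w = z .
  (A^T w) = z . z.\<close>

lemma quadratic_form_matrix_inv:
  fixes A :: "real^'d^'d"
  assumes inv: "invertible (A ** transpose A)"
  shows "(A *v z) \<bullet> (matrix_inv (A ** transpose A) *v (A *v z)) = z \<bullet> z"
proof -
  let ?V = "A ** transpose A"
  define w where "w = matrix_inv ?V *v (A *v z)"
  have "?V ** matrix_inv ?V = mat 1"
    using someI_ex[OF inv[unfolded invertible_def]] by (simp add: matrix_inv_def)
  then have "A *v (transpose A *v w) = A *v z"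
    unfolding w_def by (simp add: matrix_vector_mul_assoc matrix_mul_assoc)
  moreover have "det A \<noteq> 0" using inv by (auto simp: invertible_det_nz det_mul)
  then have "inj ((*v) A)" by (simp add: inj_matrix_vector_mult invertible_det_nz)
  ultimately have w: "transpose A *v w = z" by (auto dest: injD)
  then have "w \<bullet> (A *v z) = z \<bullet> z" using dot_lmul_matrix[of w A z] by simp
  then show ?thesis by (simp add: w_def[symmetric] inner_commute)
qed

lemma distr_quadratic_form_multivariate_normal:
  fixes V :: "real^'d^'d"
  assumes "\<And>i j. V$i$j = V$j$i" and "\<And>x. 0 \<le> x \<bullet> (V *v x)" and inv: "invertible V"
  shows "distr (multivariate_normal 0 V) borel (\<lambda>x. x \<bullet> (matrix_inv V *v x)) = chi_squared CARD('d)"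
proof -
  let ?N = "std_normal_distribution"
  obtain A :: "real^'d^'d" where A: "A ** transpose A = V" "multivariate_normal 0 V =
    distr (\<Pi>\<^sub>M i\<in>UNIV. ?N) borel (\<lambda>z. A *v (\<chi> i. z i))"
    using multivariate_normal_eq_distr[OF assms(1,2)] by metis
  have [measurable]: "(\<lambda>x. matrix_inv V *v x) \<in> borel_measurable borel"
    by (intro borel_measurable_continuous_onI linear_continuous_on matrix_vector_mul_bounded_linear)
  have [measurable]: "(\<lambda>x. x \<bullet> (matrix_inv V *v x)) \<in> borel_measurable borel" by measurable
  have "distr (multivariate_normal 0 V) borel (\<lambda>x. x \<bullet> (matrix_inv V *v x)) =
      distr (\<Pi>\<^sub>M i\<in>(UNIV::'d set). ?N) borel (\<lambda>z. \<Sum>i\<in>UNIV. (z i)\<^sup>2)"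
    unfolding A(2) using inv quadratic_form_matrix_inv[of A]
    by (subst distr_distr) (auto simp: o_def A(1) inner_vec_def power2_eq_square)
  also have "\<dots> = chi_squared CARD('d)"
  proof -
    \<comment> \<open>The normal vector is indexed by the type \<open>'d\<close>,
      \<open>chi_squared\<close> by an initial segment of the naturals; a product of equal factors
      is invariant under reindexing along a bijection.\<close>
    obtain f :: "nat \<Rightarrow> 'd" where f: "bij_betw f {..<CARD('d)} UNIV"
      using ex_bij_betw_nat_finite[of "UNIV :: 'd set"] by (auto simp: atLeast0LessThan)
    have [measurable]: "(\<lambda>\<omega>. \<lambda>n\<in>{..<CARD('d)}. \<omega> (f n)) \<in>
        measurable (\<Pi>\<^sub>M i\<in>UNIV. ?N) (\<Pi>\<^sub>M i\<in>{..<CARD('d)}. ?N)"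
      by (intro measurable_restrict measurable_component_singleton) auto
    have "chi_squared CARD('d) = distr (distr (\<Pi>\<^sub>M i\<in>UNIV. ?N) (\<Pi>\<^sub>M i\<in>{..<CARD('d)}. ?N)
        (\<lambda>\<omega>. \<lambda>n\<in>{..<CARD('d)}. \<omega> (f n))) borel (\<lambda>z. \<Sum>i<CARD('d). (z i)\<^sup>2)"
      unfolding chi_squared_def
      by (subst distr_PiM_reindex) (use f in \<open>auto simp: bij_betw_def prob_space_std_normal\<close>)
    also have "\<dots> = distr (\<Pi>\<^sub>M i\<in>UNIV. ?N) borel (\<lambda>z. \<Sum>i<CARD('d). (z (f i))\<^sup>2)"
      by (subst distr_distr) (auto simp: o_def)
    also have "(\<lambda>z. \<Sum>i<CARD('d). (z (f i))\<^sup>2) = (\<lambda>z::'d \<Rightarrow> real. \<Sum>i\<in>UNIV. (z i)\<^sup>2)"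
      by (intro ext sum.reindex_bij_betw f)
    finally show ?thesis by simp
  qed
  finally show ?thesis .
qed

section \<open>The chi-squared law and its quantiles\<close>

lemma real_distribution_chi_squared: "real_distribution (chi_squared d)"
proof -
  interpret product_prob_space "\<lambda>_::nat. std_normal_distribution" "{..<d}"
    by (rule product_prob_space_std_normal)
  show ?thesis unfolding chi_squared_def by (rule P.real_distribution_distr) measurable
qed

text \<open>By Fubini all coordinates but the last are frozen. The last one must then have a
  prescribed square, which leaves at most two values, a null set for the normal density.\<close>

lemma emeasure_chi_squared_singleton:
  assumes "d > 0"
  shows "emeasure (chi_squared d) {c} = 0"
proof -
  interpret product_prob_space "\<lambda>_::nat. std_normal_distribution" UNIV
    by (rule product_prob_space_std_normal)
  obtain k where d: "d = Suc k" using assms by (cases d) auto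
  let ?M = "\<lambda>I::nat set. \<Pi>\<^sub>M i\<in>I. std_normal_distribution"
  have eq: "{..<d} = insert k {..<k}" by (auto simp: d)
  have [measurable]: "(\<lambda>z. \<Sum>i<d. (z i)\<^sup>2) \<in> borel_measurable (?M {..<d})" by measurable
  have "emeasure (chi_squared d) {c} = emeasure (?M {..<d}) ((\<lambda>z. \<Sum>i<d. (z i)\<^sup>2) -` {c} \<inter> space (?M {..<d}))"
    unfolding chi_squared_def by (subst emeasure_distr) auto
  also have "\<dots> = (\<integral>\<^sup>+z. indicator {c} (\<Sum>i<d. (z i)\<^sup>2) \<partial>?M {..<d})"
  proof -
    have "(\<lambda>z. \<Sum>i<d. (z i)\<^sup>2) -` {c} \<inter> space (?M {..<d}) \<in> sets (?M {..<d})" by measurable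
    from nn_integral_indicator[OF this, symmetric] show ?thesis
      by (auto intro!: nn_integral_cong elim!: trans simp: indicator_def)
  qed
  also have "\<dots> = (\<integral>\<^sup>+x. (\<integral>\<^sup>+y. indicator {c} (\<Sum>i<d. ((x(k := y)) i)\<^sup>2) \<partial>std_normal_distribution) \<partial>?M {..<k})"
    unfolding eq by (rule product_nn_integral_insert) (auto simp: eq[symmetric])
  also have "\<dots> = (\<integral>\<^sup>+x. 0 \<partial>?M {..<k})"
  proof (rule nn_integral_cong)
    fix x :: "nat \<Rightarrow> real"
    \<comment> \<open>If \<open>?a < 0\<close>, no \<open>y\<close> solves the equation; the
      two-point set is then merely an upper bound, and still a null set.\<close>
    let ?a = "c - (\<Sum>i<k. (x i)\<^sup>2)"
    have "(\<Sum>i<d. ((x(k := y)) i)\<^sup>2) = (\<Sum>i<k. (x i)\<^sup>2) + y\<^sup>2" for y by (simp add: d)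
    then have le: "indicator {c} (\<Sum>i<d. ((x(k := y)) i)\<^sup>2) \<le> (indicator {sqrt ?a, - sqrt ?a} y :: ennreal)" for y
    proof (cases "(\<Sum>i<k. (x i)\<^sup>2) + y\<^sup>2 = c")
      case True
      then have "sqrt ?a = \<bar>y\<bar>" by (auto simp: algebra_simps)
      then show ?thesis by (auto simp: indicator_def abs_if split: if_splits)
    qed (simp add: \<open>\<And>y. (\<Sum>i<d. ((x(k := y)) i)\<^sup>2) = (\<Sum>i<k. (x i)\<^sup>2) + y\<^sup>2\<close>)
    have "(\<integral>\<^sup>+y. indicator {c} (\<Sum>i<d. ((x(k := y)) i)\<^sup>2) \<partial>std_normal_distribution)
        \<le> (\<integral>\<^sup>+y. indicator {sqrt ?a, - sqrt ?a} y \<partial>std_normal_distribution)"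
      by (intro nn_integral_mono le)
    also have "\<dots> = emeasure std_normal_distribution {sqrt ?a, - sqrt ?a}"
      by (subst nn_integral_indicator) auto
    also have "\<dots> = 0"
    proof -
      have "{sqrt ?a, - sqrt ?a} \<in> null_sets lborel" by (rule finite_imp_null_set_lborel) simp
      moreover have "absolutely_continuous lborel std_normal_distribution"
        by (rule absolutely_continuousI_density) simp
      ultimately show ?thesis by (auto simp: absolutely_continuous_def)
    qed
    finally show "(\<integral>\<^sup>+y. indicator {c} (\<Sum>i<d. ((x(k := y)) i)\<^sup>2) \<partial>std_normal_distribution) = 0"
      by simp
  qed
  finally show ?thesis by simp
qed

text \<open>By continuity of the distribution function the infimum is attained, which gives at least
  \<open>p\<close>; its values to the left lie below \<open>p\<close>, which gives at most
  \<open>p\<close>. Without atoms the half-line may be taken open.\<close>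

lemma measure_lessThan_quantile:
  assumes D: "real_distribution D" and atomless: "\<And>x. measure D {x} = 0" and p: "0 < p" "p < 1"
  shows "measure D {..<quantile D p} = p"
proof -
  interpret real_distribution D by fact
  have cont: "isCont (cdf D) x" for x by (simp add: isCont_cdf atomless)
  define A where "A = {x. p \<le> cdf D x}"
  have "\<forall>\<^sub>F x in at_top. cdf D x > p"
    using order_tendstoD(1)[OF cdf_lim_at_top_prob p(2)] .
  then obtain a where "a \<in> A" by (auto simp: A_def eventually_at_top_linorder intro: less_imp_le)
  have "\<forall>\<^sub>F x in at_bot. cdf D x < p"
    using order_tendstoD(2)[OF cdf_lim_at_bot p(1)] .
  then obtain b where b: "\<And>x. x \<le> b \<Longrightarrow> cdf D x < p" by (auto simp: eventually_at_bot_linorder)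
  have "b \<le> x" if "x \<in> A" for x
    using b[of x] that unfolding A_def by (cases "x \<le> b") auto
  then have bdd: "bdd_below A" by (rule bdd_belowI)
  have "closed A" unfolding A_def
    by (intro closed_Collect_le continuous_on_const continuous_at_imp_continuous_on) (simp add: cont)
  then have "Inf A \<in> A"
    using closed_contains_Inf[of A] \<open>a \<in> A\<close> bdd by auto
  define q where "q = Inf A"
  have "cdf D q \<ge> p" using \<open>Inf A \<in> A\<close> by (simp add: A_def q_def)
  moreover have "cdf D q \<le> p"
  proof (rule tendsto_upperbound)
    show "(cdf D \<longlongrightarrow> cdf D q) (at_left q)"
      using cont[of q] by (auto simp: isCont_def intro: tendsto_within_subset)
    have "cdf D x \<le> p" if "x < q" for x
      using cInf_lower[OF _ bdd, of x] that by (force simp: A_def q_def)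
    then show "\<forall>\<^sub>F x in at_left q. cdf D x \<le> p"
      by (auto simp: eventually_at_filter)
  qed simp
  moreover have "cdf D q = measure D {..<q} + measure D {q}"
    unfolding cdf_def ivl_disj_un_singleton(2)[symmetric] by (rule finite_measure_Union) auto
  ultimately show ?thesis by (simp add: atomless quantile_def q_def A_def)
qed

text \<open>Replacing the random matrix by the inverse of \<open>V\<close> changes the form by a
  finite sum of null sequences times tight products of coordinates. The form with the fixed matrix
  is a continuous function of \<open>X n\<close>, and for its Gaussian limit it is a sum of squares
  of independent standard normals. The quantile is no atom of this law, so the probabilities of the
  half-line converge.\<close>

theorem (in prob_space) quadratic_form_converges_to_chi_squared:
  fixes X :: "nat \<Rightarrow> 'a \<Rightarrow> real^'d" and W :: "nat \<Rightarrow> 'a \<Rightarrow> real^'d^'d"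
  assumes V: "\<And>i j. V$i$j = V$j$i" "\<And>x. 0 \<le> x \<bullet> (V *v x)" "invertible V"
    and conv: "converges_in_distribution M X (multivariate_normal 0 V)"
    and tight: "tight_sequence M X"
    and W [measurable]: "\<And>n i j. (\<lambda>\<omega>. W n \<omega> $ i $ j) \<in> borel_measurable M"
    and W_conv: "\<And>i j. converges_in_probability_to_0 M (\<lambda>n \<omega>. W n \<omega> $ i $ j - matrix_inv V $ i $ j)"
    and p: "0 < p" "p < 1"
  shows "(\<lambda>n. \<P>(\<omega> in M. X n \<omega> \<bullet> (W n \<omega> *v X n \<omega>) < quantile (chi_squared CARD('d)) p)) \<longlonglongrightarrow> p"
proof -
  let ?D = "chi_squared CARD('d)" and ?q = "quantile (chi_squared CARD('d)) p"
  have X [measurable]: "X n \<in> borel_measurable M" for n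
    using conv by (simp add: converges_in_distribution_def)
  define Q where "Q n \<omega> = X n \<omega> \<bullet> (W n \<omega> *v X n \<omega>)" for n \<omega>
  define Q' where "Q' n \<omega> = X n \<omega> \<bullet> (matrix_inv V *v X n \<omega>)" for n \<omega>
  have quad: "x \<bullet> (A *v x) = (\<Sum>i\<in>UNIV. \<Sum>j\<in>UNIV. A $ i $ j * (x $ i * x $ j))"
    for x :: "real^'d" and A :: "real^'d^'d"
    by (simp add: inner_vec_def matrix_vector_mult_def sum_distrib_left mult_ac)
  have [measurable]: "Q n \<in> borel_measurable M" "Q' n \<in> borel_measurable M" for n
    unfolding Q_def Q'_def quad by measurable
  have diff: "Q n \<omega> - Q' n \<omega> =
      (\<Sum>k\<in>UNIV\<times>UNIV. (W n \<omega> $ fst k $ snd k - matrix_inv V $ fst k $ snd k) * (X n \<omega> $ fst k * X n \<omega> $ snd k))"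
    for n \<omega>
    by (simp add: Q_def Q'_def quad sum.cartesian_product left_diff_distrib sum_subtractf case_prod_beta)
  have QQ': "converges_in_probability_to_0 M (\<lambda>n \<omega>. Q n \<omega> - Q' n \<omega>)"
    unfolding diff
    by (intro converges_in_probability_sum converges_in_probability_times_tight
        tight_sequence_component_product prob_space_axioms W_conv tight) measurable
  have [measurable]: "cts_step a b \<in> borel_measurable borel" for a b
    unfolding cts_step_def by measurable
  \<comment> \<open>The functions \<open>cts_step\<close> determine weak convergence on the line.
    Their uniform continuity is used to pass from \<open>Q'\<close> to \<open>Q\<close>, whose
    values need not stay in a compact set.\<close>
  have lim: "(\<lambda>n. expectation (\<lambda>\<omega>. cts_step a b (Q n \<omega>))) \<longlonglongrightarrow> integral\<^sup>L ?D (cts_step a b)"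
    if ab: "a < b" for a b
  proof -
    have uc: "uniformly_continuous_on UNIV (cts_step a b)" by (rule cts_step_uniformly_continuous[OF ab])
    have bd: "\<bar>cts_step a b x\<bar> \<le> 1" for x using ab by (auto simp: cts_step_def)
    have int: "integrable M (\<lambda>\<omega>. cts_step a b (Z \<omega>))" if [measurable]: "Z \<in> borel_measurable M" for Z
      by (rule integrable_const_bound[of _ 1]) (use bd in auto)
    have [measurable]: "(\<lambda>x. matrix_inv V *v x) \<in> borel_measurable borel"
      by (intro borel_measurable_continuous_onI linear_continuous_on matrix_vector_mul_bounded_linear)
    have "continuous_on UNIV (\<lambda>x. x \<bullet> (matrix_inv V *v x))" (is ?cont)
      by (intro continuous_intros linear_continuous_on matrix_vector_mul_bounded_linear)
    then have "continuous_on UNIV (\<lambda>x. cts_step a b (x \<bullet> (matrix_inv V *v x)))"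
      by (intro continuous_on_compose2[OF uniformly_continuous_imp_continuous[OF uc]]) auto
    moreover have "bounded (range (\<lambda>x. cts_step a b (x \<bullet> (matrix_inv V *v x))))"
      using bd by (intro boundedI[of _ 1]) auto
    ultimately have "(\<lambda>n. expectation (\<lambda>\<omega>. cts_step a b (Q' n \<omega>))) \<longlonglongrightarrow>
        (\<integral>x. cts_step a b (x \<bullet> (matrix_inv V *v x)) \<partial>multivariate_normal 0 V)"
      using conv unfolding converges_in_distribution_def Q'_def by blast
    also have "(\<integral>x. cts_step a b (x \<bullet> (matrix_inv V *v x)) \<partial>multivariate_normal 0 V) = integral\<^sup>L ?D (cts_step a b)"
      unfolding distr_quadratic_form_multivariate_normal[OF V, symmetric]
      by (subst integral_distr)
        (simp_all add: measurable_cong_sets[OF sets_multivariate_normal refl]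
          borel_measurable_continuous_onI[OF \<open>?cont\<close>])
    finally have Q': "(\<lambda>n. expectation (\<lambda>\<omega>. cts_step a b (Q' n \<omega>))) \<longlonglongrightarrow> integral\<^sup>L ?D (cts_step a b)" .
    have "(\<lambda>n. expectation (\<lambda>\<omega>. cts_step a b (Q n \<omega>) - cts_step a b (Q' n \<omega>))) \<longlonglongrightarrow> 0"
    proof (rule tendsto_if_subseq)
      fix r :: "nat \<Rightarrow> nat" assume r: "strict_mono r"
      obtain s where s: "strict_mono s" "AE \<omega> in M. (\<lambda>n. Q (r (s n)) \<omega> - Q' (r (s n)) \<omega>) \<longlonglongrightarrow> 0"
        using converges_in_probability_AE_subseq[of "{()}" "\<lambda>_ n \<omega>. Q n \<omega> - Q' n \<omega>" r] QQ' r by auto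
      have "(\<lambda>n. expectation (\<lambda>\<omega>. cts_step a b (Q (r (s n)) \<omega>) - cts_step a b (Q' (r (s n)) \<omega>)))
          \<longlonglongrightarrow> expectation (\<lambda>\<omega>. 0 :: real)"
      proof (rule integral_dominated_convergence[where w="\<lambda>\<omega>. 2"])
        show "AE \<omega> in M. (\<lambda>n. cts_step a b (Q (r (s n)) \<omega>) - cts_step a b (Q' (r (s n)) \<omega>)) \<longlonglongrightarrow> 0"
          using s(2)
        proof eventually_elim
          case (elim \<omega>)
          then have "(\<lambda>n. dist (Q (r (s n)) \<omega>) (Q' (r (s n)) \<omega>)) \<longlonglongrightarrow> 0"
            by (simp add: dist_real_def tendsto_rabs_zero)
          then have "(\<lambda>n. dist (cts_step a b (Q (r (s n)) \<omega>)) (cts_step a b (Q' (r (s n)) \<omega>))) \<longlonglongrightarrow> 0"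
            using uc[unfolded uniformly_continuous_on_sequentially, THEN spec, THEN spec,
                of "\<lambda>n. Q (r (s n)) \<omega>" "\<lambda>n. Q' (r (s n)) \<omega>"] by simp
          then show ?case unfolding dist_real_def by (rule tendsto_rabs_zero_cancel)
        qed
        show "AE \<omega> in M. norm (cts_step a b (Q (r (s n)) \<omega>) - cts_step a b (Q' (r (s n)) \<omega>)) \<le> 2" for n
        proof (rule AE_I2)
          fix \<omega> show "norm (cts_step a b (Q (r (s n)) \<omega>) - cts_step a b (Q' (r (s n)) \<omega>)) \<le> 2"
            using bd[of "Q (r (s n)) \<omega>"] bd[of "Q' (r (s n)) \<omega>"] unfolding real_norm_def by linarith
        qed
      qed auto
      with s(1) show "\<exists>s. strict_mono s \<and>
          (\<lambda>n. expectation (\<lambda>\<omega>. cts_step a b (Q (r (s n)) \<omega>) - cts_step a b (Q' (r (s n)) \<omega>))) \<longlonglongrightarrow> 0"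
        by auto
    qed
    from tendsto_add[OF this Q'] show ?thesis by (simp add: int)
  qed
  have atom: "emeasure ?D {x} = 0" for x by (rule emeasure_chi_squared_singleton) simp
  have "weak_conv_m (\<lambda>n. distr M borel (Q n)) ?D"
    by (rule integral_cts_step_conv_imp_weak_conv)
      (auto simp: real_distribution_distr real_distribution_chi_squared integral_distr lim)
  then have "(\<lambda>n. measure (distr M borel (Q n)) {..<?q}) \<longlonglongrightarrow> measure ?D {..<?q}"
    by (rule weak_conv_imp_continuity_set_conv[rotated 2])
      (auto simp: real_distribution_distr real_distribution_chi_squared frontier_real_lessThan atom)
  moreover have "measure ?D {..<?q} = p"
    by (rule measure_lessThan_quantile[OF real_distribution_chi_squared _ p]) (simp add: measure_def atom)
  moreover have "measure (distr M borel (Q n)) {..<?q} = \<P>(\<omega> in M. Q n \<omega> < ?q)" for n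
    by (subst measure_distr) (auto intro!: arg_cong[where f=prob])
  ultimately show ?thesis by (simp add: Q_def)
qed

section \<open>Samples from the strata\<close>

lemma group_count_0 [simp]: "group_count S s 0 \<omega> = 0"
  by (simp add: group_count_def)

lemma group_count_Suc: "group_count S s (Suc n) \<omega> = group_count S s n \<omega> + of_bool (S (Suc n) \<omega> = s)"
  by (simp add: group_count_def)

lemma group_count_mono: "m \<le> n \<Longrightarrow> group_count S s m \<omega> \<le> group_count S s n \<omega>"
  unfolding group_count_def by (intro sum_mono2) auto

lemma real_group_count: "real (group_count S s n \<omega>) = (\<Sum>i=1..n. of_bool (S i \<omega> = s))"
  unfolding group_count_def by (simp add: of_nat_sum of_bool_def if_distrib cong: if_cong)

lemma sample_index_hit:
  assumes lim: "filterlim (\<lambda>n. group_count S s n \<omega>) at_top sequentially" and hit: "S (Suc n) \<omega> = s"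
  shows "sample_index S s (Suc (group_count S s n \<omega>)) \<omega> = Suc n"
proof -
  have "(LEAST k. 1 \<le> k \<and> group_count S s k \<omega> = Suc (group_count S s n \<omega>)) = Suc n"
  proof (rule Least_equality)
    show "1 \<le> Suc n \<and> group_count S s (Suc n) \<omega> = Suc (group_count S s n \<omega>)"
      using hit by (simp add: group_count_Suc)
    show "Suc n \<le> k" if "1 \<le> k \<and> group_count S s k \<omega> = Suc (group_count S s n \<omega>)" for k
      using group_count_mono[of k n S s \<omega>] that by (cases "k \<le> n") auto
  qed
  with lim show ?thesis by (simp add: sample_index_def)
qed

text \<open>This removes the random index: when unit n + 1 carries the label, it is the next draw of
  the stratum, so both sides gain the same term; otherwise neither changes. The right-hand side has
  a fixed number of summands, each a function of one unit.\<close>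

lemma sum_group_sample:
  assumes "filterlim (\<lambda>n. group_count S s n \<omega>) at_top sequentially"
  shows "(\<Sum>j=1..group_count S s n \<omega>. h (group_sample Y S s j \<omega>))
    = (\<Sum>i=1..n. if S i \<omega> = s then h (Y i \<omega>) else 0)"
proof (induction n)
  case (Suc n)
  then show ?case
    using sample_index_hit[OF assms, of n]
    by (cases "S (Suc n) \<omega> = s") (simp_all add: group_count_Suc group_sample_def)
qed simp

text \<open>Counts start at 0 and grow by at most one per unit, so on the divergence event they take
  every value and the \<open>LEAST\<close> is over a nonempty set. Consequently a draw never reads
  \<open>Y 0\<close>, about which no measurability is known.\<close>

lemma sample_index_ge_1:
  assumes "j \<ge> 1"
  shows "sample_index S s j \<omega> \<ge> 1"
proof (cases "filterlim (\<lambda>n. group_count S s n \<omega>) at_top sequentially")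
  case True
  then obtain m where m: "group_count S s m \<omega> \<ge> j"
    by (auto simp: filterlim_at_top eventually_sequentially)
  have "\<exists>k. group_count S s k \<omega> = j"
    using m
  proof (induction m)
    case (Suc m)
    then show ?case
      by (cases "j \<le> group_count S s m \<omega>"; cases "S (Suc m) \<omega> = s")
        (auto simp: group_count_Suc intro!: exI[of _ "Suc m"])
  qed (use assms in auto)
  then obtain k where k: "group_count S s k \<omega> = j" by blast
  with assms have "1 \<le> k \<and> group_count S s k \<omega> = j" by (cases k) auto
  from LeastI[of "\<lambda>k. 1 \<le> k \<and> group_count S s k \<omega> = j", OF this] True show ?thesis
    by (simp add: sample_index_def)
qed (simp add: sample_index_def)

context
  fixes P :: "'a measure" and S :: "nat \<Rightarrow> 'a \<Rightarrow> nat" and A :: "nat set"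
  assumes S: "\<And>i. i \<ge> 1 \<Longrightarrow> S i \<in> measurable P (count_space A)"
begin

lemma pred_label: "i \<ge> 1 \<Longrightarrow> Measurable.pred P (\<lambda>\<omega>. S i \<omega> = s)"
  by (rule measurable_compose[OF S]) auto

lemma measurable_group_count [measurable]: "group_count S s n \<in> measurable P (count_space UNIV)"
proof (induction n)
  case (Suc n)
  have [measurable]: "Measurable.pred P (\<lambda>\<omega>. S (Suc n) \<omega> = s)" by (rule pred_label) simp
  note Suc [measurable]
  have "(\<lambda>\<omega>. group_count S s n \<omega> + (if S (Suc n) \<omega> = s then 1 else 0)) \<in> measurable P (count_space UNIV)"
    by measurable
  then show ?case by (simp add: group_count_Suc[abs_def] of_bool_def fun_eq_iff cong: measurable_cong)
qed (simp add: group_count_def[abs_def])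

lemma measurable_sample_index: 
  assumes "j \<ge> 1" 
  shows "sample_index S s j \<in> measurable P (count_space {1..})"
proof -
  have "sample_index S s j \<in> measurable P (count_space UNIV)"
    \<comment> \<open>Divergence of the counts becomes a statement with quantifiers over natural
      numbers only, hence a countable combination of measurable conditions.\<close>
    unfolding sample_index_def[abs_def] filterlim_at_top eventually_sequentially by measurable
  then show ?thesis
    using sample_index_ge_1[OF assms] unfolding measurable_count_space_eq2_countable
    by (auto simp: measurable_def)
qed

lemma measurable_group_sample:
  assumes "\<And>i. i \<ge> 1 \<Longrightarrow> Y i \<in> measurable P N" and "j \<ge> 1"
  shows "group_sample Y S s j \<in> measurable P N"
  unfolding group_sample_def[abs_def]
  by (rule measurable_compose_countable'[OF _ measurable_sample_index[OF assms(2)]]) (use assms in auto)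

lemma borel_measurable_group_mean:
  fixes Y :: "nat \<Rightarrow> 'a \<Rightarrow> real^'d"
  assumes "\<And>i. i \<ge> 1 \<Longrightarrow> Y i \<in> borel_measurable P"
  shows "group_mean Y S s m \<in> borel_measurable P"
  unfolding group_mean_def[abs_def]
  by (intro borel_measurable_scaleR borel_measurable_const borel_measurable_sum
      measurable_group_sample assms) auto

lemma borel_measurable_weighted_mean:
  fixes Y :: "nat \<Rightarrow> 'a \<Rightarrow> real^'d"
  assumes Y: "\<And>i. i \<ge> 1 \<Longrightarrow> Y i \<in> borel_measurable P"
    and l: "\<And>s. s \<in> {1..\<xi>} \<Longrightarrow> l n s \<in> borel_measurable P"
  shows "weighted_mean \<xi> l Y S n \<in> borel_measurable P"
  unfolding weighted_mean_def[abs_def]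
  by (intro borel_measurable_sum borel_measurable_scaleR l
      measurable_compose_countable[OF borel_measurable_group_mean measurable_group_count] Y) auto

lemma borel_measurable_group_covariance:
  fixes Y :: "nat \<Rightarrow> 'a \<Rightarrow> real^'d"
  assumes Y: "\<And>i. i \<ge> 1 \<Longrightarrow> Y i \<in> borel_measurable P"
  shows "(\<lambda>\<omega>. group_covariance Y S s n \<omega> $ i $ j) \<in> borel_measurable P"
proof -
  have "(\<lambda>\<omega>. (1 / (real N - 1)) * (\<Sum>k=1..N. (group_sample Y S s k \<omega> - group_mean Y S s N \<omega>) $ i
      * (group_sample Y S s k \<omega> - group_mean Y S s N \<omega>) $ j)) \<in> borel_measurable P" for N
    by (intro borel_measurable_times borel_measurable_const borel_measurable_sum borel_measurable_component
        borel_measurable_diff measurable_group_sample borel_measurable_group_mean Y) auto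
  from measurable_compose_countable[OF this measurable_group_count[of s n]] show ?thesis
    by (simp add: group_covariance_def Let_def outer_product_def)
qed

lemma borel_measurable_weighted_covariance:
  fixes Y :: "nat \<Rightarrow> 'a \<Rightarrow> real^'d"
  assumes Y: "\<And>i. i \<ge> 1 \<Longrightarrow> Y i \<in> borel_measurable P"
    and l: "\<And>s. s \<in> {1..\<xi>} \<Longrightarrow> l n s \<in> borel_measurable P"
  shows "(\<lambda>\<omega>. weighted_covariance \<xi> l Y S n \<omega> $ i $ j) \<in> borel_measurable P"
proof -
  have "(\<lambda>\<omega>. \<Sum>s=1..\<xi>. (real n * (l n s \<omega>)\<^sup>2 / real (group_count S s n \<omega>)) * group_covariance Y S s n \<omega> $ i $ j)
      \<in> borel_measurable P"
  proof (intro borel_measurable_sum borel_measurable_times borel_measurable_divide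
        borel_measurable_const borel_measurable_power l borel_measurable_group_covariance Y)
    show "(\<lambda>\<omega>. real (group_count S s n \<omega>)) \<in> borel_measurable P" for s by measurable
  qed auto
  then show ?thesis by (simp add: weighted_covariance_def)
qed

end

section \<open>Integration over a group\<close>

lemma (in prob_space) given_group_eq_density:
  assumes pos: "\<P>(\<omega> in M. S \<omega> = s) > 0"
  shows "given_group M S s =
    density M (\<lambda>\<omega>. ennreal (indicator {\<omega> \<in> space M. S \<omega> = s} \<omega> / \<P>(\<omega> in M. S \<omega> = s)))"
proof -
  let ?A = "{\<omega> \<in> space M. S \<omega> = s}"
  have "indicator ?A \<omega> / emeasure M ?A = ennreal (indicator ?A \<omega> / prob ?A)" for \<omega>
    using pos by (simp add: emeasure_eq_measure divide_ennreal[symmetric] split: split_indicator)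
  then show ?thesis by (simp add: given_group_def uniform_measure_def)
qed

lemma (in prob_space) prob_space_given_group:
  assumes "\<P>(\<omega> in M. S \<omega> = s) > 0"
  shows "prob_space (given_group M S s)"
  unfolding given_group_def using assms
  by (intro prob_space_uniform_measure) (auto simp: emeasure_eq_measure)

text \<open>The conditional measure has the normalised indicator of the group as density, so
  multiplying by the probability of the group undoes the conditioning. For a group of probability 0
  both sides vanish, which is why the law is prescribed only when the probability is
  positive.\<close>

lemma (in prob_space) integral_on_group:
  fixes Y :: "'a \<Rightarrow> 'c::topological_space" and h :: "'c \<Rightarrow> 'b::{banach, second_countable_topology}"
  assumes [measurable]: "Y \<in> borel_measurable M" "{\<omega> \<in> space M. S \<omega> = s} \<in> events" "h \<in> borel_measurable borel"
    and law: "\<P>(\<omega> in M. S \<omega> = s) > 0 \<Longrightarrow> distr (given_group M S s) borel Y = \<nu>"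
    and h: "integrable \<nu> h"
  shows "integrable M (\<lambda>\<omega>. if S \<omega> = s then h (Y \<omega>) else 0)"
    and "(\<integral>\<omega>. (if S \<omega> = s then h (Y \<omega>) else 0) \<partial>M) = \<P>(\<omega> in M. S \<omega> = s) *\<^sub>R integral\<^sup>L \<nu> h"
proof -
  let ?A = "{\<omega> \<in> space M. S \<omega> = s}"
  have "integrable M (\<lambda>\<omega>. if S \<omega> = s then h (Y \<omega>) else 0) \<and>
      (\<integral>\<omega>. (if S \<omega> = s then h (Y \<omega>) else 0) \<partial>M) = prob ?A *\<^sub>R integral\<^sup>L \<nu> h"
  proof (cases "prob ?A = 0")
    case True
    then have "AE \<omega> in M. \<omega> \<notin> ?A" by (subst AE_iff_measurable[OF _ refl]) (auto simp: emeasure_eq_measure)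
    then have ae: "AE \<omega> in M. (if S \<omega> = s then h (Y \<omega>) else 0) = 0"
      by (auto elim: AE_mp)
    have [measurable]: "(\<lambda>\<omega>. if S \<omega> = s then h (Y \<omega>) else 0) \<in> borel_measurable M" by measurable
    show ?thesis using integrable_cong_AE[OF _ _ ae] integral_cong_AE[OF _ _ ae] True by simp
  next
    case False
    then have p: "prob ?A > 0" by (simp add: zero_less_measure_iff measure_nonneg less_le)
    note dens = given_group_eq_density[of S s, OF p]
    have [measurable]: "Y \<in> borel_measurable (given_group M S s)"
      by (simp add: dens)
    have eq: "(if S \<omega> = s then h (Y \<omega>) else 0) = prob ?A *\<^sub>R ((indicator ?A \<omega> / prob ?A) *\<^sub>R h (Y \<omega>))"
      if "\<omega> \<in> space M" for \<omega>
      using p that by (auto simp: indicator_def)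
    have hY: "integrable (given_group M S s) (\<lambda>\<omega>. h (Y \<omega>))"
      "(\<integral>\<omega>. h (Y \<omega>) \<partial>given_group M S s) = integral\<^sup>L \<nu> h"
      using h unfolding law[OF p, symmetric] by (auto simp: integrable_distr_eq integral_distr)
    then have "integrable M (\<lambda>\<omega>. (indicator ?A \<omega> / prob ?A) *\<^sub>R h (Y \<omega>))"
      and "(\<integral>\<omega>. (indicator ?A \<omega> / prob ?A) *\<^sub>R h (Y \<omega>) \<partial>M) = integral\<^sup>L \<nu> h"
      unfolding dens by (auto simp: integrable_density integral_density)
    then show ?thesis
      by (simp only: Bochner_Integration.integrable_cong[OF refl eq] Bochner_Integration.integral_cong[OF refl eq]
          integrable_scaleR_right integral_scaleR_right)
  qed
  then show "integrable M (\<lambda>\<omega>. if S \<omega> = s then h (Y \<omega>) else 0)"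
    and "(\<integral>\<omega>. (if S \<omega> = s then h (Y \<omega>) else 0) \<partial>M) = \<P>(\<omega> in M. S \<omega> = s) *\<^sub>R integral\<^sup>L \<nu> h"
    by auto
qed

section \<open>Limit theorems for sums over the sample\<close>

lemma exp_minus_approx:
  fixes x :: real
  assumes "x \<ge> 0"
  shows "\<bar>exp (- x) - (1 - x)\<bar> \<le> x\<^sup>2"
proof -
  have "exp (- x) \<le> 1 - x + x\<^sup>2"
  proof -
    \<comment> \<open>The product equals 1 + x^3.\<close>
    have "1 \<le> (1 - x + x\<^sup>2) * (1 + x)"
      using assms by (simp add: power2_eq_square algebra_simps)
    also have "\<dots> \<le> (1 - x + x\<^sup>2) * exp x"
    proof (rule mult_left_mono[OF exp_ge_add_one_self])
      have "0 \<le> (x - 1/2)\<^sup>2 + 3/4" by simp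
      then show "0 \<le> 1 - x + x\<^sup>2" by (simp add: power2_eq_square algebra_simps)
    qed
    finally show ?thesis by (simp add: exp_minus field_simps)
  qed
  moreover have "1 - x \<le> exp (- x)" using exp_ge_add_one_self[of "- x"] by simp
  ultimately show ?thesis by (simp add: abs_le_iff)
qed

lemma abs_min_nonneg_le:
  fixes a b :: real
  assumes "0 \<le> a" "0 \<le> b"
  shows "\<bar>min a b\<bar> \<le> a" and "\<bar>min a b\<bar> \<le> b"
  using assms by (auto simp: min_def)

text \<open>The remainder is t^2 times a function \<delta> that depends on the law alone. The
  integrand of \<delta> tends to 0 pointwise as t -> 0 and is dominated by 6 x^2, so a finite second
  moment is enough for dominated convergence.\<close>

lemma (in real_distribution) char_second_order:
  assumes int: "integrable M (\<lambda>x. x\<^sup>2)" and mean: "expectation (\<lambda>x. x) = 0"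
  shows "\<exists>\<delta>. (\<forall>t. cmod (char M t - complex_of_real (1 - t\<^sup>2 * expectation (\<lambda>x. x\<^sup>2) / 2)) \<le> t\<^sup>2 * \<delta> t) \<and>
    (\<forall>t. \<delta> t \<ge> 0) \<and> (\<forall>t. t \<longlonglongrightarrow> 0 \<longrightarrow> (\<lambda>n. \<delta> (t n)) \<longlonglongrightarrow> 0)"
proof -
  define \<delta> where "\<delta> t = expectation (\<lambda>x. min (6 * x\<^sup>2) (\<bar>t\<bar> * \<bar>x\<bar> ^ 3)) / 6" for t
  have i1: "integrable M (\<lambda>x. x)"
    by (rule square_integrable_imp_integrable[OF _ int]) simp
  have 1: "cmod (char M t - complex_of_real (1 - t\<^sup>2 * expectation (\<lambda>x. x\<^sup>2) / 2)) \<le> t\<^sup>2 * \<delta> t" for t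
    using char_approx3[OF i1 mean int, of "expectation (\<lambda>x. x\<^sup>2)" t] mean by (simp add: \<delta>_def)
  have 2: "\<delta> t \<ge> 0" for t
    unfolding \<delta>_def by (intro divide_nonneg_pos integral_nonneg_AE AE_I2 min.boundedI) auto
  have 3: "(\<lambda>n. \<delta> (t n)) \<longlonglongrightarrow> 0" if t: "t \<longlonglongrightarrow> 0" for t
  proof -
    have "(\<lambda>n. min (6 * x\<^sup>2) (\<bar>t n\<bar> * \<bar>x\<bar> ^ 3)) \<longlonglongrightarrow> 0" for x :: real
    proof (rule Lim_null_comparison)
      show "\<forall>\<^sub>F n in sequentially. norm (min (6 * x\<^sup>2) (\<bar>t n\<bar> * \<bar>x\<bar> ^ 3)) \<le> \<bar>t n\<bar> * \<bar>x\<bar> ^ 3"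
        unfolding real_norm_def by (intro always_eventually allI abs_min_nonneg_le) auto
      show "(\<lambda>n. \<bar>t n\<bar> * \<bar>x\<bar> ^ 3) \<longlonglongrightarrow> 0"
        by (intro tendsto_mult_left_zero tendsto_rabs_zero t)
    qed
    note lim = this
    have "(\<lambda>n. expectation (\<lambda>x. min (6 * x\<^sup>2) (\<bar>t n\<bar> * \<bar>x\<bar> ^ 3))) \<longlonglongrightarrow> expectation (\<lambda>x. 0 :: real)"
    proof (rule integral_dominated_convergence[where w="\<lambda>x. 6 * x\<^sup>2"])
      show "AE x in M. norm (min (6 * x\<^sup>2) (\<bar>t n\<bar> * \<bar>x\<bar> ^ 3)) \<le> 6 * x\<^sup>2" for n
        unfolding real_norm_def by (intro AE_I2 abs_min_nonneg_le) auto
      show "integrable M (\<lambda>x. 6 * x\<^sup>2)" using int by simp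
      show "AE x in M. (\<lambda>n. min (6 * x\<^sup>2) (\<bar>t n\<bar> * \<bar>x\<bar> ^ 3)) \<longlonglongrightarrow> 0" using lim by simp
    qed auto
    from tendsto_divide_zero[OF this[unfolded Bochner_Integration.integral_zero]] show ?thesis unfolding \<delta>_def by simp
  qed
  show ?thesis using 1 2 3 by (intro exI[of _ \<delta>]) blast
qed

lemma (in real_distribution) char_first_order:
  assumes int: "integrable M (\<lambda>x. x)" and mean: "expectation (\<lambda>x. x) = 0"
  shows "\<exists>\<delta>. (\<forall>t. cmod (char M t - 1) \<le> \<bar>t\<bar> * \<delta> t) \<and>
    (\<forall>t. \<delta> t \<ge> 0) \<and> (\<forall>t. t \<longlonglongrightarrow> 0 \<longrightarrow> (\<lambda>n. \<delta> (t n)) \<longlonglongrightarrow> 0)"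
proof -
  define \<delta> where "\<delta> t = expectation (\<lambda>x. min (4 * \<bar>x\<bar>) (\<bar>t\<bar> * x\<^sup>2)) / 2" for t
  have i: "integrable M (\<lambda>x. x ^ k)" if "k \<le> 1" for k
    using that int by (cases k) auto
  have 1: "cmod (char M t - 1) \<le> \<bar>t\<bar> * \<delta> t" for t
    using char_approx2[OF i, of 1 t] mean prob_space
    by (simp add: \<delta>_def mult.commute numeral_2_eq_2[symmetric])
  have 2: "\<delta> t \<ge> 0" for t
    unfolding \<delta>_def by (intro divide_nonneg_pos integral_nonneg_AE AE_I2 min.boundedI) auto
  have 3: "(\<lambda>n. \<delta> (t n)) \<longlonglongrightarrow> 0" if t: "t \<longlonglongrightarrow> 0" for t
  proof -
    have "(\<lambda>n. min (4 * \<bar>x\<bar>) (\<bar>t n\<bar> * x\<^sup>2)) \<longlonglongrightarrow> 0" for x :: real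
    proof (rule Lim_null_comparison)
      show "\<forall>\<^sub>F n in sequentially. norm (min (4 * \<bar>x\<bar>) (\<bar>t n\<bar> * x\<^sup>2)) \<le> \<bar>t n\<bar> * x\<^sup>2"
        unfolding real_norm_def by (intro always_eventually allI abs_min_nonneg_le) auto
      show "(\<lambda>n. \<bar>t n\<bar> * x\<^sup>2) \<longlonglongrightarrow> 0"
        by (intro tendsto_mult_left_zero tendsto_rabs_zero t)
    qed
    note lim = this
    have "(\<lambda>n. expectation (\<lambda>x. min (4 * \<bar>x\<bar>) (\<bar>t n\<bar> * x\<^sup>2))) \<longlonglongrightarrow> expectation (\<lambda>x. 0 :: real)"
    proof (rule integral_dominated_convergence[where w="\<lambda>x. 4 * \<bar>x\<bar>"])
      show "AE x in M. norm (min (4 * \<bar>x\<bar>) (\<bar>t n\<bar> * x\<^sup>2)) \<le> 4 * \<bar>x\<bar>" for n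
        unfolding real_norm_def by (intro AE_I2 abs_min_nonneg_le) auto
      show "integrable M (\<lambda>x. 4 * \<bar>x\<bar>)" using int by simp
      show "AE x in M. (\<lambda>n. min (4 * \<bar>x\<bar>) (\<bar>t n\<bar> * x\<^sup>2)) \<longlonglongrightarrow> 0" using lim by simp
    qed auto
    from tendsto_divide_zero[OF this[unfolded Bochner_Integration.integral_zero]] show ?thesis unfolding \<delta>_def by simp
  qed
  show ?thesis using 1 2 3 by (intro exI[of _ \<delta>]) blast
qed

text \<open>The constant 1 is the characteristic function of the point mass at 0. By Levy continuity
  the laws converge weakly to it, and it does not charge the boundary points of {x. |x| >
  e}.\<close>

lemma (in prob_space) converges_in_probability_if_char:
  assumes X [measurable]: "\<And>n. X n \<in> borel_measurable M"
    and char: "\<And>t. (\<lambda>n. char (distr M borel (X n)) t) \<longlonglongrightarrow> 1"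
  shows "converges_in_probability_to_0 M X"
  unfolding converges_in_probability_to_0_def
proof (intro allI impI)
  fix e :: real assume e: "e > 0"
  let ?D = "return borel (0::real)"
  have D: "real_distribution ?D"
    by (simp add: real_distribution_def real_distribution_axioms_def prob_space_return)
  have c: "char ?D t = 1" for t
    unfolding char_def by (subst integral_return) auto
  let ?A = "{x::real. \<bar>x\<bar> > e}"
  have A: "?A = - {- e..e}" by auto
  have "frontier ?A = frontier {- e..e}"
    by (simp only: A frontier_complement)
  then have "0 \<notin> frontier ?A"
    using e by (simp add: frontier_def)
  then have fr: "emeasure ?D (frontier ?A) = 0"
    by simp
  have "weak_conv_m (\<lambda>n. distr M borel (X n)) ?D"
    by (rule levy_continuity) (auto simp: D c char)
  then have "(\<lambda>n. measure (distr M borel (X n)) ?A) \<longlonglongrightarrow> measure ?D ?A"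
    by (rule weak_conv_imp_continuity_set_conv[rotated 2]) (auto simp: D fr)
  moreover have "measure ?D ?A = 0" using e by (simp add: measure_return indicator_def)
  moreover have "measure (distr M borel (X n)) ?A = \<P>(\<omega> in M. \<bar>X n \<omega>\<bar> > e)" for n
    by (subst measure_distr) (auto intro!: arg_cong[where f=prob])
  ultimately show "(\<lambda>n. \<P>(\<omega> in M. \<bar>X n \<omega>\<bar> > e)) \<longlonglongrightarrow> 0" by simp
qed

lemma (in prob_space) expectation_square_sum_indep:
  fixes x :: "nat \<Rightarrow> 'a \<Rightarrow> real"
  assumes indep: "indep_vars (\<lambda>_. borel) x I" and I: "finite I"
    and sq: "\<And>i. i \<in> I \<Longrightarrow> integrable M (\<lambda>\<omega>. (x i \<omega>)\<^sup>2)"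
    and mean: "\<And>i. i \<in> I \<Longrightarrow> expectation (x i) = 0"
  shows "integrable M (\<lambda>\<omega>. (\<Sum>i\<in>I. x i \<omega>)\<^sup>2)"
    and "expectation (\<lambda>\<omega>. (\<Sum>i\<in>I. x i \<omega>)\<^sup>2) = (\<Sum>i\<in>I. expectation (\<lambda>\<omega>. (x i \<omega>)\<^sup>2))"
proof -
  have rv: "x i \<in> borel_measurable M" if "i \<in> I" for i
    using indep that by (simp add: indep_vars_def)
  have int: "integrable M (x i)" if "i \<in> I" for i
    by (rule square_integrable_imp_integrable[OF rv sq]) (use that in auto)
  have mix: "integrable M (\<lambda>\<omega>. x i \<omega> * x j \<omega>) \<and>
      expectation (\<lambda>\<omega>. x i \<omega> * x j \<omega>) = (if i = j then expectation (\<lambda>\<omega>. (x i \<omega>)\<^sup>2) else 0)"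
    if ij: "i \<in> I" "j \<in> I" for i j
  proof (cases "i = j")
    case False
    have ind: "indep_vars (\<lambda>_. borel) x {i, j}" by (rule indep_vars_subset[OF indep]) (use ij in auto)
    have p: "(\<Prod>k\<in>{i, j}. x k \<omega>) = x i \<omega> * x j \<omega>" for \<omega> using False by simp
    have "integrable M (\<lambda>\<omega>. \<Prod>k\<in>{i, j}. x k \<omega>)"
      by (rule indep_vars_integrable[OF _ ind]) (use ij int in auto)
    moreover have "expectation (\<lambda>\<omega>. \<Prod>k\<in>{i, j}. x k \<omega>) = (\<Prod>k\<in>{i, j}. expectation (x k))"
      by (rule indep_vars_lebesgue_integral[OF _ ind]) (use ij int in auto)
    ultimately show ?thesis using False mean[OF ij(1)] by (simp add: p)
  qed (use sq[OF ij(1)] in \<open>simp add: power2_eq_square\<close>)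
  have mixi: "integrable M (\<lambda>\<omega>. x i \<omega> * x j \<omega>)" if "i \<in> I" "j \<in> I" for i j
    using mix[OF that] by simp
  have eq: "(\<Sum>i\<in>I. x i \<omega>)\<^sup>2 = (\<Sum>i\<in>I. \<Sum>j\<in>I. x i \<omega> * x j \<omega>)" for \<omega>
    by (simp add: power2_eq_square sum_product)
  show "integrable M (\<lambda>\<omega>. (\<Sum>i\<in>I. x i \<omega>)\<^sup>2)"
    unfolding eq by (intro Bochner_Integration.integrable_sum mixi)
  have "expectation (\<lambda>\<omega>. (\<Sum>i\<in>I. x i \<omega>)\<^sup>2) = (\<Sum>i\<in>I. \<Sum>j\<in>I. expectation (\<lambda>\<omega>. x i \<omega> * x j \<omega>))"
    unfolding eq by (simp add: mixi)
  also have "\<dots> = (\<Sum>i\<in>I. \<Sum>j\<in>I. if i = j then expectation (\<lambda>\<omega>. (x i \<omega>)\<^sup>2) else 0)"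
    by (intro sum.cong refl) (simp add: mix)
  also have "\<dots> = (\<Sum>i\<in>I. expectation (\<lambda>\<omega>. (x i \<omega>)\<^sup>2))"
    using I by (intro sum.cong refl) simp
  finally show "expectation (\<lambda>\<omega>. (\<Sum>i\<in>I. x i \<omega>)\<^sup>2) = (\<Sum>i\<in>I. expectation (\<lambda>\<omega>. (x i \<omega>)\<^sup>2))" .
qed

section \<open>Sums of independent units whose laws are mixtures over the strata\<close>

text \<open>Only the law within a stratum is common to all units; the label probabilities
  \<open>p i s\<close> may vary with \<open>i\<close>.\<close>

locale stratified_sample = prob_space M for M :: "'a measure" +
  fixes \<xi> :: nat and Y :: "nat \<Rightarrow> 'a \<Rightarrow> real^'d" and S :: "nat \<Rightarrow> 'a \<Rightarrow> nat"
    and \<nu> :: "nat \<Rightarrow> (real^'d) measure" and f :: "nat \<Rightarrow> real"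
  assumes Y_rv: "\<And>i. i \<ge> 1 \<Longrightarrow> Y i \<in> borel_measurable M"
    and S_rv: "\<And>i. i \<ge> 1 \<Longrightarrow> S i \<in> measurable M (count_space {1..\<xi>})"
    and indep: "indep_vars (\<lambda>_. borel \<Otimes>\<^sub>M count_space {1..\<xi>}) (\<lambda>i \<omega>. (Y i \<omega>, S i \<omega>)) {1..}"
    and prob_\<nu>: "\<And>s. s \<in> {1..\<xi>} \<Longrightarrow> prob_space (\<nu> s)"
    and sets_\<nu>: "\<And>s. s \<in> {1..\<xi>} \<Longrightarrow> sets (\<nu> s) = sets borel"
    and law: "\<And>i s. i \<ge> 1 \<Longrightarrow> s \<in> {1..\<xi>} \<Longrightarrow> \<P>(\<omega> in M. S i \<omega> = s) > 0 \<Longrightarrow>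
        distr (given_group M (S i) s) borel (Y i) = \<nu> s"
    and frac: "\<And>s. s \<in> {1..\<xi>} \<Longrightarrow>
        AE \<omega> in M. (\<lambda>n. real (group_count S s n \<omega>) / real n) \<longlonglongrightarrow> f s"
begin

abbreviation p :: "nat \<Rightarrow> nat \<Rightarrow> real" where
  "p i s \<equiv> \<P>(\<omega> in M. S i \<omega> = s)"

lemma S_in: "i \<ge> 1 \<Longrightarrow> \<omega> \<in> space M \<Longrightarrow> S i \<omega> \<in> {1..\<xi>}"
  using measurable_space[OF S_rv] by simp

lemma pred_S [measurable]: "i \<ge> 1 \<Longrightarrow> Measurable.pred M (\<lambda>\<omega>. S i \<omega> = s)"
  by (rule pred_label[OF S_rv])

lemma measurable_\<nu>: "s \<in> {1..\<xi>} \<Longrightarrow> h \<in> borel_measurable borel \<Longrightarrow> h \<in> borel_measurable (\<nu> s)"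
  using measurable_cong_sets[OF sets_\<nu> refl] by blast

lemma integral_stratum:
  fixes h :: "real^'d \<Rightarrow> 'b::{banach, second_countable_topology}"
  assumes "i \<ge> 1" "s \<in> {1..\<xi>}" "h \<in> borel_measurable borel" "integrable (\<nu> s) h"
  shows "integrable M (\<lambda>\<omega>. if S i \<omega> = s then h (Y i \<omega>) else 0)"
    and "(\<integral>\<omega>. (if S i \<omega> = s then h (Y i \<omega>) else 0) \<partial>M) = p i s *\<^sub>R integral\<^sup>L (\<nu> s) h"
proof -
  have ev: "{\<omega> \<in> space M. S i \<omega> = s} \<in> events"
    using pred_S[OF assms(1)] by (simp add: pred_def)
  note I = integral_on_group[OF Y_rv[OF assms(1)] ev assms(3) law[OF assms(1,2)] assms(4)]
  show "integrable M (\<lambda>\<omega>. if S i \<omega> = s then h (Y i \<omega>) else 0)" by (rule I(1))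
  show "(\<integral>\<omega>. (if S i \<omega> = s then h (Y i \<omega>) else 0) \<partial>M) = p i s *\<^sub>R integral\<^sup>L (\<nu> s) h" by (rule I(2))
qed

lemma split_strata:
  fixes h :: "nat \<Rightarrow> 'b::comm_monoid_add"
  assumes "i \<ge> 1" "\<omega> \<in> space M"
  shows "h (S i \<omega>) = (\<Sum>s=1..\<xi>. if S i \<omega> = s then h s else 0)"
  using S_in[OF assms] by simp

text \<open>The joint law of a unit is a mixture of the \<open>\<nu> s\<close> with weights
  \<open>p i s\<close>. Means, second moments and characteristic functions of scores are all
  obtained from this formula.\<close>

lemma integral_strata:
  fixes h :: "nat \<Rightarrow> real^'d \<Rightarrow> 'b::{banach, second_countable_topology}"
  assumes "i \<ge> 1" "\<And>s. s \<in> {1..\<xi>} \<Longrightarrow> h s \<in> borel_measurable borel"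
    and "\<And>s. s \<in> {1..\<xi>} \<Longrightarrow> integrable (\<nu> s) (h s)"
  shows "integrable M (\<lambda>\<omega>. h (S i \<omega>) (Y i \<omega>))"
    and "expectation (\<lambda>\<omega>. h (S i \<omega>) (Y i \<omega>)) = (\<Sum>s=1..\<xi>. p i s *\<^sub>R integral\<^sup>L (\<nu> s) (h s))"
proof -
  have eq: "h (S i \<omega>) (Y i \<omega>) = (\<Sum>s=1..\<xi>. if S i \<omega> = s then h s (Y i \<omega>) else 0)"
    if "\<omega> \<in> space M" for \<omega>
    by (rule split_strata[OF assms(1) that])
  have "integrable M (\<lambda>\<omega>. \<Sum>s=1..\<xi>. if S i \<omega> = s then h s (Y i \<omega>) else 0)"
    by (intro Bochner_Integration.integrable_sum integral_stratum assms)
  then show "integrable M (\<lambda>\<omega>. h (S i \<omega>) (Y i \<omega>))"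
    by (simp only: Bochner_Integration.integrable_cong[OF refl eq])
  have "expectation (\<lambda>\<omega>. h (S i \<omega>) (Y i \<omega>)) =
      expectation (\<lambda>\<omega>. \<Sum>s=1..\<xi>. if S i \<omega> = s then h s (Y i \<omega>) else 0)"
    by (rule Bochner_Integration.integral_cong[OF refl eq])
  also have "\<dots> = (\<Sum>s=1..\<xi>. expectation (\<lambda>\<omega>. if S i \<omega> = s then h s (Y i \<omega>) else 0))"
    by (intro Bochner_Integration.integral_sum integral_stratum assms)
  also have "\<dots> = (\<Sum>s=1..\<xi>. p i s *\<^sub>R integral\<^sup>L (\<nu> s) (h s))"
    by (intro sum.cong refl integral_stratum assms)
  finally show "expectation (\<lambda>\<omega>. h (S i \<omega>) (Y i \<omega>)) = (\<Sum>s=1..\<xi>. p i s *\<^sub>R integral\<^sup>L (\<nu> s) (h s))" .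
qed

lemma integral_one_\<nu>:
  assumes "s \<in> {1..\<xi>}"
  shows "integrable (\<nu> s) (\<lambda>y. 1 :: real)" and "(\<integral>y. 1 \<partial>\<nu> s) = (1 :: real)"
proof -
  interpret \<nu>s: prob_space "\<nu> s" by (rule prob_\<nu>[OF assms])
  show "integrable (\<nu> s) (\<lambda>y. 1 :: real)" by simp
  show "(\<integral>y. 1 \<partial>\<nu> s) = (1 :: real)" using \<nu>s.prob_space by simp
qed

lemma sum_p:
  assumes "i \<ge> 1"
  shows "(\<Sum>s=1..\<xi>. p i s) = 1"
proof -
  have one: "integrable (\<nu> s) (\<lambda>y. 1 :: real)" "(\<integral>y. 1 \<partial>\<nu> s) = (1 :: real)" if "s \<in> {1..\<xi>}" for s
    by (rule integral_one_\<nu>[OF that])+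
  have "expectation (\<lambda>\<omega>. 1 :: real) = (\<Sum>s=1..\<xi>. p i s *\<^sub>R (\<integral>y. 1 \<partial>\<nu> s))"
    by (rule integral_strata(2)[OF assms, where h="\<lambda>_ _. 1"]) (rule borel_measurable_const one | assumption)+
  also have "\<dots> = (\<Sum>s=1..\<xi>. p i s)"
    by (rule sum.cong[OF refl]) (simp only: one real_scaleR_def mult_1_right)
  finally show ?thesis by (simp add: prob_space)
qed

text \<open>The relative frequencies lie between 0 and 1, so their almost sure limit passes to
  expectations, although the individual \<open>p i s\<close> need not converge.\<close>

lemma mean_p_tendsto:
  assumes "s \<in> {1..\<xi>}"
  shows "(\<lambda>n. (\<Sum>i=1..n. p i s) / real n) \<longlonglongrightarrow> f s"
proof -
  have [measurable]: "group_count S s n \<in> measurable M (count_space UNIV)" for n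
    by (rule measurable_group_count[OF S_rv])
  have lim: "(\<lambda>n. expectation (\<lambda>\<omega>. real (group_count S s n \<omega>) / real n)) \<longlonglongrightarrow> expectation (\<lambda>\<omega>. f s)"
  proof (rule integral_dominated_convergence[where w="\<lambda>_. 1"])
    have "real (group_count S s n \<omega>) / real n \<le> 1" for n \<omega>
    proof -
      have "group_count S s n \<omega> \<le> (\<Sum>i=1..n. 1)"
        unfolding group_count_def by (intro sum_mono) auto
      then show ?thesis by (simp add: divide_le_eq)
    qed
    then show "AE \<omega> in M. norm (real (group_count S s n \<omega>) / real n) \<le> 1" for n by simp
  qed (use frac[OF assms] in auto)
  have eq: "expectation (\<lambda>\<omega>. real (group_count S s n \<omega>) / real n) = (\<Sum>i=1..n. p i s) / real n" for n
  proof -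
    have "expectation (\<lambda>\<omega>. of_bool (S i \<omega> = s)) = p i s \<and> integrable M (\<lambda>\<omega>. of_bool (S i \<omega> = s) :: real)"
      if "i \<ge> 1" for i
    proof -
      note one = integral_one_\<nu>[OF assms]
      note I = integral_stratum[OF that assms borel_measurable_const one(1)]
      show ?thesis
        using I one(2) by (simp only: of_bool_def real_scaleR_def mult_1_right)
    qed
    note b = this
    have "expectation (\<lambda>\<omega>. real (group_count S s n \<omega>) / real n) =
        expectation (\<lambda>\<omega>. \<Sum>i=1..n. of_bool (S i \<omega> = s)) / real n"
      unfolding real_group_count by (rule integral_divide_zero)
    also have "expectation (\<lambda>\<omega>. \<Sum>i=1..n. of_bool (S i \<omega> = s)) =
        (\<Sum>i=1..n. expectation (\<lambda>\<omega>. of_bool (S i \<omega> = s) :: real))"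
      using b by (intro Bochner_Integration.integral_sum) auto
    also have "\<dots> = (\<Sum>i=1..n. p i s)" using b by (intro sum.cong) auto
    finally show ?thesis .
  qed
  show ?thesis using lim unfolding eq by (simp add: prob_space)
qed

text \<open>\<open>g s\<close> is a real score for units of stratum \<open>s\<close>. One limit
  theory for such scores serves linear functionals of the centred observations over all strata as
  well as statistics that vanish outside one stratum.\<close>

context
  fixes g :: "nat \<Rightarrow> real^'d \<Rightarrow> real"
  assumes g_meas: "\<And>s. s \<in> {1..\<xi>} \<Longrightarrow> g s \<in> borel_measurable borel"
begin

lemma score_rv: "i \<ge> 1 \<Longrightarrow> (\<lambda>\<omega>. g (S i \<omega>) (Y i \<omega>)) \<in> borel_measurable M"
  by (rule measurable_compose_countable'[OF _ S_rv])
    (auto intro!: measurable_compose[OF Y_rv g_meas])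

lemma score_indep: "indep_vars (\<lambda>_. borel) (\<lambda>i \<omega>. g (S i \<omega>) (Y i \<omega>)) {1..}"
proof -
  have "(\<lambda>z. g (snd z) (fst z)) \<in> borel_measurable (borel \<Otimes>\<^sub>M count_space {1..\<xi>})"
    by (rule measurable_compose_countable'[OF _ measurable_snd])
      (auto intro!: measurable_compose[OF measurable_fst g_meas])
  from indep_vars_compose2[OF indep, of "\<lambda>_ z. g (snd z) (fst z)" "\<lambda>_. borel", OF this] show ?thesis by simp
qed

lemma score_char:
  assumes "i \<ge> 1"
  shows "char (distr M borel (\<lambda>\<omega>. g (S i \<omega>) (Y i \<omega>))) t
    = (\<Sum>s=1..\<xi>. p i s *\<^sub>R char (distr (\<nu> s) borel (g s)) t)"
proof -
  have m: "(\<lambda>y. iexp (t * g s y)) \<in> borel_measurable borel" if "s \<in> {1..\<xi>}" for s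
    using g_meas[OF that] by measurable
  have i: "integrable (\<nu> s) (\<lambda>y. iexp (t * g s y))" if "s \<in> {1..\<xi>}" for s
    by (rule finite_measure.integrable_const_bound[OF prob_space.finite_measure[OF prob_\<nu>[OF that]], of _ 1])
      (use measurable_\<nu>[OF that m[OF that]] in simp_all)
  have "char (distr M borel (\<lambda>\<omega>. g (S i \<omega>) (Y i \<omega>))) t = expectation (\<lambda>\<omega>. iexp (t * g (S i \<omega>) (Y i \<omega>)))"
    unfolding char_def by (rule integral_distr[OF score_rv[OF assms]]) simp
  also have "\<dots> = (\<Sum>s=1..\<xi>. p i s *\<^sub>R integral\<^sup>L (\<nu> s) (\<lambda>y. iexp (t * g s y)))"
    by (rule integral_strata(2)[OF assms m i])
  also have "\<dots> = (\<Sum>s=1..\<xi>. p i s *\<^sub>R char (distr (\<nu> s) borel (g s)) t)"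
    unfolding char_def
    by (intro sum.cong refl arg_cong2[where f=scaleR] integral_distr[symmetric])
      (simp_all add: measurable_\<nu> g_meas)
  finally show ?thesis .
qed

lemma score_sum_char:
  "char (distr M borel (\<lambda>\<omega>. c * (\<Sum>i=1..n. g (S i \<omega>) (Y i \<omega>)))) t =
    (\<Prod>i=1..n. char (distr M borel (\<lambda>\<omega>. g (S i \<omega>) (Y i \<omega>))) (c * t))"
proof -
  have rv: "(\<lambda>\<omega>. \<Sum>i=1..n. g (S i \<omega>) (Y i \<omega>)) \<in> borel_measurable M"
    by (intro borel_measurable_sum score_rv) auto
  have "char (distr M borel (\<lambda>\<omega>. c * (\<Sum>i=1..n. g (S i \<omega>) (Y i \<omega>)))) t =
      char (distr M borel (\<lambda>\<omega>. \<Sum>i=1..n. g (S i \<omega>) (Y i \<omega>))) (c * t)"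
    unfolding char_def using rv by (subst (1 2) integral_distr) (auto simp: mult_ac)
  also have "\<dots> = (\<Prod>i=1..n. char (distr M borel (\<lambda>\<omega>. g (S i \<omega>) (Y i \<omega>))) (c * t))"
    by (rule char_distr_sum, rule indep_vars_subset[OF score_indep]) auto
  finally show ?thesis .
qed

lemma score_dist: "s \<in> {1..\<xi>} \<Longrightarrow> real_distribution (distr (\<nu> s) borel (g s))"
  by (intro prob_space.real_distribution_distr prob_\<nu> measurable_\<nu> g_meas)

lemma score_cmod_char_le_1:
  "i \<ge> 1 \<Longrightarrow> cmod (char (distr M borel (\<lambda>\<omega>. g (S i \<omega>) (Y i \<omega>))) t) \<le> 1"
  by (intro real_distribution.cmod_char_le_1 real_distribution_distr score_rv)

text \<open>The weights are bounded by 1, so the total error does not depend on them; this is the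
  source of the uniformity in \<open>i\<close>.\<close>

lemma mixture_minus:
  assumes "i \<ge> 1" and "\<And>s. s \<in> {1..\<xi>} \<Longrightarrow> cmod (a s - b s) \<le> c s" and "\<And>s. s \<in> {1..\<xi>} \<Longrightarrow> 0 \<le> c s"
  shows "cmod ((\<Sum>s=1..\<xi>. p i s *\<^sub>R a s) - (\<Sum>s=1..\<xi>. p i s *\<^sub>R b s)) \<le> (\<Sum>s=1..\<xi>. c s)"
proof -
  have "(\<Sum>s=1..\<xi>. p i s *\<^sub>R a s) - (\<Sum>s=1..\<xi>. p i s *\<^sub>R b s) = (\<Sum>s=1..\<xi>. p i s *\<^sub>R (a s - b s))"
    by (simp add: scaleR_diff_right sum_subtractf)
  also have "cmod \<dots> \<le> (\<Sum>s=1..\<xi>. c s)"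
  proof (rule sum_norm_le)
    fix s assume s: "s \<in> {1..\<xi>}"
    have "cmod (p i s *\<^sub>R (a s - b s)) \<le> 1 * c s"
      unfolding norm_scaleR using assms s by (intro mult_mono) auto
    then show "cmod (p i s *\<^sub>R (a s - b s)) \<le> c s" by simp
  qed
  finally show ?thesis .
qed

text \<open>
  No reordering of the sample is needed: the summands are independent and each is a mixture, with
  weights \<open>P(S\<^sub>i = s)\<close>, of the same finitely many laws, so one second-order expansion of the
  characteristic functions of these laws is uniform in \<open>i\<close>.
\<close>
theorem score_clt:
  assumes sq: "\<And>s. s \<in> {1..\<xi>} \<Longrightarrow> integrable (\<nu> s) (\<lambda>y. (g s y)\<^sup>2)"
    and mean: "\<And>s. s \<in> {1..\<xi>} \<Longrightarrow> (\<integral>y. g s y \<partial>\<nu> s) = 0"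
  shows "(\<lambda>n. char (distr M borel (\<lambda>\<omega>. 1 / sqrt (real n) * (\<Sum>i=1..n. g (S i \<omega>) (Y i \<omega>)))) 1)
    \<longlonglongrightarrow> of_real (exp (- (\<Sum>s=1..\<xi>. f s * (\<integral>y. (g s y)\<^sup>2 \<partial>\<nu> s)) / 2))"
proof -
  define N where "N s = distr (\<nu> s) borel (g s)" for s
  define \<sigma> where "\<sigma> s = (\<integral>y. (g s y)\<^sup>2 \<partial>\<nu> s)" for s
  have \<sigma>0: "\<sigma> s \<ge> 0" for s unfolding \<sigma>_def by simp
  have "\<forall>s\<in>{1..\<xi>}. \<exists>\<delta>. (\<forall>t. cmod (char (N s) t - complex_of_real (1 - t\<^sup>2 * \<sigma> s / 2)) \<le> t\<^sup>2 * \<delta> t) \<and> (\<forall>t. \<delta> t \<ge> 0) \<and>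
      (\<forall>t. t \<longlonglongrightarrow> 0 \<longrightarrow> (\<lambda>n. \<delta> (t n)) \<longlonglongrightarrow> 0)"
    (is "\<forall>s\<in>_. \<exists>\<delta>. ?Q s \<delta>")
  proof
    fix s assume s: "s \<in> {1..\<xi>}"
    have m: "g s \<in> borel_measurable (\<nu> s)" by (rule measurable_\<nu>[OF s g_meas[OF s]])
    interpret N: real_distribution "N s" unfolding N_def by (rule score_dist[OF s])
    have "integrable (N s) (\<lambda>x. x\<^sup>2)" "N.expectation (\<lambda>x. x) = 0" "N.expectation (\<lambda>x. x\<^sup>2) = \<sigma> s"
      unfolding N_def \<sigma>_def using m sq[OF s] mean[OF s] by (simp_all add: integrable_distr_eq integral_distr)
    with N.char_second_order show "\<exists>\<delta>. ?Q s \<delta>"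
      by simp
  qed
  from bchoice[OF this] obtain \<delta> where "\<forall>s\<in>{1..\<xi>}. ?Q s (\<delta> s)" ..
  then have \<delta>: "\<And>s t. s \<in> {1..\<xi>} \<Longrightarrow> cmod (char (N s) t - complex_of_real (1 - t\<^sup>2 * \<sigma> s / 2)) \<le> t\<^sup>2 * \<delta> s t"
    and \<delta>0: "\<And>s t. s \<in> {1..\<xi>} \<Longrightarrow> \<delta> s t \<ge> 0"
    and \<delta>lim: "\<And>s t. s \<in> {1..\<xi>} \<Longrightarrow> t \<longlonglongrightarrow> 0 \<Longrightarrow> (\<lambda>n. \<delta> s (t n)) \<longlonglongrightarrow> 0"
    by blast+
  define \<phi> where "\<phi> i = char (distr M borel (\<lambda>\<omega>. g (S i \<omega>) (Y i \<omega>)))" for i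
  define v where "v i = (\<Sum>s=1..\<xi>. p i s * \<sigma> s)" for i
  define C where "C = (\<Sum>s=1..\<xi>. \<sigma> s)"
  have v: "0 \<le> v i" "v i \<le> C" for i
    unfolding v_def C_def using \<sigma>0 by (auto intro!: sum_nonneg sum_mono mult_left_le_one_le)
  define \<Delta> where "\<Delta> n = (\<Sum>s=1..\<xi>. \<delta> s (1 / sqrt (real n)))" for n
  have inv: "(\<lambda>n. 1 / sqrt (real n)) \<longlonglongrightarrow> 0" by real_asymp
  have \<Delta>: "\<Delta> \<longlonglongrightarrow> 0"
    unfolding \<Delta>_def by (rule tendsto_null_sum) (rule \<delta>lim[OF _ inv])
  have tri: "cmod (a - b) \<le> x + y" if "cmod (a - c) \<le> x" "cmod (b - c) \<le> y" for a b c x y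
    using norm_triangle_ineq4[of "a - c" "b - c"] that by simp
  \<comment> \<open>The comparison is with an exponential and not with 1 - v_i/(2n): exponentials
    multiply exactly, and they have modulus at most 1 for every \<open>n\<close>, as the telescoping
    estimate for products requires. The n errors add up to \<Delta> n + C^2/(4n).\<close>
  have one: "cmod (\<phi> i (1 / sqrt (real n)) - of_real (exp (- (v i / (2 * real n))))) \<le> \<Delta> n / n + (C / (2 * n))\<^sup>2"
    if i: "i \<ge> 1" and n: "n \<ge> 1" for i n
  proof -
    have sq: "(1 / sqrt (real n))\<^sup>2 = 1 / n" using n by (simp add: power_divide)
    have "cmod (\<phi> i (1 / sqrt (real n)) - (\<Sum>s=1..\<xi>. p i s *\<^sub>R of_real (1 - (1 / sqrt (real n))\<^sup>2 * \<sigma> s / 2)))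
        \<le> (\<Sum>s=1..\<xi>. (1 / sqrt (real n))\<^sup>2 * \<delta> s (1 / sqrt (real n)))"
      unfolding \<phi>_def score_char[OF i] N_def[symmetric]
      by (rule mixture_minus[OF i \<delta>]) (auto simp: \<delta>0)
    moreover have "(\<Sum>s=1..\<xi>. p i s *\<^sub>R complex_of_real (1 - (1 / sqrt (real n))\<^sup>2 * \<sigma> s / 2)) = of_real (1 - v i / (2 * n))"
    proof -
      have "(\<Sum>s=1..\<xi>. p i s *\<^sub>R complex_of_real (1 - (1 / sqrt (real n))\<^sup>2 * \<sigma> s / 2)) =
          of_real (\<Sum>s=1..\<xi>. p i s * (1 - (1 / sqrt (real n))\<^sup>2 * \<sigma> s / 2))"
        by (simp add: scaleR_conv_of_real)
      also have "(\<Sum>s=1..\<xi>. p i s * (1 - (1 / sqrt (real n))\<^sup>2 * \<sigma> s / 2)) =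
          (\<Sum>s=1..\<xi>. p i s) - (\<Sum>s=1..\<xi>. p i s * \<sigma> s) / (2 * n)"
        unfolding sq by (simp add: right_diff_distrib sum_subtractf sum_divide_distrib mult.commute[of 2])
      finally show ?thesis by (simp only: sum_p[OF i] v_def)
    qed
    moreover have "(\<Sum>s=1..\<xi>. (1 / sqrt (real n))\<^sup>2 * \<delta> s (1 / sqrt (real n))) = \<Delta> n / n"
      unfolding sq \<Delta>_def by (simp add: sum_divide_distrib)
    ultimately have 1: "cmod (\<phi> i (1 / sqrt (real n)) - of_real (1 - v i / (2 * n))) \<le> \<Delta> n / n" by simp
    have "\<bar>exp (- (v i / (2 * n))) - (1 - v i / (2 * n))\<bar> \<le> (v i / (2 * n))\<^sup>2"
      by (rule exp_minus_approx) (simp add: v)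
    also have "\<dots> \<le> (C / (2 * n))\<^sup>2" using v by (intro power_mono divide_right_mono) auto
    finally have "cmod (of_real (exp (- (v i / (2 * n)))) - of_real (1 - v i / (2 * n))) \<le> (C / (2 * n))\<^sup>2"
      unfolding of_real_diff[symmetric] norm_of_real .
    from tri[OF 1 this] show ?thesis by simp
  qed
  define L where "L n = (\<Prod>i=1..n. complex_of_real (exp (- (v i / (2 * real n)))))" for n
  \<comment> \<open>The exponent depends on the label probabilities only through their averages over
    i \<le> n, whose limits are \<open>f s\<close>.\<close>
  have Leq: "L n = of_real (exp (- (\<Sum>s=1..\<xi>. (\<Sum>i=1..n. p i s) / n * \<sigma> s) / 2))" for n
  proof -
    have "(\<Sum>i=1..n. - (v i / (2 * real n))) = - ((\<Sum>i=1..n. v i) / n) / 2"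
      by (simp add: sum_negf sum_divide_distrib mult.commute[of 2])
    also have "(\<Sum>i=1..n. v i) / n = (\<Sum>s=1..\<xi>. (\<Sum>i=1..n. p i s) / n * \<sigma> s)"
      unfolding v_def by (subst sum.swap) (simp add: sum_divide_distrib sum_distrib_right)
    finally have sum_eq: "(\<Sum>i=1..n. - (v i / (2 * real n))) = - (\<Sum>s=1..\<xi>. (\<Sum>i=1..n. p i s) / n * \<sigma> s) / 2"
      by simp
    have "L n = of_real (exp (\<Sum>i=1..n. - (v i / (2 * real n))))"
      unfolding L_def by (simp only: exp_sum[OF finite_atLeastAtMost] of_real_prod)
    then show ?thesis by (simp only: sum_eq)
  qed
  have L: "L \<longlonglongrightarrow> of_real (exp (- (\<Sum>s=1..\<xi>. f s * \<sigma> s) / 2))"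
    unfolding Leq by (intro tendsto_intros mean_p_tendsto) auto
  have "(\<lambda>n. (\<Prod>i=1..n. \<phi> i (1 / sqrt (real n))) - L n) \<longlonglongrightarrow> 0"
  proof (rule Lim_null_comparison)
    show "\<forall>\<^sub>F n in sequentially. norm ((\<Prod>i=1..n. \<phi> i (1 / sqrt (real n))) - L n) \<le> \<Delta> n + C\<^sup>2 / (4 * real n)"
      using eventually_ge_at_top[of 1]
    proof eventually_elim
      case (elim n)
      have "norm ((\<Prod>i=1..n. \<phi> i (1 / sqrt (real n))) - L n) \<le>
          (\<Sum>i=1..n. cmod (\<phi> i (1 / sqrt (real n)) - of_real (exp (- (v i / (2 * real n))))))"
        unfolding L_def by (rule norm_prod_diff) (auto simp: \<phi>_def score_cmod_char_le_1 v)
      also have "\<dots> \<le> (\<Sum>i=1..n. \<Delta> n / n + (C / (2 * n))\<^sup>2)"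
        by (intro sum_mono one) (use elim in auto)
      also have "\<dots> = \<Delta> n + C\<^sup>2 / (4 * real n)"
        using elim by (simp add: field_simps power2_eq_square)
      finally show ?case .
    qed
    have "(\<lambda>n. C\<^sup>2 / (4 * real n)) \<longlonglongrightarrow> 0" by real_asymp
    from tendsto_add[OF \<Delta> this] show "(\<lambda>n. \<Delta> n + C\<^sup>2 / (4 * real n)) \<longlonglongrightarrow> 0" by simp
  qed
  from tendsto_add[OF this L] show ?thesis
    unfolding score_sum_char by (simp add: \<phi>_def \<sigma>_def)
qed

text \<open>Each of the n factors of the characteristic function differs from 1 by at most (|t|/n)
  \<Delta> n with \<Delta> n -> 0, so the product differs from 1 by at most |t| \<Delta> n.\<close>

theorem score_wlln:
  assumes int: "\<And>s. s \<in> {1..\<xi>} \<Longrightarrow> integrable (\<nu> s) (g s)"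
    and mean: "\<And>s. s \<in> {1..\<xi>} \<Longrightarrow> (\<integral>y. g s y \<partial>\<nu> s) = 0"
  shows "converges_in_probability_to_0 M (\<lambda>n \<omega>. 1 / real n * (\<Sum>i=1..n. g (S i \<omega>) (Y i \<omega>)))"
proof (rule converges_in_probability_if_char)
  show "(\<lambda>\<omega>. 1 / real n * (\<Sum>i=1..n. g (S i \<omega>) (Y i \<omega>))) \<in> borel_measurable M" for n
    by (intro borel_measurable_times borel_measurable_const borel_measurable_sum score_rv) auto
  fix t :: real
  define N where "N s = distr (\<nu> s) borel (g s)" for s
  have "\<forall>s\<in>{1..\<xi>}. \<exists>\<delta>. (\<forall>t. cmod (char (N s) t - 1) \<le> \<bar>t\<bar> * \<delta> t) \<and> (\<forall>t. \<delta> t \<ge> 0) \<and>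
      (\<forall>t. t \<longlonglongrightarrow> 0 \<longrightarrow> (\<lambda>n. \<delta> (t n)) \<longlonglongrightarrow> 0)"
    (is "\<forall>s\<in>_. \<exists>\<delta>. ?Q s \<delta>")
  proof
    fix s assume s: "s \<in> {1..\<xi>}"
    have m: "g s \<in> borel_measurable (\<nu> s)" by (rule measurable_\<nu>[OF s g_meas[OF s]])
    interpret N: real_distribution "N s" unfolding N_def by (rule score_dist[OF s])
    have "integrable (N s) (\<lambda>x. x)" "N.expectation (\<lambda>x. x) = 0"
      unfolding N_def using m int[OF s] mean[OF s] by (simp_all add: integrable_distr_eq integral_distr)
    with N.char_first_order show "\<exists>\<delta>. ?Q s \<delta>"
      by simp
  qed
  from bchoice[OF this] obtain \<delta> where "\<forall>s\<in>{1..\<xi>}. ?Q s (\<delta> s)" ..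
  then have \<delta>: "\<And>s t. s \<in> {1..\<xi>} \<Longrightarrow> cmod (char (N s) t - 1) \<le> \<bar>t\<bar> * \<delta> s t"
    and \<delta>0: "\<And>s t. s \<in> {1..\<xi>} \<Longrightarrow> \<delta> s t \<ge> 0"
    and \<delta>lim: "\<And>s t. s \<in> {1..\<xi>} \<Longrightarrow> t \<longlonglongrightarrow> 0 \<Longrightarrow> (\<lambda>n. \<delta> s (t n)) \<longlonglongrightarrow> 0"
    by blast+
  define \<phi> where "\<phi> i = char (distr M borel (\<lambda>\<omega>. g (S i \<omega>) (Y i \<omega>)))" for i
  define \<Delta> where "\<Delta> n = (\<Sum>s=1..\<xi>. \<delta> s (1 / real n * t))" for n
  have inv: "(\<lambda>n. 1 / real n * t) \<longlonglongrightarrow> 0" by real_asymp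
  have \<Delta>: "\<Delta> \<longlonglongrightarrow> 0"
    unfolding \<Delta>_def by (rule tendsto_null_sum) (rule \<delta>lim[OF _ inv])
  have one: "cmod (\<phi> i (1 / real n * t) - 1) \<le> \<bar>1 / real n * t\<bar> * \<Delta> n" if i: "i \<ge> 1" for i n
  proof -
    have "cmod (\<phi> i (1 / real n * t) - (\<Sum>s=1..\<xi>. p i s *\<^sub>R 1)) \<le> (\<Sum>s=1..\<xi>. \<bar>1 / real n * t\<bar> * \<delta> s (1 / real n * t))"
      unfolding \<phi>_def score_char[OF i] N_def[symmetric]
      by (rule mixture_minus[OF i \<delta>]) (auto simp: \<delta>0)
    moreover have "(\<Sum>s=1..\<xi>. p i s *\<^sub>R 1) = complex_of_real (\<Sum>s=1..\<xi>. p i s)"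
      by (simp add: scaleR_conv_of_real)
    ultimately show ?thesis by (simp only: sum_p[OF i] of_real_1 \<Delta>_def sum_distrib_left)
  qed
  have "(\<lambda>n. (\<Prod>i=1..n. \<phi> i (1 / real n * t)) - 1) \<longlonglongrightarrow> 0"
  proof (rule Lim_null_comparison)
    show "\<forall>\<^sub>F n in sequentially. norm ((\<Prod>i=1..n. \<phi> i (1 / real n * t)) - 1) \<le> \<bar>t\<bar> * \<Delta> n"
      using eventually_ge_at_top[of 1]
    proof eventually_elim
      case (elim n)
      have "norm ((\<Prod>i=1..n. \<phi> i (1 / real n * t)) - (\<Prod>i=1..n. 1)) \<le> (\<Sum>i=1..n. cmod (\<phi> i (1 / real n * t) - 1))"
        by (rule norm_prod_diff) (auto simp: \<phi>_def score_cmod_char_le_1)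
      also have "\<dots> \<le> (\<Sum>i=1..n. \<bar>1 / real n * t\<bar> * \<Delta> n)"
        by (intro sum_mono one) auto
      also have "\<dots> = \<bar>t\<bar> * \<Delta> n" using elim by (simp add: abs_mult)
      finally show ?case by simp
    qed
    show "(\<lambda>n. \<bar>t\<bar> * \<Delta> n) \<longlonglongrightarrow> 0" by (rule tendsto_mult_right_zero[OF \<Delta>])
  qed
  from tendsto_add[OF this tendsto_const[of 1]]
  show "(\<lambda>n. char (distr M borel (\<lambda>\<omega>. 1 / real n * (\<Sum>i=1..n. g (S i \<omega>) (Y i \<omega>)))) t) \<longlonglongrightarrow> 1"
    unfolding score_sum_char by (simp add: \<phi>_def)
qed

text \<open>Independence removes the mixed terms, and bounding each weight \<open>p i s\<close> by 1
  gives a constant free of \<open>n\<close>, which is what tightness asks for.\<close>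

lemma score_second_moment:
  assumes sq: "\<And>s. s \<in> {1..\<xi>} \<Longrightarrow> integrable (\<nu> s) (\<lambda>y. (g s y)\<^sup>2)"
    and mean: "\<And>s. s \<in> {1..\<xi>} \<Longrightarrow> (\<integral>y. g s y \<partial>\<nu> s) = 0"
  shows "integrable M (\<lambda>\<omega>. (1 / sqrt (real n) * (\<Sum>i=1..n. g (S i \<omega>) (Y i \<omega>)))\<^sup>2)"
    and "expectation (\<lambda>\<omega>. (1 / sqrt (real n) * (\<Sum>i=1..n. g (S i \<omega>) (Y i \<omega>)))\<^sup>2)
      \<le> (\<Sum>s=1..\<xi>. \<integral>y. (g s y)\<^sup>2 \<partial>\<nu> s)"
proof -
  let ?C = "\<Sum>s=1..\<xi>. \<integral>y. (g s y)\<^sup>2 \<partial>\<nu> s"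
  let ?x = "\<lambda>i \<omega>. g (S i \<omega>) (Y i \<omega>)"
  have int: "integrable (\<nu> s) (g s)" if "s \<in> {1..\<xi>}" for s
  proof -
    interpret \<nu>s: prob_space "\<nu> s" by (rule prob_\<nu>[OF that])
    show ?thesis by (rule \<nu>s.square_integrable_imp_integrable[OF measurable_\<nu>[OF that g_meas[OF that]] sq[OF that]])
  qed
  have ind: "indep_vars (\<lambda>_. borel) ?x {1..n}" by (rule indep_vars_subset[OF score_indep]) auto
  have sqm: "(\<lambda>y. (g s y)\<^sup>2) \<in> borel_measurable borel" if "s \<in> {1..\<xi>}" for s
    using g_meas[OF that] by measurable
  have i2: "integrable M (\<lambda>\<omega>. (?x i \<omega>)\<^sup>2)" if "i \<in> {1..n}" for i
    using that by (intro integral_strata(1)[where h="\<lambda>s y. (g s y)\<^sup>2"] sqm sq) auto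
  have m0: "expectation (?x i) = 0" if "i \<in> {1..n}" for i
  proof -
    have "expectation (?x i) = (\<Sum>s=1..\<xi>. p i s *\<^sub>R (\<integral>y. g s y \<partial>\<nu> s))"
      using that by (intro integral_strata(2) g_meas int) auto
    also have "\<dots> = 0" by (intro sum.neutral ballI) (simp only: mean scaleR_zero_right)
    finally show ?thesis .
  qed
  have le: "expectation (\<lambda>\<omega>. (?x i \<omega>)\<^sup>2) \<le> ?C" if "i \<in> {1..n}" for i
  proof -
    have "expectation (\<lambda>\<omega>. (?x i \<omega>)\<^sup>2) = (\<Sum>s=1..\<xi>. p i s *\<^sub>R (\<integral>y. (g s y)\<^sup>2 \<partial>\<nu> s))"
      using that by (intro integral_strata(2)[where h="\<lambda>s y. (g s y)\<^sup>2"] sqm sq) auto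
    also have "\<dots> \<le> ?C"
      by (intro sum_mono) (auto intro!: mult_left_le_one_le)
    finally show ?thesis .
  qed
  note E = expectation_square_sum_indep[OF ind finite_atLeastAtMost i2 m0]
  have eq: "(1 / sqrt (real n) * (\<Sum>i=1..n. ?x i \<omega>))\<^sup>2 = 1 / real n * (\<Sum>i=1..n. ?x i \<omega>)\<^sup>2" for \<omega>
    by (simp add: power_mult_distrib power_divide)
  show "integrable M (\<lambda>\<omega>. (1 / sqrt (real n) * (\<Sum>i=1..n. ?x i \<omega>))\<^sup>2)"
    unfolding eq using E(1) by simp
  have "expectation (\<lambda>\<omega>. (1 / sqrt (real n) * (\<Sum>i=1..n. ?x i \<omega>))\<^sup>2) =
      1 / real n * (\<Sum>i=1..n. expectation (\<lambda>\<omega>. (?x i \<omega>)\<^sup>2))"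
    unfolding eq using E by simp
  also have "\<dots> \<le> 1 / real n * (\<Sum>i=1..n. ?C)"
    by (intro mult_left_mono sum_mono le) auto
  also have "\<dots> \<le> ?C"
    by (cases "n = 0") (auto intro!: sum_nonneg)
  finally show "expectation (\<lambda>\<omega>. (1 / sqrt (real n) * (\<Sum>i=1..n. ?x i \<omega>))\<^sup>2) \<le> ?C" .
qed

end

end

section \<open>The stratified estimator\<close>

lemma sum_centered_products:
  fixes x y :: "nat \<Rightarrow> real"
  assumes "N > 0"
  shows "(\<Sum>j=1..N. (x j - (\<Sum>j=1..N. x j) / N) * (y j - (\<Sum>j=1..N. y j) / N)) =
    (\<Sum>j=1..N. x j * y j) - (\<Sum>j=1..N. x j) * (\<Sum>j=1..N. y j) / N"
proof -
  define A B where "A = (\<Sum>j=1..N. x j)" and "B = (\<Sum>j=1..N. y j)"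
  have s1: "(\<Sum>j=1..N. x j * c) = A * c" and s2: "(\<Sum>j=1..N. c * y j) = c * B" for c
    unfolding A_def B_def by (simp_all add: sum_distrib_right sum_distrib_left)
  have "(\<Sum>j=1..N. (x j - A / N) * (y j - B / N)) =
      (\<Sum>j=1..N. x j * y j - x j * (B / N) - (A / N) * y j + (A / N) * (B / N))"
    by (intro sum.cong) (auto simp: algebra_simps)
  also have "\<dots> = (\<Sum>j=1..N. x j * y j) - A * (B / N) - (A / N) * B + N * ((A / N) * (B / N))"
    by (simp only: sum.distrib sum_subtractf s1 s2) simp
  also have "\<dots> = (\<Sum>j=1..N. x j * y j) - A * B / N" using assms by simp
  finally show ?thesis by (simp add: A_def B_def)
qed

text \<open>\<open>q s\<close> stands for P(S = s) and \<open>\<nu> s\<close> for the law of Y given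
  S = s; the centring by E(Y) appears here as the sum of the \<open>q s\<close> times the stratum
  means.\<close>

locale stratified_estimator = stratified_sample M \<xi> Y S \<nu> f
  for M :: "'a measure" and \<xi> and Y :: "nat \<Rightarrow> 'a \<Rightarrow> real^'d" and S \<nu> f +
  fixes q :: "nat \<Rightarrow> real" and lam :: "nat \<Rightarrow> nat \<Rightarrow> 'a \<Rightarrow> real"
  assumes sq_\<nu>: "\<And>s. s \<in> {1..\<xi>} \<Longrightarrow> integrable (\<nu> s) (\<lambda>y. (norm y)\<^sup>2)"
    and f_pos: "\<And>s. s \<in> {1..\<xi>} \<Longrightarrow> f s > 0"
    and lam_rv: "\<And>n s. s \<in> {1..\<xi>} \<Longrightarrow> lam n s \<in> borel_measurable M"
    and lam_conv: "\<And>s. s \<in> {1..\<xi>} \<Longrightarrow>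
        converges_in_probability_to_0 M (\<lambda>n \<omega>. sqrt (real n) * (lam n s \<omega> - q s))"
begin

definition \<mu> :: "nat \<Rightarrow> real^'d" where
  "\<mu> s = (\<integral>y. y \<partial>\<nu> s)"

definition cov :: "nat \<Rightarrow> real^'d^'d" where
  "cov s = (\<chi> i j. \<integral>y. (y $ i - \<mu> s $ i) * (y $ j - \<mu> s $ j) \<partial>\<nu> s)"

definition V :: "real^'d^'d" where
  "V = (\<Sum>s=1..\<xi>. ((q s)\<^sup>2 / f s) *\<^sub>R cov s)"

definition T :: "nat \<Rightarrow> nat \<Rightarrow> 'a \<Rightarrow> real^'d" where
  "T s n \<omega> = (\<Sum>i=1..n. if S i \<omega> = s then Y i \<omega> - \<mu> s else 0)"

text \<open>The weights are kept general: \<open>q s / f s\<close> gives the linearised estimator,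
  and the indicator of one stratum gives the normalised \<open>T s n\<close>.\<close>

definition Z :: "(nat \<Rightarrow> real) \<Rightarrow> nat \<Rightarrow> 'a \<Rightarrow> real^'d" where
  "Z w n \<omega> = (1 / sqrt (real n)) *\<^sub>R (\<Sum>s=1..\<xi>. w s *\<^sub>R T s n \<omega>)"

lemma measurable_component_\<nu> [measurable]:
  "s \<in> {1..\<xi>} \<Longrightarrow> (\<lambda>y. y $ i) \<in> borel_measurable (\<nu> s)"
  by (rule measurable_\<nu>) measurable

lemma measurable_ident_\<nu>: "s \<in> {1..\<xi>} \<Longrightarrow> (\<lambda>y. y) \<in> borel_measurable (\<nu> s)"
  by (rule measurable_\<nu>) simp_all

lemma integrable_ident_\<nu>:
  assumes s: "s \<in> {1..\<xi>}"
  shows "integrable (\<nu> s) (\<lambda>y. y)"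
proof -
  interpret \<nu>s: prob_space "\<nu> s" by (rule prob_\<nu>[OF s])
  note m = measurable_ident_\<nu>[OF s]
  have "integrable (\<nu> s) (\<lambda>y. norm y)"
    by (rule \<nu>s.square_integrable_imp_integrable[OF _ sq_\<nu>[OF s]]) (use m in measurable)
  then show ?thesis by (rule integrable_norm_cancel) (rule m)
qed

lemma integrable_centered_sq:
  assumes s: "s \<in> {1..\<xi>}"
  shows "integrable (\<nu> s) (\<lambda>y. (norm (y - \<mu> s))\<^sup>2)"
proof -
  interpret \<nu>s: prob_space "\<nu> s" by (rule prob_\<nu>[OF s])
  note m = measurable_ident_\<nu>[OF s]
  have "integrable (\<nu> s) (\<lambda>y. (norm y)\<^sup>2 - 2 * (y \<bullet> \<mu> s) + (norm (\<mu> s))\<^sup>2)"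
    using integrable_ident_\<nu>[OF s] sq_\<nu>[OF s] by simp
  moreover have "(norm (y - \<mu> s))\<^sup>2 = (norm y)\<^sup>2 - 2 * (y \<bullet> \<mu> s) + (norm (\<mu> s))\<^sup>2" for y
    by (simp add: power2_norm_eq_inner inner_diff_left inner_diff_right inner_commute)
  ultimately show ?thesis by simp
qed

lemma integrable_centered_prod:
  assumes s: "s \<in> {1..\<xi>}"
  shows "integrable (\<nu> s) (\<lambda>y. (y $ i - \<mu> s $ i) * (y $ j - \<mu> s $ j))"
proof (rule Bochner_Integration.integrable_bound[OF integrable_centered_sq[OF s]])
  show "(\<lambda>y. (y $ i - \<mu> s $ i) * (y $ j - \<mu> s $ j)) \<in> borel_measurable (\<nu> s)"
    using measurable_component_\<nu>[OF s] by measurable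
  show "AE y in \<nu> s. norm ((y $ i - \<mu> s $ i) * (y $ j - \<mu> s $ j)) \<le> norm ((norm (y - \<mu> s))\<^sup>2)"
  proof (rule AE_I2)
    fix y
    have "\<bar>(y - \<mu> s) $ i\<bar> * \<bar>(y - \<mu> s) $ j\<bar> \<le> norm (y - \<mu> s) * norm (y - \<mu> s)"
      by (intro mult_mono component_le_norm_cart) auto
    then show "norm ((y $ i - \<mu> s $ i) * (y $ j - \<mu> s $ j)) \<le> norm ((norm (y - \<mu> s))\<^sup>2)"
      by (simp add: abs_mult power2_eq_square)
  qed
qed

lemma centered_linear:
  assumes s: "s \<in> {1..\<xi>}"
  shows "integrable (\<nu> s) (\<lambda>y. t \<bullet> (y - \<mu> s))" and "(\<integral>y. t \<bullet> (y - \<mu> s) \<partial>\<nu> s) = 0"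
proof -
  interpret \<nu>s: prob_space "\<nu> s" by (rule prob_\<nu>[OF s])
  show "integrable (\<nu> s) (\<lambda>y. t \<bullet> (y - \<mu> s))" using integrable_ident_\<nu>[OF s] by simp
  show "(\<integral>y. t \<bullet> (y - \<mu> s) \<partial>\<nu> s) = 0"
    using integrable_ident_\<nu>[OF s] \<nu>s.prob_space by (simp add: \<mu>_def inner_diff_right)
qed

lemma centered_linear_sq:
  assumes s: "s \<in> {1..\<xi>}"
  shows "integrable (\<nu> s) (\<lambda>y. (t \<bullet> (y - \<mu> s))\<^sup>2)"
    and "(\<integral>y. (t \<bullet> (y - \<mu> s))\<^sup>2 \<partial>\<nu> s) = t \<bullet> (cov s *v t)"
proof -
  have eq: "(t \<bullet> (y - \<mu> s))\<^sup>2 =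
      (\<Sum>i\<in>UNIV. \<Sum>j\<in>UNIV. (t $ i * t $ j) * ((y $ i - \<mu> s $ i) * (y $ j - \<mu> s $ j)))" for y
    by (simp add: power2_eq_square inner_vec_def sum_product mult_ac)
  note I = integrable_mult_right[OF integrable_centered_prod[OF s]]
  show "integrable (\<nu> s) (\<lambda>y. (t \<bullet> (y - \<mu> s))\<^sup>2)"
    unfolding eq by (intro Bochner_Integration.integrable_sum I)
  have "(\<integral>y. (t \<bullet> (y - \<mu> s))\<^sup>2 \<partial>\<nu> s) = (\<Sum>i\<in>UNIV. \<Sum>j\<in>UNIV. (t $ i * t $ j) * cov s $ i $ j)"
    unfolding eq by (simp add: Bochner_Integration.integral_sum Bochner_Integration.integrable_sum I
        integrable_centered_prod[OF s] cov_def)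
  also have "\<dots> = t \<bullet> (cov s *v t)"
    by (simp add: inner_vec_def matrix_vector_mult_def sum_distrib_left mult_ac)
  finally show "(\<integral>y. (t \<bullet> (y - \<mu> s))\<^sup>2 \<partial>\<nu> s) = t \<bullet> (cov s *v t)" .
qed

lemma cov_sym: "cov s $ i $ j = cov s $ j $ i"
  by (simp add: cov_def mult.commute)

lemma cov_psd: "s \<in> {1..\<xi>} \<Longrightarrow> 0 \<le> t \<bullet> (cov s *v t)"
  unfolding centered_linear_sq(2)[symmetric] by simp

lemma V_sym: "V $ i $ j = V $ j $ i"
  by (simp add: V_def cov_sym[of _ i j])

lemma V_quadratic: "t \<bullet> (V *v t) = (\<Sum>s=1..\<xi>. (q s)\<^sup>2 / f s * (t \<bullet> (cov s *v t)))"
proof -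
  have "V *v t = (\<Sum>s=1..\<xi>. ((q s)\<^sup>2 / f s) *\<^sub>R (cov s *v t))"
    unfolding V_def
    by (induction rule: infinite_finite_induct[of _ "{1..\<xi>}"])
      (simp_all add: matrix_vector_mult_add_rdistrib scaleR_matrix_vector_assoc[symmetric])
  then show ?thesis by (simp add: inner_sum_right)
qed

lemma V_psd: "0 \<le> t \<bullet> (V *v t)"
  unfolding V_quadratic using f_pos
  by (intro sum_nonneg mult_nonneg_nonneg cov_psd divide_nonneg_pos) auto

lemma measurable_T [measurable]: "T s n \<in> borel_measurable M"
  unfolding T_def[abs_def]
  by (intro borel_measurable_sum measurable_If borel_measurable_diff borel_measurable_const Y_rv)
    (use pred_S in \<open>auto simp: pred_def\<close>)

lemma measurable_Z [measurable]: "Z w n \<in> borel_measurable M"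
  unfolding Z_def[abs_def] by measurable

lemma sum_T:
  assumes "\<omega> \<in> space M"
  shows "(\<Sum>s=1..\<xi>. w s *\<^sub>R T s n \<omega>) = (\<Sum>i=1..n. w (S i \<omega>) *\<^sub>R (Y i \<omega> - \<mu> (S i \<omega>)))"
proof -
  have "(\<Sum>s=1..\<xi>. w s *\<^sub>R T s n \<omega>) = (\<Sum>i=1..n. \<Sum>s=1..\<xi>. if S i \<omega> = s then w s *\<^sub>R (Y i \<omega> - \<mu> s) else 0)"
    unfolding T_def scaleR_sum_right
    by (subst sum.swap) (intro sum.cong refl, simp)
  also have "\<dots> = (\<Sum>i=1..n. w (S i \<omega>) *\<^sub>R (Y i \<omega> - \<mu> (S i \<omega>)))"
    by (intro sum.cong refl split_strata[symmetric]) (use assms in auto)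
  finally show ?thesis .
qed

text \<open>Interchanging the sums over strata and units presents every linear functional of
  \<open>Z\<close> as a normalised sum of independent scores, so the one-dimensional results apply
  to each direction \<open>t\<close>.\<close>

lemma Z_inner:
  assumes "\<omega> \<in> space M"
  shows "t \<bullet> Z w n \<omega> = 1 / sqrt (real n) * (\<Sum>i=1..n. w (S i \<omega>) * (t \<bullet> (Y i \<omega> - \<mu> (S i \<omega>))))"
  unfolding Z_def sum_T[OF assms] by (simp add: inner_sum_right)

lemma score_props:
  assumes s: "s \<in> {1..\<xi>}"
  shows "(\<lambda>y. w s * (t \<bullet> (y - \<mu> s))) \<in> borel_measurable borel"
    and "integrable (\<nu> s) (\<lambda>y. (w s * (t \<bullet> (y - \<mu> s)))\<^sup>2)"
    and "(\<integral>y. w s * (t \<bullet> (y - \<mu> s)) \<partial>\<nu> s) = 0"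
    and "(\<integral>y. (w s * (t \<bullet> (y - \<mu> s)))\<^sup>2 \<partial>\<nu> s) = (w s)\<^sup>2 * (t \<bullet> (cov s *v t))"
proof -
  show "(\<lambda>y. w s * (t \<bullet> (y - \<mu> s))) \<in> borel_measurable borel" by measurable
  show "integrable (\<nu> s) (\<lambda>y. (w s * (t \<bullet> (y - \<mu> s)))\<^sup>2)"
    unfolding power_mult_distrib by (intro integrable_mult_right centered_linear_sq s)
  show "(\<integral>y. w s * (t \<bullet> (y - \<mu> s)) \<partial>\<nu> s) = 0"
    by (simp only: integral_mult_right_zero centered_linear(2)[OF s] mult_zero_right)
  show "(\<integral>y. (w s * (t \<bullet> (y - \<mu> s)))\<^sup>2 \<partial>\<nu> s) = (w s)\<^sup>2 * (t \<bullet> (cov s *v t))"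
    by (simp only: power_mult_distrib integral_mult_right_zero centered_linear_sq(2)[OF s])
qed

lemma Z_char:
  "(\<lambda>n. expectation (\<lambda>\<omega>. cis (t \<bullet> Z w n \<omega>))) \<longlonglongrightarrow>
    of_real (exp (- (\<Sum>s=1..\<xi>. f s * ((w s)\<^sup>2 * (t \<bullet> (cov s *v t)))) / 2))"
proof -
  let ?g = "\<lambda>s y. w s * (t \<bullet> (y - \<mu> s))"
  have eq: "expectation (\<lambda>\<omega>. cis (t \<bullet> Z w n \<omega>)) =
      char (distr M borel (\<lambda>\<omega>. 1 / sqrt (real n) * (\<Sum>i=1..n. ?g (S i \<omega>) (Y i \<omega>)))) 1" for n
  proof -
    have "(\<lambda>\<omega>. 1 / sqrt (real n) * (\<Sum>i=1..n. ?g (S i \<omega>) (Y i \<omega>))) \<in> borel_measurable M"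
      by (intro borel_measurable_times borel_measurable_const borel_measurable_sum
          score_rv[where g="?g"] score_props) auto
    then have "char (distr M borel (\<lambda>\<omega>. 1 / sqrt (real n) * (\<Sum>i=1..n. ?g (S i \<omega>) (Y i \<omega>)))) 1 =
        expectation (\<lambda>\<omega>. iexp (1 * (1 / sqrt (real n) * (\<Sum>i=1..n. ?g (S i \<omega>) (Y i \<omega>)))))"
      unfolding char_def by (rule integral_distr) simp
    also have "\<dots> = expectation (\<lambda>\<omega>. cis (t \<bullet> Z w n \<omega>))"
      by (rule Bochner_Integration.integral_cong[OF refl]) (simp only: Z_inner cis_conv_exp mult_1_left)
    finally show ?thesis by simp
  qed
  have "(\<Sum>s=1..\<xi>. f s * (\<integral>y. (?g s y)\<^sup>2 \<partial>\<nu> s)) = (\<Sum>s=1..\<xi>. f s * ((w s)\<^sup>2 * (t \<bullet> (cov s *v t))))"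
    by (rule sum.cong[OF refl]) (simp only: score_props)
  with score_clt[where g="?g", OF score_props(1,2,3)[where w=w and t=t]] show ?thesis
    unfolding eq by (simp only:)
qed

lemma Z_tight: "tight_sequence M (Z w)"
proof (rule tight_sequence_second_moment)
  let ?g = "\<lambda>a s y. w s * (axis a 1 \<bullet> (y - \<mu> s))"
  let ?C = "\<Sum>a\<in>UNIV. \<Sum>s=1..\<xi>. \<integral>y. (?g a s y)\<^sup>2 \<partial>\<nu> s"
  have comp: "integrable M (\<lambda>\<omega>. (Z w n \<omega> $ a)\<^sup>2) \<and>
      expectation (\<lambda>\<omega>. (Z w n \<omega> $ a)\<^sup>2) \<le> (\<Sum>s=1..\<xi>. \<integral>y. (?g a s y)\<^sup>2 \<partial>\<nu> s)" for n a
  proof -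
    have eq: "(Z w n \<omega> $ a)\<^sup>2 = (1 / sqrt (real n) * (\<Sum>i=1..n. ?g a (S i \<omega>) (Y i \<omega>)))\<^sup>2"
      if "\<omega> \<in> space M" for \<omega>
    proof -
      have "Z w n \<omega> $ a = axis a 1 \<bullet> Z w n \<omega>" by (simp add: inner_axis')
      then show ?thesis by (simp only: Z_inner[OF that])
    qed
    note E = score_second_moment[where g="?g a" and n=n, OF score_props(1,2,3)[where w=w and t="axis a 1"]]
    show ?thesis
      using E by (simp only: Bochner_Integration.integrable_cong[OF refl eq] Bochner_Integration.integral_cong[OF refl eq])
  qed
  have norm: "(norm (Z w n \<omega>))\<^sup>2 = (\<Sum>a\<in>UNIV. (Z w n \<omega> $ a)\<^sup>2)" for n \<omega>
    unfolding power2_norm_eq_inner inner_vec_def by (simp add: power2_eq_square)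
  show "Z w n \<in> borel_measurable M" for n by measurable
  show "integrable M (\<lambda>\<omega>. (norm (Z w n \<omega>))\<^sup>2)" for n
    unfolding norm using comp by (intro Bochner_Integration.integrable_sum) simp
  show "expectation (\<lambda>\<omega>. (norm (Z w n \<omega>))\<^sup>2) \<le> ?C" for n
  proof -
    have "expectation (\<lambda>\<omega>. (norm (Z w n \<omega>))\<^sup>2) = (\<Sum>a\<in>UNIV. expectation (\<lambda>\<omega>. (Z w n \<omega> $ a)\<^sup>2))"
      unfolding norm using comp by (intro Bochner_Integration.integral_sum) simp
    also have "\<dots> \<le> ?C" using comp by (intro sum_mono) simp
    finally show ?thesis .
  qed
qed

lemma T_tight:
  assumes s: "s \<in> {1..\<xi>}"
  shows "tight_sequence M (\<lambda>n \<omega>. T s n \<omega> $ b / sqrt (real n))"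
proof -
  \<comment> \<open>With this weight \<open>Z\<close> reduces to \<open>T s n\<close> divided by
    sqrt n, and its tightness is inherited.\<close>
  let ?w = "\<lambda>s'. if s' = s then 1 else 0 :: real"
  have "(\<Sum>s'=1..\<xi>. ?w s' *\<^sub>R T s' n \<omega>) = T s n \<omega>" for n \<omega>
  proof -
    have "(\<Sum>s'=1..\<xi>. ?w s' *\<^sub>R T s' n \<omega>) = (\<Sum>s'=1..\<xi>. if s' = s then T s' n \<omega> else 0)"
      by (intro sum.cong) auto
    then show ?thesis using s by simp
  qed
  then have eq: "Z ?w n \<omega> = (1 / sqrt (real n)) *\<^sub>R T s n \<omega>" for n \<omega> by (simp only: Z_def)
  have le: "norm (T s n \<omega> $ b / sqrt (real n)) \<le> norm (Z ?w n \<omega>)" for n \<omega>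
    using component_le_norm_cart[of "Z ?w n \<omega>" b] unfolding eq by simp
  show ?thesis unfolding tight_sequence_def
  proof (intro allI impI)
    fix e :: real assume "e > 0"
    then obtain R where "\<forall>\<^sub>F n in sequentially. \<P>(\<omega> in M. norm (Z ?w n \<omega>) > R) \<le> e"
      using Z_tight[of ?w] unfolding tight_sequence_def by blast
    then have "\<forall>\<^sub>F n in sequentially. \<P>(\<omega> in M. norm (T s n \<omega> $ b / sqrt (real n)) > R) \<le> e"
    proof eventually_elim
      case (elim n)
      have "{\<omega> \<in> space M. norm (T s n \<omega> $ b / sqrt (real n)) > R} \<subseteq> {\<omega> \<in> space M. norm (Z ?w n \<omega>) > R}"
        using le[of n] by (auto intro: less_le_trans)
      then have "\<P>(\<omega> in M. norm (T s n \<omega> $ b / sqrt (real n)) > R) \<le> \<P>(\<omega> in M. norm (Z ?w n \<omega>) > R)"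
        by (intro finite_measure_mono) measurable
      with elim show ?case by linarith
    qed
    then show "\<exists>R. \<forall>\<^sub>F n in sequentially. \<P>(\<omega> in M. norm (T s n \<omega> $ b / sqrt (real n)) > R) \<le> e" by blast
  qed
qed

section \<open>Consistency of the group covariances and of the weights\<close>

lemma stratum_wlln:
  assumes s: "s \<in> {1..\<xi>}" and h: "h \<in> borel_measurable borel" "integrable (\<nu> s) h" "integral\<^sup>L (\<nu> s) h = 0"
  shows "converges_in_probability_to_0 M (\<lambda>n \<omega>. (\<Sum>i=1..n. if S i \<omega> = s then h (Y i \<omega>) else 0) / real n)"
proof -
  let ?g = "\<lambda>s' y. if s' = s then h y else 0"
  have "converges_in_probability_to_0 M (\<lambda>n \<omega>. 1 / real n * (\<Sum>i=1..n. ?g (S i \<omega>) (Y i \<omega>)))"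
  proof (rule score_wlln[where g="?g"])
    fix s'
    show "?g s' \<in> borel_measurable borel" by (cases "s' = s") (use h in simp_all)
    show "integrable (\<nu> s') (?g s')" by (cases "s' = s") (use h in simp_all)
    show "(\<integral>y. ?g s' y \<partial>\<nu> s') = 0" by (cases "s' = s") (use h in simp_all)
  qed
  then show ?thesis by simp
qed

lemma T_wlln:
  assumes s: "s \<in> {1..\<xi>}"
  shows "converges_in_probability_to_0 M (\<lambda>n \<omega>. T s n \<omega> $ b / real n)"
proof -
  have eq: "T s n \<omega> $ b = (\<Sum>i=1..n. if S i \<omega> = s then axis b 1 \<bullet> (Y i \<omega> - \<mu> s) else 0)" for n \<omega>
    unfolding T_def sum_component by (intro sum.cong) (auto simp: inner_axis')
  show ?thesis unfolding eq
    by (rule stratum_wlln[OF s _ centered_linear[OF s]]) measurable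
qed

text \<open>The covariance is subtracted under the indicator, so that each summand is centred
  whatever the random number of units in the stratum.\<close>

definition U :: "nat \<Rightarrow> 'd \<Rightarrow> 'd \<Rightarrow> nat \<Rightarrow> 'a \<Rightarrow> real" where
  "U s a b n \<omega> = (\<Sum>i=1..n. if S i \<omega> = s then
    (Y i \<omega> $ a - \<mu> s $ a) * (Y i \<omega> $ b - \<mu> s $ b) - cov s $ a $ b else 0)"

lemma U_wlln:
  assumes s: "s \<in> {1..\<xi>}"
  shows "converges_in_probability_to_0 M (\<lambda>n \<omega>. U s a b n \<omega> / real n)"
  unfolding U_def
proof (rule stratum_wlln[OF s, of "\<lambda>y. (y $ a - \<mu> s $ a) * (y $ b - \<mu> s $ b) - cov s $ a $ b"])
  interpret \<nu>s: prob_space "\<nu> s" by (rule prob_\<nu>[OF s])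
  show "(\<lambda>y. (y $ a - \<mu> s $ a) * (y $ b - \<mu> s $ b) - cov s $ a $ b) \<in> borel_measurable borel" by measurable
  show "integrable (\<nu> s) (\<lambda>y. (y $ a - \<mu> s $ a) * (y $ b - \<mu> s $ b) - cov s $ a $ b)"
    using integrable_centered_prod[OF s] by simp
  show "(\<integral>y. (y $ a - \<mu> s $ a) * (y $ b - \<mu> s $ b) - cov s $ a $ b \<partial>\<nu> s) = 0"
    using integrable_centered_prod[OF s] \<nu>s.prob_space by (simp add: cov_def)
qed

lemma measurable_U [measurable]: "U s a b n \<in> borel_measurable M"
  unfolding U_def[abs_def]
  by (intro borel_measurable_sum measurable_If borel_measurable_diff borel_measurable_const Y_rv
      borel_measurable_times borel_measurable_component)
    (use pred_S in \<open>auto simp: pred_def\<close>)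

lemma AE_counts:
  "AE \<omega> in M. \<forall>s\<in>{1..\<xi>}. (\<lambda>n. real (group_count S s n \<omega>) / real n) \<longlonglongrightarrow> f s"
  using frac by (simp add: AE_finite_all)

text \<open>A frequency with positive limit forces linear growth of the count, so outcomes with
  convergent frequencies lie in the regular branch of \<open>sample_index\<close>.\<close>

lemma count_at_top:
  assumes "(\<lambda>n. real (group_count S s n \<omega>) / real n) \<longlonglongrightarrow> f s" and "s \<in> {1..\<xi>}"
  shows "filterlim (\<lambda>n. group_count S s n \<omega>) at_top sequentially"
proof -
  have "filterlim (\<lambda>n. real (group_count S s n \<omega>) / real n * real n) at_top sequentially"
    by (rule filterlim_tendsto_pos_mult_at_top[OF assms(1) f_pos[OF assms(2)] filterlim_real_sequentially])
  moreover have "\<forall>\<^sub>F n in sequentially. real (group_count S s n \<omega>) / real n * real n = real (group_count S s n \<omega>)"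
    using eventually_gt_at_top[of 0] by eventually_elim simp
  ultimately have "filterlim (\<lambda>n. real (group_count S s n \<omega>)) at_top sequentially"
    by (simp add: filterlim_cong[OF refl refl])
  then show ?thesis by (simp add: filterlim_sequentially_iff_filterlim_real)
qed

lemma sum_const_stratum: "(\<Sum>i=1..n. if S i \<omega> = s then c else 0) = real (group_count S s n \<omega>) *\<^sub>R c"
  for c :: "'v::real_vector"
proof -
  have "(\<Sum>i=1..n. if S i \<omega> = s then c else 0) = (\<Sum>i=1..n. of_bool (S i \<omega> = s) *\<^sub>R c)"
    by (intro sum.cong) auto
  then show ?thesis by (simp only: real_group_count scaleR_sum_left)
qed

lemma group_mean_eq:
  assumes "filterlim (\<lambda>n. group_count S s n \<omega>) at_top sequentially" and "group_count S s n \<omega> > 0"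
  shows "group_mean Y S s (group_count S s n \<omega>) \<omega> = \<mu> s + (1 / real (group_count S s n \<omega>)) *\<^sub>R T s n \<omega>"
proof -
  let ?N = "group_count S s n \<omega>"
  have "T s n \<omega> = (\<Sum>i=1..n. (if S i \<omega> = s then Y i \<omega> else 0) - (if S i \<omega> = s then \<mu> s else 0))"
    unfolding T_def by (intro sum.cong) auto
  also have "\<dots> = (\<Sum>i=1..n. if S i \<omega> = s then Y i \<omega> else 0) - real ?N *\<^sub>R \<mu> s"
    by (simp only: sum_subtractf sum_const_stratum)
  also have "(\<Sum>i=1..n. if S i \<omega> = s then Y i \<omega> else 0) = (\<Sum>j=1..?N. group_sample Y S s j \<omega>)"
    by (rule sum_group_sample[OF assms(1), where h="\<lambda>y. y", symmetric])
  finally show ?thesis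
    using assms(2) by (simp add: group_mean_def scaleR_diff_right)
qed

text \<open>Everything is expressed through quotients by \<open>n\<close> that have limits: U/n and
  T/n tend to 0 in probability, N/n to \<open>f s\<close>, and 1/n to 0. The T-term is the price of
  centring at the sample mean in place of the true one. For N = 1 both sides are 0, since division
  by 0 gives 0.\<close>

lemma group_covariance_eq:
  assumes lim: "filterlim (\<lambda>n. group_count S s n \<omega>) at_top sequentially" and N: "group_count S s n \<omega> > 0"
  defines "N \<equiv> real (group_count S s n \<omega>)"
  shows "group_covariance Y S s n \<omega> $ a $ b =
    (U s a b n \<omega> / n + (N / n) * cov s $ a $ b - (T s n \<omega> $ a / n) * (T s n \<omega> $ b / n) / (N / n)) / (N / n - 1 / n)"
proof -
  let ?N = "group_count S s n \<omega>"
  have n: "n > 0" using N by (cases n) auto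
  let ?x = "\<lambda>c j. group_sample Y S s j \<omega> $ c - \<mu> s $ c"
  have T: "(\<Sum>j=1..?N. ?x c j) = T s n \<omega> $ c" for c
  proof -
    have "(\<Sum>j=1..?N. ?x c j) = (\<Sum>i=1..n. if S i \<omega> = s then Y i \<omega> $ c - \<mu> s $ c else 0)"
      by (rule sum_group_sample[OF lim, where h="\<lambda>y. y $ c - \<mu> s $ c"])
    also have "\<dots> = T s n \<omega> $ c"
      unfolding T_def sum_component by (intro sum.cong) auto
    finally show ?thesis .
  qed
  have U: "(\<Sum>j=1..?N. ?x a j * ?x b j) = U s a b n \<omega> + N * cov s $ a $ b"
  proof -
    have "(\<Sum>j=1..?N. ?x a j * ?x b j) = (\<Sum>i=1..n. if S i \<omega> = s then
        (Y i \<omega> $ a - \<mu> s $ a) * (Y i \<omega> $ b - \<mu> s $ b) else 0)"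
      by (rule sum_group_sample[OF lim, where h="\<lambda>y. (y $ a - \<mu> s $ a) * (y $ b - \<mu> s $ b)"])
    also have "\<dots> = (\<Sum>i=1..n. (if S i \<omega> = s then
        (Y i \<omega> $ a - \<mu> s $ a) * (Y i \<omega> $ b - \<mu> s $ b) - cov s $ a $ b else 0) + (if S i \<omega> = s then cov s $ a $ b else 0))"
      by (intro sum.cong) auto
    also have "\<dots> = U s a b n \<omega> + N * cov s $ a $ b"
      by (simp only: sum.distrib U_def[symmetric] sum_const_stratum real_scaleR_def N_def)
    finally show ?thesis .
  qed
  have c: "(group_sample Y S s j \<omega> - group_mean Y S s ?N \<omega>) $ c = ?x c j - (\<Sum>j=1..?N. ?x c j) / N" for c j
    unfolding T group_mean_eq[OF lim N] N_def by simp
  have "group_covariance Y S s n \<omega> $ a $ b = (1 / (N - 1)) *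
      (\<Sum>j=1..?N. (group_sample Y S s j \<omega> - group_mean Y S s ?N \<omega>) $ a
        * (group_sample Y S s j \<omega> - group_mean Y S s ?N \<omega>) $ b)"
    by (simp add: group_covariance_def Let_def outer_product_def N_def)
  also have "\<dots> = (1 / (N - 1)) * (U s a b n \<omega> + N * cov s $ a $ b - T s n \<omega> $ a * T s n \<omega> $ b / N)"
    unfolding c unfolding N_def sum_centered_products[OF N] unfolding N_def[symmetric] U T ..
  also have "\<dots> = (U s a b n \<omega> / n + (N / n) * cov s $ a $ b - (T s n \<omega> $ a / n) * (T s n \<omega> $ b / n) / (N / n)) / (N / n - 1 / n)"
  proof -
    have "(N / n - 1 / n) = (N - 1) / n" by (simp add: diff_divide_distrib)
    moreover have "U s a b n \<omega> / n + (N / n) * cov s $ a $ b - (T s n \<omega> $ a / n) * (T s n \<omega> $ b / n) / (N / n)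
        = (U s a b n \<omega> + N * cov s $ a $ b - T s n \<omega> $ a * T s n \<omega> $ b / N) / n"
      using n N by (simp add: N_def field_simps)
    ultimately show ?thesis using n by simp
  qed
  finally show ?thesis .
qed

lemma eventually_count_pos:
  assumes "filterlim (\<lambda>n. group_count S s n \<omega>) at_top sequentially" and "strict_mono (r :: nat \<Rightarrow> nat)"
  shows "\<forall>\<^sub>F n in sequentially. group_count S s (r n) \<omega> > 0"
proof -
  have "filterlim (\<lambda>n. group_count S s (r n) \<omega>) at_top sequentially"
    by (rule filterlim_compose[OF assms(1) filterlim_subseq[OF assms(2)]])
  from this[unfolded filterlim_at_top, rule_format, of 1] show ?thesis by (simp add: Suc_le_eq)
qed

lemma group_covariance_consistent:
  assumes s: "s \<in> {1..\<xi>}"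
  shows "converges_in_probability_to_0 M (\<lambda>n \<omega>. group_covariance Y S s n \<omega> $ a $ b - cov s $ a $ b)"
proof -
  define X where "X k n \<omega> = (if k = 0 then U s a b n \<omega> / n else if k = 1 then T s n \<omega> $ a / n else T s n \<omega> $ b / n)"
    for k :: nat and n :: nat and \<omega>
  show ?thesis
  proof (rule converges_in_probability_from[where K="{0,1,2}" and X=X])
    show "X k n \<in> borel_measurable M" for k n unfolding X_def by measurable
    show "(\<lambda>\<omega>. group_covariance Y S s n \<omega> $ a $ b - cov s $ a $ b) \<in> borel_measurable M" for n
      by (intro borel_measurable_diff borel_measurable_const borel_measurable_group_covariance[OF S_rv Y_rv])
    show "converges_in_probability_to_0 M (X k)" if "k \<in> {0,1,2}" for k
      using that U_wlln[OF s, of a b] T_wlln[OF s] by (auto simp: X_def[abs_def])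
    show "AE \<omega> in M. \<forall>r. strict_mono r \<longrightarrow> (\<forall>k\<in>{0,1,2}. (\<lambda>n. X k (r n) \<omega>) \<longlonglongrightarrow> 0) \<longrightarrow>
        (\<lambda>n. group_covariance Y S s (r n) \<omega> $ a $ b - cov s $ a $ b) \<longlonglongrightarrow> 0"
      using frac[OF s]
    proof (eventually_elim, intro allI impI)
      fix \<omega> and r :: "nat \<Rightarrow> nat"
      assume fr: "(\<lambda>n. real (group_count S s n \<omega>) / real n) \<longlonglongrightarrow> f s" and r: "strict_mono r"
        and X: "\<forall>k\<in>{0,1,2}. (\<lambda>n. X k (r n) \<omega>) \<longlonglongrightarrow> 0"
      note lim = count_at_top[OF fr s]
      have U0: "(\<lambda>n. U s a b (r n) \<omega> / real (r n)) \<longlonglongrightarrow> 0"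
        and Ta: "(\<lambda>n. T s (r n) \<omega> $ a / real (r n)) \<longlonglongrightarrow> 0" and Tb: "(\<lambda>n. T s (r n) \<omega> $ b / real (r n)) \<longlonglongrightarrow> 0"
        using X[THEN bspec, of 0] X[THEN bspec, of 1] X[THEN bspec, of 2] by (simp_all add: X_def)
      have fr': "(\<lambda>n. real (group_count S s (r n) \<omega>) / real (r n)) \<longlonglongrightarrow> f s"
        using LIMSEQ_subseq_LIMSEQ[OF fr r] by (simp add: o_def)
      have inv: "(\<lambda>n. 1 / real (r n)) \<longlonglongrightarrow> 0"
        using LIMSEQ_subseq_LIMSEQ[OF lim_1_over_n r] by (simp add: o_def)
      have f0: "f s \<noteq> 0" "f s - 0 \<noteq> 0" using f_pos[OF s] by auto
      have "(\<lambda>n. (U s a b (r n) \<omega> / real (r n) + (real (group_count S s (r n) \<omega>) / real (r n)) * cov s $ a $ b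
            - (T s (r n) \<omega> $ a / real (r n)) * (T s (r n) \<omega> $ b / real (r n)) / (real (group_count S s (r n) \<omega>) / real (r n)))
          / (real (group_count S s (r n) \<omega>) / real (r n) - 1 / real (r n)))
          \<longlonglongrightarrow> (0 + f s * cov s $ a $ b - 0 * 0 / f s) / (f s - 0)"
        by (intro tendsto_divide tendsto_diff tendsto_add tendsto_mult tendsto_const U0 Ta Tb fr' inv f0)
      then have "(\<lambda>n. (U s a b (r n) \<omega> / real (r n) + (real (group_count S s (r n) \<omega>) / real (r n)) * cov s $ a $ b
            - (T s (r n) \<omega> $ a / real (r n)) * (T s (r n) \<omega> $ b / real (r n)) / (real (group_count S s (r n) \<omega>) / real (r n)))
          / (real (group_count S s (r n) \<omega>) / real (r n) - 1 / real (r n))) \<longlonglongrightarrow> cov s $ a $ b"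
        using f0 by simp
      then have "(\<lambda>n. group_covariance Y S s (r n) \<omega> $ a $ b) \<longlonglongrightarrow> cov s $ a $ b"
        by (rule Lim_transform_eventually)
          (use eventually_count_pos[OF lim r] in \<open>eventually_elim, simp only: group_covariance_eq[OF lim]\<close>)
      from tendsto_diff[OF this tendsto_const[of "cov s $ a $ b"]]
      show "(\<lambda>n. group_covariance Y S s (r n) \<omega> $ a $ b - cov s $ a $ b) \<longlonglongrightarrow> 0" by simp
    qed
  qed simp
qed

lemma lam_subseq_tendsto:
  assumes "(\<lambda>n. sqrt (real (r n)) * (lam (r n) s \<omega> - q s)) \<longlonglongrightarrow> 0" and r: "strict_mono (r :: nat \<Rightarrow> nat)"
  shows "(\<lambda>n. lam (r n) s \<omega>) \<longlonglongrightarrow> q s"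
proof -
  have "(\<lambda>n. lam (r n) s \<omega> - q s) \<longlonglongrightarrow> 0"
  proof (rule Lim_null_comparison[OF _ tendsto_rabs_zero[OF assms(1)]])
    show "\<forall>\<^sub>F n in sequentially. norm (lam (r n) s \<omega> - q s) \<le> \<bar>sqrt (real (r n)) * (lam (r n) s \<omega> - q s)\<bar>"
      using eventually_ge_at_top[of 1]
    proof eventually_elim
      case (elim n)
      then have "1 \<le> r n" using seq_suble[OF r, of n] by linarith
      then have "1 * \<bar>lam (r n) s \<omega> - q s\<bar> \<le> sqrt (real (r n)) * \<bar>lam (r n) s \<omega> - q s\<bar>"
        by (intro mult_right_mono) auto
      then show ?case by (simp add: abs_mult)
    qed
  qed
  from tendsto_add[OF this tendsto_const[of "q s"]] show ?thesis by simp
qed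

lemma measurable_count [measurable]: "(\<lambda>\<omega>. real (group_count S s n \<omega>)) \<in> borel_measurable M"
  using measurable_group_count[OF S_rv] by measurable

lemma weight_consistent:
  assumes s: "s \<in> {1..\<xi>}"
  shows "converges_in_probability_to_0 M (\<lambda>n \<omega>. lam n s \<omega> * real n / real (group_count S s n \<omega>) - q s / f s)"
proof (rule converges_in_probability_from[where K="{()}" and X="\<lambda>_ n \<omega>. sqrt (real n) * (lam n s \<omega> - q s)"])
  note lam_rv[OF s, measurable]
  show "(\<lambda>\<omega>. sqrt (real n) * (lam n s \<omega> - q s)) \<in> borel_measurable M" for n by measurable
  show "(\<lambda>\<omega>. lam n s \<omega> * real n / real (group_count S s n \<omega>) - q s / f s) \<in> borel_measurable M" for n
    by measurable
  show "AE \<omega> in M. \<forall>r. strict_mono r \<longrightarrow>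
      (\<forall>k\<in>{()}. (\<lambda>n. sqrt (real (r n)) * (lam (r n) s \<omega> - q s)) \<longlonglongrightarrow> 0) \<longrightarrow>
      (\<lambda>n. lam (r n) s \<omega> * real (r n) / real (group_count S s (r n) \<omega>) - q s / f s) \<longlonglongrightarrow> 0"
    using frac[OF s]
  proof (eventually_elim, intro allI impI)
    fix \<omega> and r :: "nat \<Rightarrow> nat"
    assume fr: "(\<lambda>n. real (group_count S s n \<omega>) / real n) \<longlonglongrightarrow> f s" and r: "strict_mono r"
      and "\<forall>k\<in>{()}. (\<lambda>n. sqrt (real (r n)) * (lam (r n) s \<omega> - q s)) \<longlonglongrightarrow> 0"
    then have l: "(\<lambda>n. lam (r n) s \<omega>) \<longlonglongrightarrow> q s" using lam_subseq_tendsto by blast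
    have "(\<lambda>n. real (group_count S s (r n) \<omega>) / real (r n)) \<longlonglongrightarrow> f s"
      using LIMSEQ_subseq_LIMSEQ[OF fr r] by (simp add: o_def)
    from tendsto_diff[OF tendsto_divide[OF l this] tendsto_const[of "q s / f s"]]
    show "(\<lambda>n. lam (r n) s \<omega> * real (r n) / real (group_count S s (r n) \<omega>) - q s / f s) \<longlonglongrightarrow> 0"
      using f_pos[OF s] by simp
  qed
qed (simp_all add: lam_conv[OF s])

section \<open>Asymptotic normality and the quadratic form\<close>

definition X :: "nat \<Rightarrow> 'a \<Rightarrow> real^'d" where
  "X n \<omega> = sqrt (real n) *\<^sub>R (weighted_mean \<xi> lam Y S n \<omega> - (\<Sum>s=1..\<xi>. q s *\<^sub>R \<mu> s))"

lemma measurable_X [measurable]: "X n \<in> borel_measurable M"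
  unfolding X_def[abs_def]
  by (intro borel_measurable_scaleR borel_measurable_const borel_measurable_diff
      borel_measurable_weighted_mean[OF S_rv Y_rv lam_rv])

text \<open>The two errors play different roles. The error of the estimated weights is multiplied by
  the fixed means, so it must vanish at the rate n^(-1/2), as \<open>lam_conv\<close> provides; the
  coefficient of \<open>T s n\<close> is multiplied by a tight sequence, so its mere consistency
  suffices.\<close>

lemma X_minus_Z:
  assumes lim: "\<And>s. s \<in> {1..\<xi>} \<Longrightarrow> filterlim (\<lambda>n. group_count S s n \<omega>) at_top sequentially"
    and N: "\<And>s. s \<in> {1..\<xi>} \<Longrightarrow> group_count S s n \<omega> > 0" and n: "n > 0"
  shows "(X n \<omega> - Z (\<lambda>s. q s / f s) n \<omega>) $ b =
    (\<Sum>s=1..\<xi>. sqrt (real n) * (lam n s \<omega> - q s) * \<mu> s $ b +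
      (lam n s \<omega> * real n / real (group_count S s n \<omega>) - q s / f s) * (T s n \<omega> $ b / sqrt (real n)))"
proof -
  let ?N = "\<lambda>s. real (group_count S s n \<omega>)"
  have "weighted_mean \<xi> lam Y S n \<omega> = (\<Sum>s=1..\<xi>. lam n s \<omega> *\<^sub>R (\<mu> s + (1 / ?N s) *\<^sub>R T s n \<omega>))"
    unfolding weighted_mean_def by (intro sum.cong refl) (simp only: group_mean_eq[OF lim N])
  then have "X n \<omega> $ b = (\<Sum>s=1..\<xi>. sqrt n * (lam n s \<omega> * (\<mu> s $ b + T s n \<omega> $ b / ?N s) - q s * \<mu> s $ b))"
    by (simp add: X_def sum_distrib_left sum_subtractf right_diff_distrib)
  moreover have "Z (\<lambda>s. q s / f s) n \<omega> $ b = (\<Sum>s=1..\<xi>. q s / f s * (T s n \<omega> $ b / sqrt n))"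
    by (simp add: Z_def sum_distrib_left mult_ac sum_divide_distrib)
  ultimately have "(X n \<omega> - Z (\<lambda>s. q s / f s) n \<omega>) $ b =
      (\<Sum>s=1..\<xi>. sqrt n * (lam n s \<omega> * (\<mu> s $ b + T s n \<omega> $ b / ?N s) - q s * \<mu> s $ b) - q s / f s * (T s n \<omega> $ b / sqrt n))"
    by (simp add: sum_subtractf)
  also have "\<dots> = (\<Sum>s=1..\<xi>. sqrt n * (lam n s \<omega> - q s) * \<mu> s $ b +
      (lam n s \<omega> * real n / ?N s - q s / f s) * (T s n \<omega> $ b / sqrt n))"
  proof (intro sum.cong refl)
    fix s
    have dn: "real n / sqrt n = sqrt n" by (simp add: real_div_sqrt)
    have "lam n s \<omega> * real n / ?N s * (T s n \<omega> $ b / sqrt n) = lam n s \<omega> * (T s n \<omega> $ b / ?N s) * (real n / sqrt n)"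
      by (simp only: times_divide_times_eq times_divide_eq_left times_divide_eq_right divide_divide_eq_left mult_ac)
    then have "lam n s \<omega> * real n / ?N s * (T s n \<omega> $ b / sqrt n) = sqrt n * (lam n s \<omega> * (T s n \<omega> $ b / ?N s))"
      unfolding dn by (simp only: mult_ac)
    then show "sqrt n * (lam n s \<omega> * (\<mu> s $ b + T s n \<omega> $ b / ?N s) - q s * \<mu> s $ b) - q s / f s * (T s n \<omega> $ b / sqrt n) =
        sqrt n * (lam n s \<omega> - q s) * \<mu> s $ b + (lam n s \<omega> * real n / ?N s - q s / f s) * (T s n \<omega> $ b / sqrt n)"
      by (simp only: left_diff_distrib right_diff_distrib distrib_left)
  qed
  finally show ?thesis .
qed

lemma X_approx_Z: "converges_in_probability_to_0 M (\<lambda>n \<omega>. norm (X n \<omega> - Z (\<lambda>s. q s / f s) n \<omega>))"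
proof -
  \<comment> \<open>All null sequences form one finite family: \<open>None\<close> marks the weight
    error of a stratum, \<open>Some b\<close> the product of coefficient error and normalised
    \<open>T\<close> in coordinate \<open>b\<close>.\<close>
  define D where "D k n \<omega> = (case k of (s, None) \<Rightarrow> sqrt (real n) * (lam n s \<omega> - q s)
    | (s, Some b) \<Rightarrow> (lam n s \<omega> * real n / real (group_count S s n \<omega>) - q s / f s) * (T s n \<omega> $ b / sqrt (real n)))"
    for k :: "nat \<times> 'd option" and n :: nat and \<omega>
  let ?K = "{1..\<xi>} \<times> (UNIV :: 'd option set)"
  show ?thesis
  proof (rule converges_in_probability_from[where K="?K" and X=D])
    have w: "(\<lambda>\<omega>. lam n s \<omega> * real n / real (group_count S s n \<omega>) - q s / f s) \<in> borel_measurable M"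
      if "s \<in> {1..\<xi>}" for n s
      using lam_rv[OF that] by measurable
    have t: "(\<lambda>\<omega>. T s n \<omega> $ b / sqrt (real n)) \<in> borel_measurable M" for n s b by measurable
    show "D k n \<in> borel_measurable M" if k: "k \<in> ?K" for k n
    proof -
      obtain s c where [simp]: "k = (s, c)" by (cases k)
      have [measurable]: "lam n s \<in> borel_measurable M" using lam_rv k by simp
      show ?thesis by (cases c) (simp_all add: D_def[abs_def])
    qed
    show "converges_in_probability_to_0 M (D k)" if k: "k \<in> ?K" for k
    proof -
      obtain s c where [simp]: "k = (s, c)" by (cases k)
      have s: "s \<in> {1..\<xi>}" using k by simp
      show ?thesis
      proof (cases c)
        case None
        then show ?thesis using lam_conv[OF s] by (simp add: D_def[abs_def])
      next
        case (Some b)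
        then show ?thesis
          using converges_in_probability_times_tight[OF w[OF s] t weight_consistent[OF s] T_tight[OF s, of b]]
          by (simp add: D_def[abs_def])
      qed
    qed
    show "(\<lambda>\<omega>. norm (X n \<omega> - Z (\<lambda>s. q s / f s) n \<omega>)) \<in> borel_measurable M" for n by measurable
    show "AE \<omega> in M. \<forall>r. strict_mono r \<longrightarrow> (\<forall>k\<in>?K. (\<lambda>n. D k (r n) \<omega>) \<longlonglongrightarrow> 0) \<longrightarrow>
        (\<lambda>n. norm (X (r n) \<omega> - Z (\<lambda>s. q s / f s) (r n) \<omega>)) \<longlonglongrightarrow> 0"
      using AE_counts
    proof (eventually_elim, intro allI impI)
      fix \<omega> and r :: "nat \<Rightarrow> nat"
      assume fr: "\<forall>s\<in>{1..\<xi>}. (\<lambda>n. real (group_count S s n \<omega>) / real n) \<longlonglongrightarrow> f s" and r: "strict_mono r"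
        and D: "\<forall>k\<in>?K. (\<lambda>n. D k (r n) \<omega>) \<longlonglongrightarrow> 0"
      have lim: "filterlim (\<lambda>n. group_count S s n \<omega>) at_top sequentially" if "s \<in> {1..\<xi>}" for s
        using count_at_top fr that by blast
      have "\<forall>\<^sub>F n in sequentially. \<forall>s\<in>{1..\<xi>}. group_count S s (r n) \<omega> > 0"
        by (intro eventually_ball_finite ballI eventually_count_pos lim r) auto
      moreover have "\<forall>\<^sub>F n in sequentially. n \<ge> 1" by (rule eventually_ge_at_top)
      ultimately have ev: "\<forall>\<^sub>F n in sequentially. \<forall>b. (\<Sum>s=1..\<xi>. D (s, None) (r n) \<omega> * \<mu> s $ b + D (s, Some b) (r n) \<omega>)
          = (X (r n) \<omega> - Z (\<lambda>s. q s / f s) (r n) \<omega>) $ b"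
      proof eventually_elim
        case (elim n)
        have "r n > 0" using elim(2) seq_suble[OF r, of n] by linarith
        show ?case
        proof
          fix b
          have "(X (r n) \<omega> - Z (\<lambda>s. q s / f s) (r n) \<omega>) $ b =
            (\<Sum>s=1..\<xi>. sqrt (real (r n)) * (lam (r n) s \<omega> - q s) * \<mu> s $ b +
              (lam (r n) s \<omega> * real (r n) / real (group_count S s (r n) \<omega>) - q s / f s) * (T s (r n) \<omega> $ b / sqrt (real (r n))))"
            by (rule X_minus_Z[OF lim]) (use elim(1) \<open>r n > 0\<close> in auto)
          then show "(\<Sum>s=1..\<xi>. D (s, None) (r n) \<omega> * \<mu> s $ b + D (s, Some b) (r n) \<omega>)
              = (X (r n) \<omega> - Z (\<lambda>s. q s / f s) (r n) \<omega>) $ b"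
            by (simp only: D_def prod.case option.case)
        qed
      qed
      have "(\<lambda>n. (X (r n) \<omega> - Z (\<lambda>s. q s / f s) (r n) \<omega>) $ b) \<longlonglongrightarrow> 0" for b
      proof (rule Lim_transform_eventually)
        show "(\<lambda>n. \<Sum>s=1..\<xi>. D (s, None) (r n) \<omega> * \<mu> s $ b + D (s, Some b) (r n) \<omega>) \<longlonglongrightarrow> 0"
          by (intro tendsto_null_sum tendsto_add_zero tendsto_mult_left_zero D[rule_format]) auto
        show "\<forall>\<^sub>F n in sequentially. (\<Sum>s=1..\<xi>. D (s, None) (r n) \<omega> * \<mu> s $ b + D (s, Some b) (r n) \<omega>)
          = (X (r n) \<omega> - Z (\<lambda>s. q s / f s) (r n) \<omega>) $ b"
          using ev by eventually_elim blast
      qed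
      then have "(\<lambda>n. X (r n) \<omega> - Z (\<lambda>s. q s / f s) (r n) \<omega>) \<longlonglongrightarrow> 0"
        by (intro vec_tendstoI) (simp only: zero_index)
      then show "(\<lambda>n. norm (X (r n) \<omega> - Z (\<lambda>s. q s / f s) (r n) \<omega>)) \<longlonglongrightarrow> 0" by (rule tendsto_norm_zero)
    qed
  qed simp
qed

lemma X_tight: "tight_sequence M X"
  by (rule tight_sequence_perturb[OF _ _ Z_tight X_approx_Z]) measurable

theorem X_asymptotically_normal: "converges_in_distribution M X (multivariate_normal 0 V)"
proof (rule converges_in_distribution_char[OF prob_space_axioms])
  show "(\<lambda>n. expectation (\<lambda>\<omega>. cis (t \<bullet> X n \<omega>))) \<longlonglongrightarrow> (\<integral>x. cis (t \<bullet> x) \<partial>multivariate_normal 0 V)" for t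
  proof (rule char_perturb[OF _ _ X_approx_Z])
    \<comment> \<open>The variance has one factor \<open>f s\<close>, the limiting share of the
      stratum among the summands, against the two factors 1 / \<open>f s\<close> from the squared
      weight.\<close>
    have "(\<Sum>s=1..\<xi>. f s * ((q s / f s)\<^sup>2 * (t \<bullet> (cov s *v t)))) = t \<bullet> (V *v t)"
      unfolding V_quadratic
    proof (intro sum.cong refl)
      fix s assume "s \<in> {1..\<xi>}"
      then show "f s * ((q s / f s)\<^sup>2 * (t \<bullet> (cov s *v t))) = (q s)\<^sup>2 / f s * (t \<bullet> (cov s *v t))"
        using f_pos[of s] by (simp add: power2_eq_square)
    qed
    then show "(\<lambda>n. expectation (\<lambda>\<omega>. cis (t \<bullet> Z (\<lambda>s. q s / f s) n \<omega>))) \<longlonglongrightarrow> (\<integral>x. cis (t \<bullet> x) \<partial>multivariate_normal 0 V)"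
      using Z_char[of t "\<lambda>s. q s / f s"] by (simp only: char_multivariate_normal[OF V_sym V_psd])
  qed measurable
qed (simp_all add: X_tight prob_space_multivariate_normal[OF V_sym V_psd])

text \<open>Inversion is continuous at the invertible \<open>V\<close>. The estimated matrix may be
  singular for particular outcomes and \<open>n\<close>, but wherever its entries converge to those
  of \<open>V\<close> its determinant is eventually nonzero.\<close>

lemma weighted_covariance_inverse_consistent:
  assumes inv: "invertible V"
  shows "converges_in_probability_to_0 M
    (\<lambda>n \<omega>. matrix_inv (weighted_covariance \<xi> lam Y S n \<omega>) $ a $ b - matrix_inv V $ a $ b)"
proof -
  \<comment> \<open>Here \<open>None\<close> again marks the weight errors, while
    \<open>Some (i, j)\<close> marks the error of an entry of the group covariance; together with
    the frequencies they determine the limit of the weighted covariance.\<close>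
  define D where "D k n \<omega> = (case k of (s, None) \<Rightarrow> sqrt (real n) * (lam n s \<omega> - q s)
    | (s, Some (i, j)) \<Rightarrow> group_covariance Y S s n \<omega> $ i $ j - cov s $ i $ j)"
    for k :: "nat \<times> ('d \<times> 'd) option" and n :: nat and \<omega>
  let ?K = "{1..\<xi>} \<times> (UNIV :: ('d \<times> 'd) option set)"
  show ?thesis
  proof (rule converges_in_probability_from[where K="?K" and X=D])
    show "D k n \<in> borel_measurable M" if k: "k \<in> ?K" for k n
    proof -
      obtain s c where [simp]: "k = (s, c)" by (cases k)
      have [measurable]: "lam n s \<in> borel_measurable M" using lam_rv k by simp
      show ?thesis
        by (cases c) (auto simp: D_def[abs_def] split: prod.split
            intro!: borel_measurable_diff borel_measurable_group_covariance[OF S_rv Y_rv])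
    qed
    show "converges_in_probability_to_0 M (D k)" if k: "k \<in> ?K" for k
    proof -
      obtain s c where [simp]: "k = (s, c)" by (cases k)
      have s: "s \<in> {1..\<xi>}" using k by simp
      show ?thesis
        using lam_conv[OF s] group_covariance_consistent[OF s]
        by (cases c) (auto simp: D_def[abs_def] split: prod.split)
    qed
    show "(\<lambda>\<omega>. matrix_inv (weighted_covariance \<xi> lam Y S n \<omega>) $ a $ b - matrix_inv V $ a $ b) \<in> borel_measurable M" for n
      by (intro borel_measurable_diff borel_measurable_const borel_measurable_matrix_inv
          borel_measurable_weighted_covariance[OF S_rv Y_rv lam_rv])
    show "AE \<omega> in M. \<forall>r. strict_mono r \<longrightarrow> (\<forall>k\<in>?K. (\<lambda>n. D k (r n) \<omega>) \<longlonglongrightarrow> 0) \<longrightarrow>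
        (\<lambda>n. matrix_inv (weighted_covariance \<xi> lam Y S (r n) \<omega>) $ a $ b - matrix_inv V $ a $ b) \<longlonglongrightarrow> 0"
      using AE_counts
    proof (eventually_elim, intro allI impI)
      fix \<omega> and r :: "nat \<Rightarrow> nat"
      assume fr: "\<forall>s\<in>{1..\<xi>}. (\<lambda>n. real (group_count S s n \<omega>) / real n) \<longlonglongrightarrow> f s" and r: "strict_mono r"
        and D: "\<forall>k\<in>?K. (\<lambda>n. D k (r n) \<omega>) \<longlonglongrightarrow> 0"
      have "(\<lambda>n. weighted_covariance \<xi> lam Y S (r n) \<omega> $ i $ j) \<longlonglongrightarrow> V $ i $ j" for i j
      proof -
        have "(\<lambda>n. real (r n) * (lam (r n) s \<omega>)\<^sup>2 / real (group_count S s (r n) \<omega>) * group_covariance Y S s (r n) \<omega> $ i $ j)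
            \<longlonglongrightarrow> (q s)\<^sup>2 / f s * cov s $ i $ j" if s: "s \<in> {1..\<xi>}" for s
        proof -
          have "(\<lambda>n. D (s, None) (r n) \<omega>) \<longlonglongrightarrow> 0" using D s by blast
          then have "(\<lambda>n. sqrt (real (r n)) * (lam (r n) s \<omega> - q s)) \<longlonglongrightarrow> 0" by (simp add: D_def)
          then have l: "(\<lambda>n. lam (r n) s \<omega>) \<longlonglongrightarrow> q s" by (rule lam_subseq_tendsto[OF _ r])
          have fr': "(\<lambda>n. real (group_count S s (r n) \<omega>) / real (r n)) \<longlonglongrightarrow> f s"
            using LIMSEQ_subseq_LIMSEQ[OF fr[rule_format, OF s] r] by (simp add: o_def)
          have f0: "f s \<noteq> 0" using f_pos[OF s] by simp
          have "(\<lambda>n. D (s, Some (i, j)) (r n) \<omega>) \<longlonglongrightarrow> 0" using D s by blast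
          then have "(\<lambda>n. group_covariance Y S s (r n) \<omega> $ i $ j - cov s $ i $ j) \<longlonglongrightarrow> 0" by (simp add: D_def)
          from tendsto_add[OF this tendsto_const[of "cov s $ i $ j"]]
          have c: "(\<lambda>n. group_covariance Y S s (r n) \<omega> $ i $ j) \<longlonglongrightarrow> cov s $ i $ j" by simp
          from tendsto_mult[OF tendsto_divide[OF tendsto_power[OF l, of 2] fr' f0] c]
          show ?thesis by (simp add: mult.commute)
        qed
        then have "(\<lambda>n. \<Sum>s=1..\<xi>. real (r n) * (lam (r n) s \<omega>)\<^sup>2 / real (group_count S s (r n) \<omega>) * group_covariance Y S s (r n) \<omega> $ i $ j)
            \<longlonglongrightarrow> (\<Sum>s=1..\<xi>. (q s)\<^sup>2 / f s * cov s $ i $ j)"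
          by (rule tendsto_sum)
        then show ?thesis by (simp add: weighted_covariance_def V_def)
      qed
      from tendsto_diff[OF tendsto_matrix_inv[OF this inv, of a b] tendsto_const[of "matrix_inv V $ a $ b"]]
      show "(\<lambda>n. matrix_inv (weighted_covariance \<xi> lam Y S (r n) \<omega>) $ a $ b - matrix_inv V $ a $ b) \<longlonglongrightarrow> 0"
        by simp
    qed
  qed simp
qed

theorem X_quadratic_form:
  assumes inv: "invertible V" and \<alpha>: "\<alpha> \<in> {0<..<1}"
  shows "(\<lambda>n. \<P>(\<omega> in M. X n \<omega> \<bullet> (matrix_inv (weighted_covariance \<xi> lam Y S n \<omega>) *v X n \<omega>)
    < quantile (chi_squared CARD('d)) (1 - \<alpha>))) \<longlonglongrightarrow> 1 - \<alpha>"
  by (rule quadratic_form_converges_to_chi_squared[OF V_sym V_psd inv X_asymptotically_normal X_tight _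
      weighted_covariance_inverse_consistent[OF inv]])
    (use \<alpha> in \<open>auto intro!: borel_measurable_matrix_inv borel_measurable_weighted_covariance[OF S_rv Y_rv lam_rv]\<close>)

end

section \<open>Transfer to the population variables Y and S\<close>

theorem proposition3p2:
  fixes P :: "'a measure" and \<xi> :: nat
    and Y :: "'a \<Rightarrow> real^'d" and S :: "'a \<Rightarrow> nat"
    and Ys :: "nat \<Rightarrow> 'a \<Rightarrow> real^'d" and Ss :: "nat \<Rightarrow> 'a \<Rightarrow> nat"
    and lam :: "nat \<Rightarrow> nat \<Rightarrow> 'a \<Rightarrow> real" and f :: "nat \<Rightarrow> real"
    and \<Sigma> :: "nat \<Rightarrow> real^'d^'d" and V :: "real^'d^'d" and \<alpha> :: real
  assumes prob: "prob_space P"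
    and xi: "\<xi> \<ge> 1"
    and Y_rv: "Y \<in> borel_measurable P"
    and S_rv: "S \<in> measurable P (count_space {1..\<xi>})"
    and Ys_rv: "\<And>i. i \<ge> 1 \<Longrightarrow> Ys i \<in> borel_measurable P"
    and Ss_rv: "\<And>i. i \<ge> 1 \<Longrightarrow> Ss i \<in> measurable P (count_space {1..\<xi>})"
    and indep: "prob_space.indep_vars P (\<lambda>_. borel \<Otimes>\<^sub>M count_space {1..\<xi>})
                  (\<lambda>i \<omega>. (Ys i \<omega>, Ss i \<omega>)) {1..}"
    and cond_law: "\<And>i s. i \<ge> 1 \<Longrightarrow> s \<in> {1..\<xi>} \<Longrightarrow>
                  \<P>(\<omega> in P. Ss i \<omega> = s) * \<P>(\<omega> in P. S \<omega> = s) > 0 \<Longrightarrow>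
                  distr (given_group P (Ss i) s) borel (Ys i) = distr (given_group P S s) borel Y"
    and counts: "\<And>s. s \<in> {1..\<xi>} \<Longrightarrow>
                  AE \<omega> in P. filterlim (\<lambda>n. group_count Ss s n \<omega>) at_top sequentially"
    and pos: "\<And>s. s \<in> {1..\<xi>} \<Longrightarrow> \<P>(\<omega> in P. S \<omega> = s) > 0"
    and second_moment: "\<And>s. s \<in> {1..\<xi>} \<Longrightarrow> integrable (given_group P S s) (\<lambda>\<omega>. (norm (Y \<omega>))\<^sup>2)"
    and Sigma: "\<And>s. s \<in> {1..\<xi>} \<Longrightarrow> \<Sigma> s = covariance_matrix (given_group P S s) Y"
    and lam_rv: "\<And>n s. n \<ge> 1 \<Longrightarrow> s \<in> {1..\<xi>} \<Longrightarrow> lam n s \<in> borel_measurable P"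
    and lam_range: "\<And>n s \<omega>. n \<ge> 1 \<Longrightarrow> s \<in> {1..\<xi>} \<Longrightarrow> \<omega> \<in> space P \<Longrightarrow> lam n s \<omega> \<in> {0..1}"
    and lam_sum: "\<And>n \<omega>. n \<ge> 1 \<Longrightarrow> \<omega> \<in> space P \<Longrightarrow> (\<Sum>s=1..\<xi>. lam n s \<omega>) = 1"
    and lam_conv: "\<And>s. s \<in> {1..\<xi>} \<Longrightarrow> converges_in_probability_to_0 P
                  (\<lambda>n \<omega>. sqrt (real n) * (lam n s \<omega> - \<P>(\<omega>' in P. S \<omega>' = s)))"
    and f_range: "\<And>s. s \<in> {1..\<xi>} \<Longrightarrow> f s \<in> {0<..<1}"
    and frac: "\<And>s. s \<in> {1..\<xi>} \<Longrightarrow>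
                  AE \<omega> in P. (\<lambda>n. real (group_count Ss s n \<omega>) / real n) \<longlonglongrightarrow> f s"
    and V: "V = (\<Sum>s=1..\<xi>. ((\<P>(\<omega> in P. S \<omega> = s))\<^sup>2 / f s) *\<^sub>R \<Sigma> s)"
    and alpha: "\<alpha> \<in> {0<..<1}"
  shows "converges_in_distribution P
           (\<lambda>n \<omega>. sqrt (real n) *\<^sub>R (weighted_mean \<xi> lam Ys Ss n \<omega> - (\<integral>\<omega>'. Y \<omega>' \<partial>P)))
           (multivariate_normal 0 V)
       \<and> (invertible V \<longrightarrow>
         (\<lambda>n. \<P>(\<omega> in P.
            real n * ((weighted_mean \<xi> lam Ys Ss n \<omega> - (\<integral>\<omega>'. Y \<omega>' \<partial>P)) \<bullet>
              (matrix_inv (weighted_covariance \<xi> lam Ys Ss n \<omega>) *v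
                (weighted_mean \<xi> lam Ys Ss n \<omega> - (\<integral>\<omega>'. Y \<omega>' \<partial>P))))
            < quantile (chi_squared CARD('d)) (1 - \<alpha>)))
         \<longlonglongrightarrow> 1 - \<alpha>)"
proof -
  interpret P: prob_space P by (rule prob)
  define \<nu> where "\<nu> s = distr (given_group P S s) borel Y" for s
  define q where "q s = \<P>(\<omega> in P. S \<omega> = s)" for s
  \<comment> \<open>Nothing is assumed about \<open>lam 0\<close>; for \<open>n = 0\<close> the weights do not matter.\<close>
  define lam' where "lam' n = (if n = 0 then (\<lambda>s \<omega>. 0) else lam n)" for n
  note Y_meas = Y_rv and S_meas = S_rv
  have Y_given: "Y \<in> borel_measurable (given_group P S s)" for s
    using Y_rv by (simp add: given_group_def uniform_measure_def)
  have S_event: "{\<omega> \<in> space P. S \<omega> = s} \<in> sets P" for s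
  proof -
    have "Measurable.pred P (\<lambda>\<omega>. S \<omega> = s)" by (rule measurable_compose[OF S_rv]) auto
    then show ?thesis by (simp add: pred_def)
  qed
  have qs: "q s > 0" if "s \<in> {1..\<xi>}" for s using pos[OF that] by (simp add: q_def)
  interpret stratified_estimator P \<xi> Ys Ss \<nu> f q lam'
  proof (intro stratified_estimator.intro stratified_sample.intro stratified_sample_axioms.intro
      stratified_estimator_axioms.intro)
    show "prob_space P" by (rule prob)
    show "Ys i \<in> borel_measurable P" if "i \<ge> 1" for i by (rule Ys_rv[OF that])
    show "Ss i \<in> measurable P (count_space {1..\<xi>})" if "i \<ge> 1" for i by (rule Ss_rv[OF that])
    show "P.indep_vars (\<lambda>_. borel \<Otimes>\<^sub>M count_space {1..\<xi>}) (\<lambda>i \<omega>. (Ys i \<omega>, Ss i \<omega>)) {1..}" by (rule indep)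
    fix s assume s: "s \<in> {1..\<xi>}"
    show "prob_space (\<nu> s)"
      unfolding \<nu>_def by (intro prob_space.prob_space_distr P.prob_space_given_group pos s Y_given)
    show "sets (\<nu> s) = sets borel" by (simp add: \<nu>_def)
    show "AE \<omega> in P. (\<lambda>n. real (group_count Ss s n \<omega>) / real n) \<longlonglongrightarrow> f s" by (rule frac[OF s])
    show "distr (given_group P (Ss i) s) borel (Ys i) = \<nu> s"
      if "i \<ge> 1" "0 < \<P>(\<omega> in P. Ss i \<omega> = s)" for i
      unfolding \<nu>_def by (rule cond_law[OF that(1) s mult_pos_pos[OF that(2) pos[OF s]]])
    show "integrable (\<nu> s) (\<lambda>y. (norm y)\<^sup>2)"
      unfolding \<nu>_def using second_moment[OF s] Y_given by (simp add: integrable_distr_eq)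
    show "f s > 0" using f_range[OF s] by simp
    show "lam' n s \<in> borel_measurable P" for n
      using lam_rv[OF _ s] by (cases n) (auto simp: lam'_def)
    have eq: "sqrt (real n) * (lam' n s \<omega> - q s) = sqrt (real n) * (lam n s \<omega> - \<P>(\<omega>' in P. S \<omega>' = s))" for n \<omega>
      by (simp add: lam'_def q_def)
    show "converges_in_probability_to_0 P (\<lambda>n \<omega>. sqrt (real n) * (lam' n s \<omega> - q s))"
      unfolding eq by (rule lam_conv[OF s])
  qed
  \<comment> \<open>The given covariance is an integral over the conditional probability space, the
    one of the locale an integral over the image law \<open>\<nu> s\<close>; a change of variables
    identifies means and then mixed moments.\<close>
  have cov: "\<Sigma> s = cov s" if s: "s \<in> {1..\<xi>}" for s
  proof -
    have "(\<integral>\<omega>. Y \<omega> $ i \<partial>given_group P S s) = \<mu> s $ i" for i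
    proof -
      have "(\<integral>\<omega>. Y \<omega> $ i \<partial>given_group P S s) = (\<integral>y. y $ i \<partial>\<nu> s)"
        unfolding \<nu>_def by (rule integral_distr[symmetric, OF Y_given]) simp
      also have "\<dots> = (\<integral>y. y \<bullet> axis i 1 \<partial>\<nu> s)" by (simp add: inner_axis)
      also have "\<dots> = \<mu> s \<bullet> axis i 1"
        unfolding \<mu>_def using integrable_ident_\<nu>[OF s] by simp
      finally show ?thesis by (simp add: inner_axis)
    qed
    then have "\<Sigma> s = (\<chi> i j. \<integral>\<omega>. (Y \<omega> $ i - \<mu> s $ i) * (Y \<omega> $ j - \<mu> s $ j) \<partial>given_group P S s)"
      by (simp add: Sigma[OF s] covariance_matrix_def)
    also have "\<dots> = cov s"
      unfolding cov_def \<nu>_def by (subst integral_distr[OF Y_given]) auto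
    finally show ?thesis .
  qed
  have V_eq: "V = stratified_estimator.V \<xi> \<nu> f q"
    unfolding V V_def q_def by (intro sum.cong refl) (simp add: cov)
  \<comment> \<open>The law of total expectation turns E(Y) into the centring constant of
    \<open>X\<close>.\<close>
  have mean: "(\<integral>\<omega>. Y \<omega> \<partial>P) = (\<Sum>s=1..\<xi>. q s *\<^sub>R \<mu> s)"
  proof -
    have m: "(\<lambda>y::real^'d. y) \<in> borel_measurable borel" by simp
    note I = P.integral_on_group[OF Y_meas S_event m \<nu>_def[symmetric] integrable_ident_\<nu>]
    have "(\<integral>\<omega>. Y \<omega> \<partial>P) = (\<integral>\<omega>. (\<Sum>s=1..\<xi>. if S \<omega> = s then Y \<omega> else 0) \<partial>P)"
    proof (rule Bochner_Integration.integral_cong[OF refl])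
      fix \<omega> assume "\<omega> \<in> space P"
      then have "S \<omega> \<in> {1..\<xi>}" using measurable_space[OF S_meas] by simp
      then show "Y \<omega> = (\<Sum>s=1..\<xi>. if S \<omega> = s then Y \<omega> else 0)" by simp
    qed
    also have "\<dots> = (\<Sum>s=1..\<xi>. \<integral>\<omega>. (if S \<omega> = s then Y \<omega> else 0) \<partial>P)"
      by (rule Bochner_Integration.integral_sum) (rule I(1))
    also have "\<dots> = (\<Sum>s=1..\<xi>. q s *\<^sub>R \<mu> s)"
      unfolding q_def \<mu>_def by (intro sum.cong refl I(2))
    finally show ?thesis .
  qed
  \<comment> \<open>For \<open>n = 0\<close> all counts are 0: each group mean is then an empty sum,
    and the weighted covariance below has the factor \<open>real 0\<close>. For positive
    \<open>n\<close> the two weight families coincide.\<close>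
  have wm: "weighted_mean \<xi> lam Ys Ss n \<omega> = weighted_mean \<xi> lam' Ys Ss n \<omega>" for n \<omega>
    by (cases n) (simp_all add: weighted_mean_def group_mean_def lam'_def)
  have wc: "weighted_covariance \<xi> lam Ys Ss n \<omega> = weighted_covariance \<xi> lam' Ys Ss n \<omega>" for n \<omega>
    by (cases n) (simp_all add: weighted_covariance_def lam'_def)
  have X_eq: "sqrt (real n) *\<^sub>R (weighted_mean \<xi> lam Ys Ss n \<omega> - (\<integral>\<omega>'. Y \<omega>' \<partial>P)) = X n \<omega>" for n \<omega>
    by (simp only: X_def wm mean)
  have quad: "real n * ((weighted_mean \<xi> lam Ys Ss n \<omega> - (\<integral>\<omega>'. Y \<omega>' \<partial>P)) \<bullet>
      (matrix_inv (weighted_covariance \<xi> lam Ys Ss n \<omega>) *v (weighted_mean \<xi> lam Ys Ss n \<omega> - (\<integral>\<omega>'. Y \<omega>' \<partial>P))))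
    = X n \<omega> \<bullet> (matrix_inv (weighted_covariance \<xi> lam' Ys Ss n \<omega>) *v X n \<omega>)" for n \<omega>
    unfolding X_eq[symmetric] wc by (simp add: matrix_vector_mult_scaleR)
  show ?thesis
    unfolding X_eq quad V_eq using X_asymptotically_normal X_quadratic_form[OF _ alpha] by blast
qed

end
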